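(* Let $n>k\ge1$ be coprime integers, $\eta$ in the upper half-plane, $\Lambda=\mathbb{Z}+\mathbb{Z}\eta$, $E=\mathbb{C}/\Lambda$. For all $\tau\in\mathbb{C}\setminus\big(\frac1{2n}\Lambda\setminus\frac1n\Lambda\big)$, $\dim\mathrm{rel}_{n,k}(E,\tau)=\binom n2$.
   Context: Write $e(z)=e^{2\pi i z}$ and $\theta(z)=\sum_{m\in\mathbb{Z}}(-1)^m e\big(mz+\tfrac12 m(m-1)\eta\big)$. For $\alpha\in\mathbb{Z}$ put $\theta_\alpha(z)=e\big(\alpha z+\tfrac{\alpha}{2n}+\tfrac{\alpha(\alpha-n)}{2n}\eta\big)\prod_{m=0}^{n-1}\theta\big(z+\tfrac mn+\tfrac{\alpha}{n}\eta\big)$, regarded as indexed by $\alpha\in\mathbb{Z}_n$. Let $V$ be an $n$-dimensional complex vector space with basis $x_i$, $i\in\mathbb{Z}_n$. For $\tau\in\mathbb{C}\setminus\frac1n\Lambda$ and $z\in\mathbb{C}$, define $R_\tau(z)\in\mathrm{End}(V\otimes V)$ by $$R_\tau(z)(x_i\otimes x_j)=\frac{\theta_0(-z)\cdots\theta_{n-1}(-z)}{\theta_1(0)\cdots\theta_{n-1}(0)}\sum_{r\in\mathbb{Z}_n}\frac{\theta_{j-i+r(k-1)}(-z+\tau)}{\theta_{j-i-r}(-z)\,\theta_{kr}(\tau)}\,x_{j-r}\otimes x_{i+r}.$$ The space of quadratic relations is $\mathrm{rel}_{n,k}(E,\tau):=\operatorname{im}R_\tau(\tau)\subseteq V\otimes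 V$ for $\tau\notin\frac1n\Lambda$; for $\tau\in\frac1n\Lambda$, $R_\tau(\tau)$ is replaced by $R_+(\tau):=\lim_{t\to0}R_t(t+\tau)$. *)

theory Defs
  imports "HOL-Analysis.Analysis" "Jordan_Normal_Form.DL_Rank"
begin

definition ee :: "complex \<Rightarrow> complex" where
  "ee z = exp (2 * of_real pi * \<i> * z)"

definition theta :: "complex \<Rightarrow> complex \<Rightarrow> complex" where
  "theta \<eta> z = (\<Sum>\<^sub>\<infinity> m::int. (-1) powi m * ee (of_int m * z + of_int (m * (m - 1)) / 2 * \<eta>))"

definition theta_int :: "nat \<Rightarrow> complex \<Rightarrow> int \<Rightarrow> complex \<Rightarrow> complex" where
  "theta_int n \<eta> \<alpha> z =
     ee (of_int \<alpha> * z + of_int \<alpha> / (2 * of_nat n) + of_int (\<alpha> * (\<alpha> - int n)) / (2 * of_nat n) * \<eta>)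
     * (\<Prod>m<n. theta \<eta> (z + of_nat m / of_nat n + of_int \<alpha> / of_nat n * \<eta>))"

definition thetaZ :: "nat \<Rightarrow> complex \<Rightarrow> int \<Rightarrow> complex \<Rightarrow> complex" where
  "thetaZ n \<eta> \<alpha> z = theta_int n \<eta> (\<alpha> mod int n) z"

text \<open>Coefficient of x_a (x) x_b in R_tau(z)(x_i (x) x_j), all indices in {0..n-1} representing Z_n.\<close>
definition R_coeff :: "nat \<Rightarrow> nat \<Rightarrow> complex \<Rightarrow> complex \<Rightarrow> complex \<Rightarrow> nat \<Rightarrow> nat \<Rightarrow> nat \<Rightarrow> nat \<Rightarrow> complex" where
  "R_coeff n k \<eta> \<tau> z a b i j =
     (\<Prod>\<alpha><n. thetaZ n \<eta> (int \<alpha>) (- z)) / (\<Prod>\<alpha>\<in>{1..<n}. thetaZ n \<eta> (int \<alpha>) 0)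
     * (\<Sum>r\<in>{r. r < n \<and> (int j - int r) mod int n = int a \<and> (int i + int r) mod int n = int b}.
          thetaZ n \<eta> (int j - int i + int r * (int k - 1)) (- z + \<tau>)
          / (thetaZ n \<eta> (int j - int i - int r) (- z) * thetaZ n \<eta> (int k * int r) \<tau>))"

text \<open>Matrix of R_tau(z) on V (x) V w.r.t. the basis x_i (x) x_j, indexed by i*n+j.\<close>
definition R_mat :: "nat \<Rightarrow> nat \<Rightarrow> complex \<Rightarrow> complex \<Rightarrow> complex \<Rightarrow> complex mat" where
  "R_mat n k \<eta> \<tau> z = mat (n * n) (n * n)
     (\<lambda>(p, q). R_coeff n k \<eta> \<tau> z (p div n) (p mod n) (q div n) (q mod n))"

definition R_plus_mat :: "nat \<Rightarrow> nat \<Rightarrow> complex \<Rightarrow> complex \<Rightarrow> complex mat" where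
  "R_plus_mat n k \<eta> \<tau> = mat (n * n) (n * n)
     (\<lambda>(p, q). Lim (at 0) (\<lambda>t. R_coeff n k \<eta> t (t + \<tau>) (p div n) (p mod n) (q div n) (q mod n)))"

definition lattice :: "complex \<Rightarrow> complex set" where
  "lattice \<eta> = {of_int a + of_int b * \<eta> | a b. True}"

definition frac_lattice :: "nat \<Rightarrow> complex \<Rightarrow> complex set" where
  "frac_lattice m \<eta> = (\<lambda>w. w / of_nat m) ` lattice \<eta>"

text \<open>The matrix whose image is rel_{n,k}(E,tau).\<close>
definition rel_mat :: "nat \<Rightarrow> nat \<Rightarrow> complex \<Rightarrow> complex \<Rightarrow> complex mat" where
  "rel_mat n k \<eta> \<tau> =
     (if \<tau> \<in> frac_lattice n \<eta> then R_plus_mat n k \<eta> \<tau> else R_mat n k \<eta> \<tau> \<tau>)"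

definition dim_rel :: "nat \<Rightarrow> nat \<Rightarrow> complex \<Rightarrow> complex \<Rightarrow> nat" where
  "dim_rel n k \<eta> \<tau> = vec_space.rank (n * n) (rel_mat n k \<eta> \<tau>)"

end

theory Submission
  imports Defs "HOL-Complex_Analysis.Complex_Analysis" "Jordan_Normal_Form.Matrix_Kernel"
begin

text \<open>Fix \<open>\<tau>\<close> and put \<open>A = R\<^sub>\<tau>(\<tau>)\<close>, \<open>B = R\<^sub>\<tau>(-\<tau>)\<close>. By Liouville's theorem for elliptic
  functions, \<open>R\<^sub>\<tau>(z) R\<^sub>\<tau>(-z)\<close> is a scalar function of \<open>z\<close>, which vanishes at \<open>z = \<tau>\<close>, and only to first order
  if \<open>2\<tau>\<close> is not in \<open>(1/n)\<Lambda>\<close>. Hence \<open>A B = 0\<close>, so the ranks of \<open>A\<close> and \<open>B\<close> add up to at most \<open>n\<^sup>2\<close>; and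
  differentiating at \<open>\<tau>\<close> writes an invertible matrix as \<open>A U + W B\<close>, so they add up to at least
  \<open>n\<^sup>2\<close>. Both ranks are lower semicontinuous in \<open>\<tau>\<close> and have a constant sum, so they are constant on the connected
  complement of the countable set \<open>(1/2n)\<Lambda>\<close>. For \<open>\<tau> \<longlongrightarrow> 0\<close> the matrices \<open>A\<close> and \<open>B\<close> tend to \<open>1 - P\<close> and \<open>1 + P\<close>,
  where \<open>P\<close> is the flip of the two tensor factors, and the same argument at \<open>0\<close> identifies the ranks.
  For \<open>\<tau>\<close> in \<open>(1/n)\<Lambda>\<close>, quasi-periodicity turns \<open>R\<^sub>+(\<tau>)\<close> into \<open>1 - P\<close> up to monomial changes of basis.\<close>

section \<open>The theta series\<close>

text \<open>No closed form of the scalar is computed. Averaging the diagonal entries of R(z) R(-z)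
  over j - i gives a double sum over Z_n from which k has disappeared, and at z = \<tau> its
  summands cancel in pairs. The scalar vanishes at -\<tau> as well. If 2\<tau> lies in
  (1/n)\<Lambda> but \<tau> does not, the two zeros merge modulo (1/n)\<Lambda> into a double one
  and the derivative at \<tau> carries no information; this is why such \<tau> are excluded. The
  obstacle in applying Liouville is that the entries are not elliptic one by one for (1/n)\<Lambda>:
  translation by \<eta>/n raises D = j - i by one, and translation by 1/n produces a root of unity.
  The arguments therefore treat whole families indexed by D. As division by zero yields 0, values at
  poles say nothing, and removable singularities are expressed through limits. Everything rests on
  the zeros of theta being exactly \<Lambda>, with a simple one at the origin. They are found by
  comparison with an infinite product instead of a contour integral.\<close>

lemma ee_add: "ee (a + b) = ee a * ee b"
  by (simp add: ee_def distrib_left exp_add)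

lemma ee_minus: "ee (- a) = inverse (ee a)"
  by (simp add: ee_def exp_minus)

lemma ee_diff: "ee (a - b) = ee a / ee b"
  using ee_add[of a "- b"] by (simp add: ee_minus divide_inverse)

lemma ee_0 [simp]: "ee 0 = 1"
  by (simp add: ee_def)

lemma ee_nz [simp]: "ee a \<noteq> 0"
  by (simp add: ee_def)

lemma ee_of_int [simp]: "ee (of_int m) = 1"
  unfolding ee_def exp_eq_1 by (auto simp: mult.commute)

lemma ee_of_nat [simp]: "ee (of_nat m) = 1"
  using ee_of_int[of "int m"] by simp

lemma ee_1 [simp]: "ee 1 = 1"
  using ee_of_int[of 1] by simp

lemma ee_half: "ee (1 / 2) = - 1"
  by (simp add: ee_def exp_eq_polar)

lemma ee_mult_of_nat: "ee (of_nat m * a) = ee a ^ m"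
  by (simp add: ee_def flip: exp_of_nat_mult) (simp add: mult_ac)

lemma ee_sum: "finite A \<Longrightarrow> ee (\<Sum>x\<in>A. f x) = (\<Prod>x\<in>A. ee (f x))"
  by (induction A rule: finite_induct) (auto simp: ee_add)

lemma ee_eq_1_iff: "ee a = 1 \<longleftrightarrow> a \<in> \<int>"
proof
  assume "ee a = 1"
  then obtain m :: int where m: "Im (2 * of_real pi * \<i> * a) = of_int (2 * m) * pi" "Re (2 * of_real pi * \<i> * a) = 0"
    by (auto simp: ee_def exp_eq_1)
  then have "a = of_int m" by (auto simp: complex_eq_iff)
  then show "a \<in> \<int>" by simp
qed (auto elim: Ints_cases)

lemma ee_DERIV [derivative_intros]:
  "(f has_field_derivative D) (at x within S) \<Longrightarrow>
   ((\<lambda>x. ee (f x)) has_field_derivative (2 * of_real pi * \<i> * ee (f x) * D)) (at x within S)"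
  unfolding ee_def by (auto intro!: derivative_eq_intros)

lemma holomorphic_on_ee [holomorphic_intros]:
  "f holomorphic_on S \<Longrightarrow> (\<lambda>x. ee (f x)) holomorphic_on S"
  unfolding ee_def by (intro holomorphic_intros)

text \<open>Coefficient ratios tending to 0 give an infinite radius of convergence. This covers both
  \<open>theta_half\<close> and \<open>qprod\<close>, whose ratios decay like powers of
  \<open>nome\<close>.\<close>

lemma entire_power_series:
  fixes c r :: "nat \<Rightarrow> complex"
  assumes c: "\<And>m. c (Suc m) = r m * c m" and r: "r \<longlonglongrightarrow> 0"
  shows "summable (\<lambda>m. norm (c m * x ^ m))"
    and "(\<lambda>x. \<Sum>m. c m * x ^ m) holomorphic_on UNIV"
proof -
  have S: "summable (\<lambda>m. norm (c m * x ^ m))" for x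
  proof -
    have "(\<lambda>m. norm (r m * x)) \<longlonglongrightarrow> 0"
      using tendsto_norm[OF tendsto_mult[OF r tendsto_const[of x]]] by simp
    then have "eventually (\<lambda>m. norm (r m * x) < 1/2) sequentially"
      by (rule order_tendstoD) simp
    then obtain N where N: "\<And>m. m \<ge> N \<Longrightarrow> norm (r m * x) < 1/2"
      by (auto simp: eventually_sequentially)
    show ?thesis
    proof (rule summable_ratio_test[where c = "1/2" and N = N])
      fix m assume "N \<le> m"
      have "norm (c (Suc m) * x ^ Suc m) = norm (r m * x) * norm (c m * x ^ m)"
        by (simp add: c norm_mult)
      also have "\<dots> \<le> 1/2 * norm (c m * x ^ m)"
        using N[OF \<open>N \<le> m\<close>] by (intro mult_right_mono) auto
      finally show "norm (norm (c (Suc m) * x ^ Suc m)) \<le> 1/2 * norm (norm (c m * x ^ m))"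
        by simp
    qed simp
  qed
  show "summable (\<lambda>m. norm (c m * x ^ m))" by (rule S)
  show "(\<lambda>x. \<Sum>m. c m * x ^ m) holomorphic_on UNIV"
    using termdiffs_strong_converges_everywhere[OF summable_norm_cancel[OF S]]
    by (auto simp: holomorphic_on_def field_differentiable_def)
qed

locale upper_half_plane =
  fixes \<eta> :: complex
  assumes Im_eta: "Im \<eta> > 0"
begin

definition "nome = ee \<eta>"

lemma nome_nz [simp]: "nome \<noteq> 0"
  by (simp add: nome_def)

lemma norm_nome: "norm nome < 1"
  using Im_eta by (simp add: nome_def ee_def)

lemma nome_power_neq_1: "m > 0 \<Longrightarrow> nome ^ m \<noteq> 1"
  using norm_nome power_eq_1_iff by fastforce

lemma nome_power_tendsto: "(\<lambda>m. nome ^ m) \<longlonglongrightarrow> 0"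
  by (rule LIMSEQ_power_zero) (use norm_nome in auto)

definition "theta_coeff m = (-1) ^ m * nome ^ (m choose 2)"
text \<open>The terms of \<open>theta\<close> with index \<open>m \<ge> 0\<close>, as a power series in \<open>ee z\<close>; the terms with
  \<open>m < 0\<close> are given by the same entire function.\<close>

definition "theta_half x = (\<Sum>m. theta_coeff m * x ^ m)"

lemma theta_coeff_Suc: "theta_coeff (Suc m) = (- (nome ^ m)) * theta_coeff m"
  by (simp add: theta_coeff_def numeral_2_eq_2 power_add)

lemma theta_coeff_summable: "summable (\<lambda>m. norm (theta_coeff m * x ^ m))"
  and theta_half_holo: "theta_half holomorphic_on UNIV"
proof -
  have "(\<lambda>m. - (nome ^ m)) \<longlonglongrightarrow> 0"
    using tendsto_minus[OF nome_power_tendsto] by simp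
  from entire_power_series[OF theta_coeff_Suc this] show "summable (\<lambda>m. norm (theta_coeff m * x ^ m))"
    "theta_half holomorphic_on UNIV" by (simp_all add: theta_half_def[abs_def])
qed

abbreviation theta_term :: "complex \<Rightarrow> int \<Rightarrow> complex" where
  "theta_term z m \<equiv> (-1) powi m * ee (of_int m * z + of_int (m * (m - 1)) / 2 * \<eta>)"

lemma ee_choose_two: "ee (of_int (int m * (int m - 1)) / 2 * \<eta>) = nome ^ (m choose 2)"
proof -
  have "of_nat (m choose 2) = (of_int (int m * (int m - 1)) / 2 :: complex)"
    by (induction m) (auto simp: numeral_2_eq_2 field_simps)
  then have e: "of_int (int m * (int m - 1)) / 2 * \<eta> = of_nat (m choose 2) * \<eta>"
    by simp
  show ?thesis unfolding e nome_def by (rule ee_mult_of_nat)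
qed

lemma theta_term_nat: "theta_term z (int m) = theta_coeff m * ee z ^ m"
  unfolding ee_add ee_choose_two theta_coeff_def using ee_mult_of_nat[of m z] by simp

text \<open>At the index -m-1 the exponent m(m-1)/2 turns into 1 + 2m + m(m-1)/2. The negative half
  is thus the same power series, evaluated at \<open>nome ^ 2 * ee (- z)\<close>.\<close>

lemma theta_term_neg: "theta_term z (- int m - 1) = - nome * ee (- z) * (theta_coeff m * (nome ^ 2 * ee (- z)) ^ m)"
proof -
  have e: "of_int (- int m - 1) * z + of_int ((- int m - 1) * ((- int m - 1) - 1)) / 2 * \<eta>
     = \<eta> + (- z) + (of_int (int m * (int m - 1)) / 2 * \<eta> + of_nat m * (of_nat 2 * \<eta> + (- z)))"
    by (simp add: field_simps)
  have "(-1 :: complex) powi (- int m - 1) = - ((-1) ^ m)"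
    by (simp add: power_int_diff power_int_minus flip: power_inverse)
  then show ?thesis
    unfolding e unfolding ee_add ee_choose_two ee_mult_of_nat
    by (simp add: theta_coeff_def nome_def)
qed

lemma theta_has_sum:
  "(theta_term z has_sum (theta_half (ee z) - nome * ee (- z) * theta_half (nome ^ 2 * ee (- z)))) UNIV"
proof -
  have 1: "((\<lambda>m. theta_coeff m * x ^ m) has_sum theta_half x) UNIV" for x
    unfolding theta_half_def
    by (rule norm_summable_imp_has_sum[OF theta_coeff_summable])
       (use summable_sums[OF summable_norm_cancel[OF theta_coeff_summable]] in simp)
  have U: "(UNIV :: int set) = range int \<union> range (\<lambda>m. - int m - 1)"
  proof -
    have "x \<in> range int \<union> range (\<lambda>m. - int m - 1)" for x
    proof (cases "x \<ge> 0")
      case True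
      then have "x = int (nat x)" by simp
      then show ?thesis by (metis UnI1 rangeI)
    next
      case False
      then have "x = - int (nat (- x - 1)) - 1" by simp
      then show ?thesis by (metis (no_types, lifting) UnI2 rangeI)
    qed
    then show ?thesis by auto
  qed
  have D: "range int \<inter> range (\<lambda>m. - int m - 1) = {}" by auto
  have "(theta_term z has_sum theta_half (ee z)) (range int)"
    by (subst has_sum_reindex) (unfold o_def theta_term_nat, auto intro!: 1)
  moreover have "(theta_term z has_sum (- nome * ee (- z) * theta_half (nome ^ 2 * ee (- z)))) (range (\<lambda>m. - int m - 1))"
    by (subst has_sum_reindex) (unfold o_def theta_term_neg, auto simp: inj_on_def intro!: has_sum_cmult_right 1 has_sum_uminusI)
  ultimately show ?thesis
    unfolding U using has_sum_Un_disjoint[OF _ _ D] by fastforce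
qed

lemma theta_eq: "theta \<eta> z = theta_half (ee z) - nome * ee (- z) * theta_half (nome ^ 2 * ee (- z))"
  unfolding theta_def by (rule infsumI[OF theta_has_sum])

lemma theta_holo: "theta \<eta> holomorphic_on UNIV"
proof -
  have h: "(\<lambda>z. theta_half (f z)) holomorphic_on UNIV" if "f holomorphic_on UNIV" for f
    using holomorphic_on_compose_gen[OF that theta_half_holo] by (simp add: o_def)
  have e: "(\<lambda>z. ee (- z)) holomorphic_on UNIV" "ee holomorphic_on UNIV"
    using holomorphic_on_ee[OF holomorphic_on_minus[OF holomorphic_on_ident], of UNIV]
      holomorphic_on_ee[OF holomorphic_on_ident, of UNIV] by simp_all
  then show ?thesis
    unfolding theta_eq[abs_def]
    by (intro holomorphic_on_diff holomorphic_on_mult holomorphic_on_const h e)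
qed

lemma theta_plus_1: "theta \<eta> (z + 1) = theta \<eta> z"
  by (simp add: theta_def distrib_left ee_add)

text \<open>The shift m -> m - 1 of the summation index absorbs the extra m \<eta> into the
  quadratic exponent.\<close>

lemma theta_plus_eta: "theta \<eta> (z + \<eta>) = - ee (- z) * theta \<eta> z"
proof -
  have "theta \<eta> (z + \<eta>) = (\<Sum>\<^sub>\<infinity>m. theta_term (z + \<eta>) (m - 1))"
    unfolding theta_def
    by (rule infsum_reindex_bij_betw[symmetric]) (rule bij_betwI[of _ _ _ "\<lambda>m. m + 1"], auto)
  also have "\<dots> = (\<Sum>\<^sub>\<infinity>m. (- ee (- z)) * theta_term z m)"
  proof (rule infsum_cong)
    fix m :: int
    have e: "of_int (m - 1) * (z + \<eta>) + of_int ((m - 1) * (m - 1 - 1)) / 2 * \<eta>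
       = (- z) + (of_int m * z + of_int (m * (m - 1)) / 2 * \<eta>)"
      by (simp add: field_simps)
    have "(-1 :: complex) powi (m - 1) = - ((-1) powi m)"
      by (simp add: power_int_diff)
    then show "theta_term (z + \<eta>) (m - 1) = (- ee (- z)) * theta_term z m"
      unfolding e ee_add[of "- z"] by simp
  qed
  also have "\<dots> = - ee (- z) * theta \<eta> z"
    unfolding theta_def by (rule infsum_cmult_right')
  finally show ?thesis .
qed

text \<open>The reflection m -> 1 - m fixes m(m-1)/2.\<close>

lemma theta_uminus: "theta \<eta> (- z) = - ee (- z) * theta \<eta> z"
proof -
  have "theta \<eta> (- z) = (\<Sum>\<^sub>\<infinity>m. theta_term (- z) (1 - m))"
    unfolding theta_def
    by (rule infsum_reindex_bij_betw[symmetric]) (rule bij_betwI[of _ _ _ "\<lambda>m. 1 - m"], auto)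
  also have "\<dots> = (\<Sum>\<^sub>\<infinity>m. (- ee (- z)) * theta_term z m)"
  proof (rule infsum_cong)
    fix m :: int
    have e: "of_int (1 - m) * (- z) + of_int ((1 - m) * (1 - m - 1)) / 2 * \<eta>
       = (- z) + (of_int m * z + of_int (m * (m - 1)) / 2 * \<eta>)"
      by (simp add: field_simps)
    have "(-1 :: complex) powi (1 - m) = - ((-1) powi m)"
      by (simp add: power_int_diff power_int_minus_left)
    then show "theta_term (- z) (1 - m) = (- ee (- z)) * theta_term z m"
      unfolding e ee_add[of "- z"] by simp
  qed
  also have "\<dots> = - ee (- z) * theta \<eta> z"
    unfolding theta_def by (rule infsum_cmult_right')
  finally show ?thesis .
qed

lemma theta_0: "theta \<eta> 0 = 0"
  using theta_uminus[of 0] by simp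

end

section \<open>Elliptic functions and the zeros of theta\<close>

text \<open>The difference quotient has a removable singularity at \<open>a\<close>. Splitting off
  linear factors in this way replaces any calculus of orders of zeros.\<close>

lemma zero_factor:
  assumes "f holomorphic_on UNIV" "f a = (0::complex)"
  obtains g where "g holomorphic_on UNIV" "\<And>z. f z = (z - a) * g z" "g a = deriv f a"
proof
  let ?g = "\<lambda>z. if z = a then deriv f a else (f z - f a) / (z - a)"
  show "?g holomorphic_on UNIV" by (rule pole_lemma_open) (use assms in auto)
  show "f z = (z - a) * ?g z" for z using assms by auto
  show "?g a = deriv f a" by simp
qed

lemma simple_zero_quotient_limit:
  assumes "f holomorphic_on UNIV" "f a = 0" "w holomorphic_on UNIV" "w a = 0" "deriv w a \<noteq> 0"
  shows "(\<lambda>z. f z / w z) \<midarrow>a\<rightarrow> deriv f a / deriv w a"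
proof -
  obtain g where g: "g holomorphic_on UNIV" "\<And>z. f z = (z - a) * g z" "g a = deriv f a"
    using zero_factor[OF assms(1,2)] by metis
  obtain v where v: "v holomorphic_on UNIV" "\<And>z. w z = (z - a) * v z" "v a = deriv w a"
    using zero_factor[OF assms(3,4)] by metis
  have c: "isCont g a" "isCont v a"
    using g(1) v(1) by (auto simp: holomorphic_on_imp_continuous_on continuous_on_eq_continuous_at
        dest!: holomorphic_on_imp_continuous_on)
  have "(\<lambda>z. g z / v z) \<midarrow>a\<rightarrow> g a / v a"
    using c v(3) assms(5) by (auto simp: isCont_def intro!: tendsto_divide)
  moreover have "eventually (\<lambda>z. g z / v z = f z / w z) (at a)"
    by (simp add: eventually_at_filter g(2) v(2))
  ultimately have "(\<lambda>z. f z / w z) \<midarrow>a\<rightarrow> g a / v a"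
    by (rule Lim_transform_eventually)
  then show ?thesis by (simp add: g(3) v(3))
qed

text \<open>Meant for the origin, where the two simple zeros of \<open>vth (- z) * vth z\<close>
  stand in a denominator.\<close>

lemma double_zero_quotient_limit:
  assumes f: "f holomorphic_on UNIV" "f a = 0" "deriv f a = 0"
    and w: "w holomorphic_on UNIV" "w a = 0" "deriv w a \<noteq> 0"
    and u: "u holomorphic_on UNIV" "u a = 0" "deriv u a \<noteq> 0"
  shows "\<exists>l. (\<lambda>z. f z / (w z * u z)) \<midarrow>a\<rightarrow> l"
proof -
  obtain g where g: "g holomorphic_on UNIV" "\<And>z. f z = (z - a) * g z" "g a = 0"
    using zero_factor[OF f(1,2)] f(3) by metis
  obtain h where h: "h holomorphic_on UNIV" "\<And>z. g z = (z - a) * h z"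
    using zero_factor[OF g(1,3)] by metis
  obtain v where v: "v holomorphic_on UNIV" "\<And>z. w z = (z - a) * v z" "v a \<noteq> 0"
    using zero_factor[OF w(1,2)] w(3) by metis
  obtain t where t: "t holomorphic_on UNIV" "\<And>z. u z = (z - a) * t z" "t a \<noteq> 0"
    using zero_factor[OF u(1,2)] u(3) by metis
  have c: "isCont h a" "isCont v a" "isCont t a"
    using h(1) v(1) t(1) by (auto simp: continuous_on_eq_continuous_at
        dest!: holomorphic_on_imp_continuous_on)
  have "(\<lambda>z. h z / (v z * t z)) \<midarrow>a\<rightarrow> h a / (v a * t a)"
    using c v(3) t(3) by (auto simp: isCont_def intro!: tendsto_divide tendsto_mult)
  moreover have "eventually (\<lambda>z. h z / (v z * t z) = f z / (w z * u z)) (at a)"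
    by (simp add: eventually_at_filter g(2) h(2) v(2) t(2))
  ultimately have "(\<lambda>z. f z / (w z * u z)) \<midarrow>a\<rightarrow> h a / (v a * t a)"
    by (rule Lim_transform_eventually)
  then show ?thesis by blast
qed

lemma periodic_of_int:
  assumes "\<And>z. f (z + p) = f (z :: 'a :: ring_1)"
  shows "f (z + of_int m * p) = f z"
proof (induction m rule: int_induct[where k = 0])
  case (step1 i)
  then show ?case using assms[of "z + of_int i * p"] by (simp add: algebra_simps)
next
  case (step2 i)
  then show ?case using assms[of "z + of_int (i - 1) * p"] by (simp add: algebra_simps)
qed simp

lemma removable_shift:
  assumes "(f \<longlongrightarrow> l) (at (z + p :: complex))" "\<And>w. f (w + p) = f w"
  shows "(f \<longlongrightarrow> l) (at z)"
  using LIM_offset[OF assms(1), of p] assms(2) by simp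

section \<open>Liouville's theorem for elliptic functions\<close>

context upper_half_plane
begin

lemma latticeI: "of_int a + of_int b * \<eta> \<in> lattice \<eta>"
  by (auto simp: lattice_def)

lemma fundamental_parallelogram:
  obtains m k :: int and s t :: real
  where "z = of_real s + of_real t * \<eta> + of_int m * 1 + of_int k * \<eta>" "s \<in> {0..1}" "t \<in> {0..1}"
proof -
  define y where "y = Im z / Im \<eta>"
  define x where "x = Re z - y * Re \<eta>"
  have "z = of_real x + of_real y * \<eta>"
    using Im_eta by (simp add: x_def y_def complex_eq_iff)
  also have "\<dots> = of_real (frac x) + of_real (frac y) * \<eta> + of_int \<lfloor>x\<rfloor> * 1 + of_int \<lfloor>y\<rfloor> * \<eta>"
    by (simp add: frac_def algebra_simps)
  finally show ?thesis
    by (rule that) (auto simp: frac_ge_0 less_imp_le[OF frac_lt_1])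
qed

text \<open>Hypothesis and conclusion speak of limits because a quotient has the value 0 wherever
  its denominator vanishes. Filling in the limits gives an entire function whose range is the image
  of one compact period parallelogram.\<close>

lemma elliptic_limit_const:
  assumes mero: "f meromorphic_on UNIV"
    and lim: "\<And>z. \<exists>l. (f \<longlongrightarrow> l) (at z)"
    and per: "\<And>z. f (z + 1) = f z" "\<And>z. f (z + \<eta>) = f z"
  obtains c where "\<And>z. (f \<longlongrightarrow> c) (at z)"
proof -
  define g where "g = remove_sings f"
  have L: "(f \<longlongrightarrow> g z) (at z)" for z
    using lim[of z] remove_sings_eqI[of f] unfolding g_def by metis
  have "g analytic_on {z}" for z
    unfolding g_def
    by (rule remove_sings_analytic_at[OF _ L]) (use mero meromorphic_at_iff meromorphic_on_subset in blast)
  then have holo: "g holomorphic_on UNIV"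
    by (meson analytic_imp_holomorphic analytic_on_analytic_at)
  have gp: "g (z + 1) = g z" "g (z + \<eta>) = g z" for z
    using removable_shift[OF L per(1)] removable_shift[OF L per(2)] L[of z]
    by (auto intro: tendsto_unique[OF at_neq_bot])
  define K where "K = (\<lambda>(s, t). of_real s + of_real t * \<eta>) ` ({0..1::real} \<times> {0..1::real})"
  have "compact K"
    unfolding K_def case_prod_beta
    by (intro compact_continuous_image compact_Times continuous_intros) auto
  then have "compact (g ` K)"
    using holo by (intro compact_continuous_image) (auto intro: holomorphic_on_imp_continuous_on holomorphic_on_subset)
  moreover have "range g \<subseteq> g ` K"
  proof clarify
    fix z
    obtain m k s t where z: "z = of_real s + of_real t * \<eta> + of_int m * 1 + of_int k * \<eta>" "s \<in> {0..1}" "t \<in> {0..1}"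
      by (rule fundamental_parallelogram)
    have "g z = g (of_real s + of_real t * \<eta>)"
      unfolding z(1) by (simp only: periodic_of_int[of g, OF gp(1)] periodic_of_int[of g, OF gp(2)])
    moreover have "of_real s + of_real t * \<eta> \<in> K" using z(2,3) unfolding K_def by force
    ultimately show "g z \<in> g ` K" by simp
  qed
  ultimately have "bounded (range g)"
    using bounded_subset compact_imp_bounded by blast
  then obtain c where "\<And>z. g z = c"
    using Liouville_theorem[OF holo] by (auto simp: constant_on_def)
  then show ?thesis using that L by metis
qed

text \<open>The infinite product of the \<open>1 - x nome\<^sup>m\<close> over \<open>m \<ge> 0\<close>, through its power series (Euler).\<close>

definition "qprod_coeff m = (\<Prod>j<m. - (nome ^ j) / (1 - nome ^ Suc j))"
definition "qprod x = (\<Sum>m. qprod_coeff m * x ^ m)"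

lemma qprod_coeff_Suc: "qprod_coeff (Suc m) = - (nome ^ m) / (1 - nome ^ Suc m) * qprod_coeff m"
  by (simp add: qprod_coeff_def)

lemma qprod_summable: "summable (\<lambda>m. norm (qprod_coeff m * x ^ m))"
  and qprod_holo: "qprod holomorphic_on UNIV"
proof -
  have "(\<lambda>m. - (nome ^ m) / (1 - nome ^ Suc m)) \<longlonglongrightarrow> - 0 / (1 - 0)"
    using nome_power_tendsto LIMSEQ_Suc[OF nome_power_tendsto]
    by (intro tendsto_divide tendsto_minus tendsto_diff tendsto_const) auto
  then have r: "(\<lambda>m. - (nome ^ m) / (1 - nome ^ Suc m)) \<longlonglongrightarrow> 0" by simp
  from entire_power_series[OF qprod_coeff_Suc r] show "summable (\<lambda>m. norm (qprod_coeff m * x ^ m))"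
    "qprod holomorphic_on UNIV" by (simp_all add: qprod_def[abs_def])
qed

lemma qprod_sums: "(\<lambda>m. qprod_coeff m * x ^ m) sums qprod x"
  unfolding qprod_def by (rule summable_sums[OF summable_norm_cancel[OF qprod_summable]])

lemma qprod_0: "qprod 0 = 1"
  using qprod_sums[of 0] powser_sums_zero_iff[of qprod_coeff 1] by (simp add: qprod_coeff_def qprod_def)

text \<open>Comparing the coefficients of x^(m+1) leaves the recursion that defines
  \<open>qprod_coeff\<close>.\<close>

lemma qprod_rec: "qprod x = (1 - x) * qprod (nome * x)"
proof -
  have 1: "(\<lambda>m. qprod_coeff (Suc m) * x ^ Suc m) sums (qprod x - 1)"
    using qprod_sums[of x] by (subst sums_Suc_iff) (simp add: qprod_coeff_def)
  have 2: "(\<lambda>m. qprod_coeff (Suc m) * (nome * x) ^ Suc m) sums (qprod (nome * x) - 1)"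
    using qprod_sums[of "nome * x"] by (subst sums_Suc_iff) (simp add: qprod_coeff_def)
  have "(\<lambda>m. qprod_coeff (Suc m) * (nome * x) ^ Suc m - x * (qprod_coeff m * (nome * x) ^ m)) sums
     ((qprod (nome * x) - 1) - x * qprod (nome * x))"
    by (intro sums_diff sums_mult 2 qprod_sums)
  also have "(\<lambda>m. qprod_coeff (Suc m) * (nome * x) ^ Suc m - x * (qprod_coeff m * (nome * x) ^ m))
      = (\<lambda>m. qprod_coeff (Suc m) * x ^ Suc m)"
  proof
    fix m
    have "1 - nome ^ Suc m \<noteq> 0" using nome_power_neq_1[of "Suc m"] by simp
    then have "qprod_coeff (Suc m) * (1 - nome ^ Suc m) = - (nome ^ m) * qprod_coeff m"
      unfolding qprod_coeff_Suc by (simp add: divide_simps)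
    then have "qprod_coeff (Suc m) * nome ^ Suc m = qprod_coeff (Suc m) + nome ^ m * qprod_coeff m"
      by (simp add: algebra_simps)
    then show "qprod_coeff (Suc m) * (nome * x) ^ Suc m - x * (qprod_coeff m * (nome * x) ^ m) = qprod_coeff (Suc m) * x ^ Suc m"
      unfolding power_mult_distrib mult.assoc[symmetric] by (simp add: algebra_simps)
  qed
  finally show ?thesis using sums_unique2[OF 1] by (simp add: algebra_simps)
qed

lemma qprod_cont: "isCont qprod x"
  using qprod_holo by (auto simp: continuous_on_eq_continuous_at dest!: holomorphic_on_imp_continuous_on)

text \<open>If no factor 1 - x \<open>nome\<close>^m vanishes, the functional equation carries the
  zero along the points x \<open>nome\<close>^m. These tend to 0, where the value is 1.\<close>

lemma qprod_zero:
  assumes "qprod x = 0"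
  obtains m where "x * nome ^ m = 1"
proof -
  have "\<exists>m. x * nome ^ m = 1"
  proof (rule ccontr)
    assume *: "\<not> ?thesis"
    have "qprod (nome ^ m * x) = 0" for m
    proof (induction m)
      case (Suc m)
      then show ?case using qprod_rec[of "nome ^ m * x"] * by (auto simp: mult_ac)
    qed (use assms in simp)
    moreover have "(\<lambda>m. nome ^ m * x) \<longlonglongrightarrow> 0"
      using tendsto_mult_left_zero[OF nome_power_tendsto] by simp
    then have "(\<lambda>m. qprod (nome ^ m * x)) \<longlonglongrightarrow> qprod 0"
      by (rule isCont_tendsto_compose[OF qprod_cont])
    ultimately show False using qprod_0 LIMSEQ_unique tendsto_const by fastforce
  qed
  then show ?thesis using that by blast
qed

lemma qprod_nome_nz: "qprod nome \<noteq> 0"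
proof
  assume "qprod nome = 0"
  then obtain m where "nome * nome ^ m = 1" by (rule qprod_zero)
  then show False using nome_power_neq_1[of "Suc m"] by simp
qed

text \<open>The product side of the Jacobi triple product identity, up to a constant factor.\<close>

definition "theta_product z = qprod (ee z) * qprod (nome * ee (- z))"

lemma qprod_compose_holo: "f holomorphic_on UNIV \<Longrightarrow> (\<lambda>z. qprod (f z)) holomorphic_on UNIV"
  using holomorphic_on_compose_gen[OF _ qprod_holo] by (auto simp: o_def)

lemma ee_holo: "(\<lambda>z. ee (- z)) holomorphic_on UNIV" "ee holomorphic_on UNIV"
  using holomorphic_on_ee[OF holomorphic_on_minus[OF holomorphic_on_ident], of UNIV]
    holomorphic_on_ee[OF holomorphic_on_ident, of UNIV] by simp_all

lemma theta_product_holo: "theta_product holomorphic_on UNIV"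
  unfolding theta_product_def[abs_def]
  by (intro holomorphic_on_mult holomorphic_on_const qprod_compose_holo ee_holo)

lemma theta_product_plus_1: "theta_product (z + 1) = theta_product z"
  unfolding theta_product_def ee_minus ee_add by simp

text \<open>The translation removes the factor \<open>1 - ee z\<close> from the first product and
  adds \<open>1 - ee (- z)\<close> to the second. Their quotient is the multiplier of theta.\<close>

lemma theta_product_plus_eta: "theta_product (z + \<eta>) = - ee (- z) * theta_product z"
proof -
  have a: "qprod (ee (- z)) = (1 - ee (- z)) * qprod (nome * ee (- z))"
    by (rule qprod_rec)
  have b: "qprod (ee z) = (1 - ee z) * qprod (nome * ee z)"
    by (rule qprod_rec)
  have "theta_product (z + \<eta>) = qprod (nome * ee z) * qprod (ee (- z))"
    by (simp add: theta_product_def ee_add ee_minus ee_diff nome_def field_simps)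
  also have "\<dots> = qprod (nome * ee z) * (1 - ee (- z)) * qprod (nome * ee (- z))"
    by (simp add: a)
  also have "1 - ee (- z) = - ee (- z) * (1 - ee z)"
    by (simp add: ee_minus field_simps)
  also have "qprod (nome * ee z) * (- ee (- z) * (1 - ee z)) * qprod (nome * ee (- z)) = - ee (- z) * theta_product z"
    by (simp add: theta_product_def b)
  finally show ?thesis .
qed

lemma theta_product_zero:
  assumes "theta_product z = 0"
  shows "z \<in> lattice \<eta>"
proof -
  from assms consider "qprod (ee z) = 0" | "qprod (nome * ee (- z)) = 0" by (auto simp: theta_product_def)
  then show ?thesis
  proof cases
    case 1
    then obtain m where "ee z * nome ^ m = 1" by (rule qprod_zero)
    then have "ee (z + of_nat m * \<eta>) = 1" by (simp add: ee_add ee_mult_of_nat nome_def)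
    then obtain k where "z + of_nat m * \<eta> = of_int k" by (auto simp: ee_eq_1_iff elim: Ints_cases)
    then have "z = of_int k + of_int (- int m) * \<eta>" by (simp add: algebra_simps)
    then show ?thesis using latticeI by metis
  next
    case 2
    then obtain m where "nome * ee (- z) * nome ^ m = 1" by (rule qprod_zero)
    then have "ee (of_nat (Suc m) * \<eta> + (- z)) = 1" unfolding ee_add ee_mult_of_nat by (simp add: nome_def mult_ac)
    then obtain k where "of_nat (Suc m) * \<eta> + (- z) = of_int k" by (auto simp: ee_eq_1_iff elim: Ints_cases)
    then have "z = of_int (- k) + of_int (int (Suc m)) * \<eta>" by (simp add: algebra_simps)
    then show ?thesis using latticeI by metis
  qed
qed

lemma theta_product_0: "theta_product 0 = 0" and deriv_tp_0: "deriv theta_product 0 \<noteq> 0"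
proof -
  let ?g = "\<lambda>z. qprod (nome * ee z) * qprod (nome * ee (- z))"
  have "?g holomorphic_on UNIV"
    by (intro holomorphic_on_mult holomorphic_on_const qprod_compose_holo ee_holo)
  then obtain D where D: "(?g has_field_derivative D) (at 0)"
    by (auto simp: holomorphic_on_def field_differentiable_def)
  \<comment> \<open>One factor of the first product carries the zero at the origin; the rest takes
    the value \<open>qprod nome ^ 2\<close> there.\<close>
  have e: "theta_product = (\<lambda>z. (1 - ee z) * ?g z)"
    by (rule ext, unfold theta_product_def, subst qprod_rec) simp
  show "theta_product 0 = 0" by (simp add: e)
  have "(theta_product has_field_derivative (- (2 * of_real pi * \<i>) * ?g 0)) (at 0)"
    unfolding e by (rule derivative_eq_intros D refl | simp)+
  then show "deriv theta_product 0 \<noteq> 0"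
    using qprod_nome_nz by (simp add: DERIV_imp_deriv)
qed

text \<open>Excludes the constant 0 when theta is compared with \<open>theta_product\<close>.
  Vanishing of theta would relate \<open>theta_half\<close> at x to its values near 0 as x
  grows.\<close>

lemma theta_not_identically_zero: "\<exists>z. theta \<eta> z \<noteq> 0"
proof (rule ccontr)
  assume "\<not> ?thesis"
  then have z: "theta_half (ee z) = nome * ee (- z) * theta_half (nome ^ 2 * ee (- z))" for z
    using theta_eq[of z] by simp
  have *: "theta_half x = nome * inverse x * theta_half (nome ^ 2 * inverse x)" if "x \<noteq> 0" for x
  proof -
    have "x = ee (Ln x / (2 * of_real pi * \<i>))"
      using that by (simp add: ee_def)
    then show ?thesis using z[of "Ln x / (2 * of_real pi * \<i>)"] by (simp add: ee_minus)
  qed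
  have A0: "theta_half 0 = 1"
    using powser_zero[of theta_coeff] by (simp add: theta_half_def theta_coeff_def numeral_2_eq_2)
  txt \<open>The equation * forces \<open>theta_half\<close> to vanish at infinity.\<close>
  have "isCont theta_half 0"
    using theta_half_holo by (auto simp: continuous_on_eq_continuous_at dest!: holomorphic_on_imp_continuous_on)
  moreover have "((\<lambda>x. nome ^ 2 * inverse x) \<longlongrightarrow> 0) at_infinity"
    using tendsto_mult_right_zero[OF tendsto_inverse_0] by fastforce
  ultimately have "((\<lambda>x. theta_half (nome ^ 2 * inverse x)) \<longlongrightarrow> 1) at_infinity"
    using isCont_tendsto_compose[of 0 theta_half] A0 by fastforce
  then have "((\<lambda>x. nome * inverse x * theta_half (nome ^ 2 * inverse x)) \<longlongrightarrow> nome * 0 * 1) at_infinity"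
    by (intro tendsto_mult tendsto_const tendsto_inverse_0)
  moreover have "eventually (\<lambda>x. nome * inverse x * theta_half (nome ^ 2 * inverse x) = theta_half x) at_infinity"
    unfolding eventually_at_infinity
    by (intro exI[of _ 1] allI impI, rule *[symmetric]) auto
  ultimately have "(theta_half \<longlongrightarrow> nome * 0 * 1) at_infinity"
    by (rule Lim_transform_eventually)
  then have "(theta_half \<longlongrightarrow> 0) at_infinity" by simp
  then have "theta_half 0 = 0" by (rule Liouville_weak[OF theta_half_holo])
  then show False using A0 by simp
qed

lemma quasi_lattice_zero:
  assumes "\<And>z. f (z + 1) = f z" "\<And>z. f (z + \<eta>) = u z * f z" "\<And>z. u z \<noteq> 0" "f 0 = (0::complex)"
    "z \<in> lattice \<eta>"
  shows "f z = 0"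
proof -
  obtain a b where z: "z = of_int a + of_int b * \<eta>" using assms(5) by (auto simp: lattice_def)
  have "f (of_int b * \<eta>) = 0"
  proof (induction b rule: int_induct[where k = 0])
    case (step1 i)
    then show ?case using assms(2)[of "of_int i * \<eta>"] by (simp add: algebra_simps)
  next
    case (step2 i)
    then show ?case using assms(2,3)[of "of_int (i - 1) * \<eta>"] by (simp add: algebra_simps)
  qed (use assms in simp)
  then show ?thesis
    using periodic_of_int[of f 1 "of_int b * \<eta>" a] assms(1) unfolding z by (simp add: add_ac)
qed

lemma removable_lattice_shift:
  assumes "\<And>z. f (z + 1) = f z" "\<And>z. f (z + \<eta>) = f z" "z \<in> lattice \<eta>" "(f \<longlongrightarrow> l) (at 0)"
  shows "(f \<longlongrightarrow> l) (at (z :: complex))"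
proof -
  obtain a b where z: "z = of_int a + of_int b * \<eta>" using assms(3) by (auto simp: lattice_def)
  have "f (w + - z) = f w" for w
    using periodic_of_int[of f 1 "w" "- a", OF assms(1)]
      periodic_of_int[of f \<eta> "w + of_int (- a) * 1" "- b", OF assms(2)]
    unfolding z by (simp add: algebra_simps)
  then show ?thesis
    using removable_shift[of f l z "- z"] assms(4) by simp
qed

text \<open>The Jacobi triple product with an undetermined constant. Both functions have the same
  multipliers, so their quotient is elliptic. Its only possible poles are lattice points, and these
  reduce to the origin, where the denominator has a simple zero and theta vanishes too.\<close>

lemma theta_eq_tp: "\<exists>c. c \<noteq> 0 \<and> (\<forall>z. theta \<eta> z = c * theta_product z)"
proof -
  define f where "f z = theta \<eta> z / theta_product z" for z
  have mero: "f meromorphic_on UNIV"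
    unfolding f_def[abs_def]
    by (intro meromorphic_on_divide analytic_on_imp_meromorphic_on)
       (auto simp: analytic_on_open theta_holo theta_product_holo)
  have per: "f (z + 1) = f z" "f (z + \<eta>) = f z" for z
    by (simp_all add: f_def theta_plus_1 theta_plus_eta theta_product_plus_1 theta_product_plus_eta)
  have nz: "(f \<longlongrightarrow> f z) (at z)" if "theta_product z \<noteq> 0" for z
  proof -
    have "isCont (theta \<eta>) z" "isCont theta_product z"
      using theta_holo theta_product_holo by (auto simp: continuous_on_eq_continuous_at dest!: holomorphic_on_imp_continuous_on)
    then show ?thesis using that by (auto simp: f_def[abs_def] isCont_def intro!: tendsto_divide)
  qed
  have "\<exists>l. (f \<longlongrightarrow> l) (at z)" for z
  proof (cases "theta_product z = 0")
    case True
    obtain l where "(f \<longlongrightarrow> l) (at 0)"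
      using simple_zero_quotient_limit[OF theta_holo theta_0 theta_product_holo theta_product_0 deriv_tp_0]
      by (auto simp: f_def[abs_def])
    then show ?thesis using removable_lattice_shift[of f, OF per theta_product_zero[OF True]] by blast
  qed (use nz in blast)
  then obtain c where c: "\<And>z. (f \<longlongrightarrow> c) (at z)"
    by (rule elliptic_limit_const[OF mero _ per]) auto
  have t: "theta \<eta> z = c * theta_product z" for z
  proof (cases "theta_product z = 0")
    case True
    have "theta \<eta> z = 0"
      by (rule quasi_lattice_zero[OF theta_plus_1 theta_plus_eta _ theta_0 theta_product_zero[OF True]]) simp
    then show ?thesis using True by simp
  next
    case False
    then have "f z = c" using nz c tendsto_unique[OF at_neq_bot] by blast
    then show ?thesis using False by (simp add: f_def divide_eq_eq)
  qed
  have "c \<noteq> 0" using theta_not_identically_zero t by auto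
  with t show ?thesis by (intro exI[of _ c]) simp
qed

lemma theta_eq_0_iff: "theta \<eta> z = 0 \<longleftrightarrow> z \<in> lattice \<eta>"
proof
  assume "theta \<eta> z = 0"
  moreover obtain c where "c \<noteq> 0" "\<And>z. theta \<eta> z = c * theta_product z" using theta_eq_tp by blast
  ultimately show "z \<in> lattice \<eta>" using theta_product_zero by simp
next
  assume "z \<in> lattice \<eta>"
  then show "theta \<eta> z = 0"
    by (intro quasi_lattice_zero[OF theta_plus_1 theta_plus_eta _ theta_0]) simp_all
qed

lemma deriv_theta_0: "deriv (theta \<eta>) 0 \<noteq> 0"
proof -
  obtain c where c: "c \<noteq> 0" "\<And>z. theta \<eta> z = c * theta_product z" using theta_eq_tp by blast
  have "theta \<eta> = (\<lambda>z. c * theta_product z)" using c by auto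
  moreover have "theta_product field_differentiable (at 0)"
    using theta_product_holo by (auto simp: holomorphic_on_def)
  ultimately show ?thesis using c(1) deriv_tp_0 by (simp add: deriv_cmult)
qed

end

section \<open>The functions \<open>\<theta>\<^sub>\<alpha>\<close>\<close>

text \<open>Sums over Z_n are written as sums of n-periodic functions over one set of
  representatives. An injective self-map of this finite set is a permutation.\<close>

lemma sum_residues_reindex:
  fixes f :: "int \<Rightarrow> 'a :: comm_monoid_add"
  assumes f: "\<And>a. f (a mod int n) = f a"
    and g: "\<And>a b. a \<in> {0..<int n} \<Longrightarrow> b \<in> {0..<int n} \<Longrightarrow> g a mod int n = g b mod int n \<Longrightarrow> a = b"
  shows "(\<Sum>e\<in>{0..<int n}. f (g e)) = (\<Sum>e\<in>{0..<int n}. f e)"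
proof (cases "n = 0")
  case False
  let ?h = "\<lambda>e. g e mod int n"
  have inj: "inj_on ?h {0..<int n}" by (rule inj_onI) (use g in blast)
  moreover have "?h ` {0..<int n} \<subseteq> {0..<int n}" using False by auto
  ultimately have "bij_betw ?h {0..<int n} {0..<int n}"
    by (simp add: bij_betw_def endo_inj_surj)
  then have "(\<Sum>e\<in>{0..<int n}. f (?h e)) = (\<Sum>e\<in>{0..<int n}. f e)"
    by (rule sum.reindex_bij_betw)
  then show ?thesis by (simp add: f)
qed simp

lemma sum_residues_shift:
  fixes f :: "int \<Rightarrow> 'a :: comm_monoid_add"
  assumes "\<And>a. f (a mod int n) = f a"
  shows "(\<Sum>e\<in>{0..<int n}. f (e + c)) = (\<Sum>e\<in>{0..<int n}. f e)"
proof (rule sum_residues_reindex[where f = f, OF assms])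
  fix a b assume ab: "a \<in> {0..<int n}" "b \<in> {0..<int n}" "(a + c) mod int n = (b + c) mod int n"
  then have "((a + c) - c) mod int n = ((b + c) - c) mod int n" by (metis mod_diff_left_eq)
  then show "a = b" using ab by simp
qed

lemma deriv_mult_at_zero:
  assumes "f holomorphic_on UNIV" "g holomorphic_on UNIV" "f a = 0"
  shows "deriv (\<lambda>z. f z * g z) a = deriv f a * g a"
proof -
  have "f field_differentiable (at a)" "g field_differentiable (at a)"
    using assms by (auto simp: holomorphic_on_def)
  then show ?thesis using assms(3) by (simp add: deriv_mult)
qed

lemma entire_isCont: "f holomorphic_on UNIV \<Longrightarrow> isCont f (z :: complex)"
  by (auto simp: continuous_on_eq_continuous_at dest!: holomorphic_on_imp_continuous_on)

lemma entire_compose: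
  "g holomorphic_on UNIV \<Longrightarrow> f holomorphic_on UNIV \<Longrightarrow> (\<lambda>z. g (f z)) holomorphic_on UNIV"
  using holomorphic_on_compose_gen[of f UNIV g UNIV] by (auto simp: o_def)

lemma entire_affine: "(\<lambda>z. z + c :: complex) holomorphic_on UNIV" "(\<lambda>z. c + z :: complex) holomorphic_on UNIV"
   "(\<lambda>z. z - c :: complex) holomorphic_on UNIV"  "(\<lambda>z. - z :: complex) holomorphic_on UNIV"
   "(\<lambda>z. - z + c :: complex) holomorphic_on UNIV" "(\<lambda>z. - z - c :: complex) holomorphic_on UNIV"
  by (auto intro!: holomorphic_intros)

locale theta_level = upper_half_plane +
  fixes n :: nat
  assumes n_pos: "n > 0"
begin

abbreviation "t \<equiv> thetaZ n \<eta>"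
abbreviation "N \<equiv> (of_nat n :: complex)"
abbreviation "L \<equiv> frac_lattice n \<eta>"

lemma N_nz: "N \<noteq> 0"
  using n_pos by simp

lemma L_iff: "z \<in> L \<longleftrightarrow> N * z \<in> lattice \<eta>"
  using N_nz by (auto simp: frac_lattice_def image_iff field_simps)

lemma L_iff': "z \<in> L \<longleftrightarrow> (\<exists>a b. z = (of_int a + of_int b * \<eta>) / N)"
  by (auto simp: frac_lattice_def lattice_def)

lemma L_add: "x \<in> L \<Longrightarrow> y \<in> L \<Longrightarrow> x + y \<in> L"
proof -
  assume "x \<in> L" "y \<in> L"
  then obtain a b c d where "x = (of_int a + of_int b * \<eta>) / N" "y = (of_int c + of_int d * \<eta>) / N"
    unfolding L_iff' by blast
  then have "x + y = (of_int (a + c) + of_int (b + d) * \<eta>) / N"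
    by (simp add: add_divide_distrib algebra_simps)
  then show ?thesis unfolding L_iff' by blast
qed

lemma L_uminus: "x \<in> L \<Longrightarrow> - x \<in> L"
proof -
  assume "x \<in> L"
  then obtain a b where "x = (of_int a + of_int b * \<eta>) / N"
    unfolding L_iff' by blast
  then have "- x = (of_int (- a) + of_int (- b) * \<eta>) / N"
    by (simp add: minus_divide_left)
  then show ?thesis unfolding L_iff' by blast
qed

lemma L_uminus_iff [simp]: "- x \<in> L \<longleftrightarrow> x \<in> L"
  using L_uminus[of x] L_uminus[of "- x"] by auto

text \<open>The four steps reach all of \<open>L\<close> from 0, so a behaviour known under 1/n and
  \<eta>/n spreads from the origin to every lattice point.\<close>

lemma L_induct:
  assumes "z \<in> L" "P 0"
    "\<And>z. P z \<Longrightarrow> P (z + 1 / N)" "\<And>z. P z \<Longrightarrow> P (z - 1 / N)"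
    "\<And>z. P z \<Longrightarrow> P (z + \<eta> / N)" "\<And>z. P z \<Longrightarrow> P (z - \<eta> / N)"
  shows "P z"
proof -
  obtain a b where z: "z = (of_int a + of_int b * \<eta>) / N" using assms(1) by (auto simp: L_iff')
  have 1: "P (of_int a / N)" for a :: int
    by (induction a rule: int_induct[where k = 0])
       (use assms(2) assms(3,4)[of "of_int _ / N"] in \<open>auto simp: add_divide_distrib diff_divide_distrib\<close>)
  have "P (of_int a / N + of_int b * \<eta> / N)"
  proof (induction b rule: int_induct[where k = 0])
    case (step1 i)
    then show ?case using assms(5)[OF step1(2)] by (simp add: distrib_right add_divide_distrib add_ac)
  next
    case (step2 i)
    then show ?case using assms(6)[OF step2(2)] by (simp add: left_diff_distrib diff_divide_distrib add_diff_eq)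
  qed (use 1 in simp)
  then show ?thesis by (simp add: z add_divide_distrib)
qed

lemma sum_of_nat_lessThan: "(\<Sum>m<n. of_nat m / N) = (N - 1) / 2"
proof -
  have "2 * (\<Sum>m<j. (of_nat m :: complex)) = of_nat j * (of_nat j - 1)" for j
    by (induction j) (auto simp: algebra_simps)
  from this[of n] have "(\<Sum>m<n. (of_nat m :: complex)) = N * (N - 1) / 2" by (simp add: field_simps)
  then show ?thesis using N_nz by (simp add: sum_divide_distrib[symmetric])
qed

lemma ee_half_N: "ee ((N - 1) / 2) = - ((-1) ^ n)"
proof -
  have "ee ((N - 1) / 2) = ee (of_nat n * (1 / 2)) / ee (1 / 2)"
    unfolding ee_diff[symmetric] by (simp add: diff_divide_distrib)
  then show ?thesis unfolding ee_mult_of_nat ee_half by simp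
qed

text \<open>The n signs and the n roots of unity \<open>ee (- (of_nat m / N))\<close> multiply to
  -1, whatever the parity of n.\<close>

lemma prod_theta_plus_eta:
  "(\<Prod>m<n. theta \<eta> (z + of_nat m / N + \<eta>)) = - ee (- (N * z)) * (\<Prod>m<n. theta \<eta> (z + of_nat m / N))"
proof -
  have "(\<Prod>m<n. theta \<eta> (z + of_nat m / N + \<eta>))
      = (\<Prod>m<n. - ee (- (z + of_nat m / N))) * (\<Prod>m<n. theta \<eta> (z + of_nat m / N))"
    unfolding theta_plus_eta by (rule prod.distrib)
  also have "(\<Prod>m<n. - ee (- (z + of_nat m / N))) = (-1) ^ n * ee (- (N * z) - (N - 1) / 2)"
    unfolding prod_uminus
    by (simp add: ee_sum[symmetric] sum_negf sum.distrib sum_subtractf sum_of_nat_lessThan)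
  also have "\<dots> = - ee (- (N * z))"
    unfolding ee_diff ee_half_N by simp
  finally show ?thesis .
qed

text \<open>This makes the index an element of Z_n. The exponential prefactor of
  \<open>theta_int\<close> is built to cancel the multiplier of the product; the term 1/2 in the
  exponent accounts for the sign.\<close>

lemma theta_int_plus_n: "theta_int n \<eta> (a + int n) z = theta_int n \<eta> a z"
proof -
  have e: "z + of_nat m / N + of_int (a + int n) / N * \<eta> = (z + of_int a / N * \<eta>) + of_nat m / N + \<eta>" for m
    using N_nz by (simp add: field_simps)
  have e': "z + of_nat m / N + of_int a / N * \<eta> = (z + of_int a / N * \<eta>) + of_nat m / N" for m
    by simp
  have x: "of_int (a + int n) * z + of_int (a + int n) / (2 * N) + of_int ((a + int n) * (a + int n - int n)) / (2 * N) * \<eta>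
     = (of_int a * z + of_int a / (2 * N) + of_int (a * (a - int n)) / (2 * N) * \<eta>) + 1 / 2 + N * (z + of_int a / N * \<eta>)"
    using N_nz by (simp add: field_simps)
  show ?thesis
    unfolding theta_int_def e e' x prod_theta_plus_eta
    by (simp only: ee_add ee_half ee_minus) simp
qed

lemma t_eq: "t a z = theta_int n \<eta> a z"
proof -
  have "theta_int n \<eta> (a mod int n + of_int (a div int n) * int n) z = theta_int n \<eta> (a mod int n) z"
    by (rule periodic_of_int[of "\<lambda>a. theta_int n \<eta> a z"]) (rule theta_int_plus_n)
  then show ?thesis by (simp add: thetaZ_def)
qed

lemma t_mod [simp]: "t (a mod int n) z = t a z"
  by (simp add: thetaZ_def)

lemma t_cong: "a mod int n = b mod int n \<Longrightarrow> t a = t b"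
  by (rule ext) (metis t_mod)

lemma theta_int_alt: "theta_int n \<eta> a z =
     ee (of_int a * z + of_int a / (2 * N) + of_int (a * (a - int n)) / (2 * N) * \<eta>)
     * (\<Prod>m<n. theta \<eta> ((z + of_int a / N * \<eta>) + of_nat m / N))"
  unfolding theta_int_def by (simp add: add_ac)

lemma prod_theta_plus_1n:
  "(\<Prod>m<n. theta \<eta> (z + 1 / N + of_nat m / N)) = (\<Prod>m<n. theta \<eta> (z + of_nat m / N))"
proof -
  obtain n' where n': "n = Suc n'" using n_pos by (cases n) auto
  have "theta \<eta> (z + 1 / N + of_nat m / N) = theta \<eta> (z + of_nat (Suc m) / N)" for m
    by (simp add: add_divide_distrib add_ac)
  then have "(\<Prod>m<n. theta \<eta> (z + 1 / N + of_nat m / N)) = (\<Prod>m<n. theta \<eta> (z + of_nat (Suc m) / N))"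
    by simp
  also have "\<dots> = (\<Prod>m<n'. theta \<eta> (z + of_nat (Suc m) / N)) * theta \<eta> (z + 1)"
    unfolding n' by (simp add: divide_self del: of_nat_Suc)
  also have "\<dots> = (\<Prod>m<n. theta \<eta> (z + of_nat m / N))"
    unfolding n' prod.lessThan_Suc_shift theta_plus_1 by simp
  finally show ?thesis .
qed

lemma prod_theta_uminus:
  "(\<Prod>m<n. theta \<eta> (z - of_nat m / N)) = (\<Prod>m<n. theta \<eta> (z + of_nat m / N))"
proof -
  obtain n' where n': "n = Suc n'" using n_pos by (cases n) auto
  have "(\<Prod>m<n'. theta \<eta> (z - of_nat (Suc m) / N)) = (\<Prod>m<n'. theta \<eta> (z - of_nat (Suc (n' - Suc m)) / N))"
    by (rule prod.nat_diff_reindex[symmetric])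
  also have "\<dots> = (\<Prod>m<n'. theta \<eta> (z + of_nat (Suc m) / N))"
  proof (rule prod.cong)
    fix m assume "m \<in> {..<n'}"
    then have "(of_nat (Suc (n' - Suc m)) :: complex) = N - of_nat (Suc m)"
      unfolding n' by (simp add: Suc_diff_Suc of_nat_diff)
    then have "z - of_nat (Suc (n' - Suc m)) / N + 1 = z + of_nat (Suc m) / N"
      using N_nz by (simp add: diff_divide_distrib del: of_nat_Suc)
    then show "theta \<eta> (z - of_nat (Suc (n' - Suc m)) / N) = theta \<eta> (z + of_nat (Suc m) / N)"
      by (metis theta_plus_1)
  qed simp
  finally show ?thesis
    by (simp only: n' prod.lessThan_Suc_shift) simp
qed

lemma t_plus_1n: "t a (z + 1 / N) = ee (of_int a / N) * t a z"
proof -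
  have e: "z + 1 / N + of_int a / N * \<eta> = (z + of_int a / N * \<eta>) + 1 / N" by simp
  have x: "of_int a * (z + 1 / N) + of_int a / (2 * N) + of_int (a * (a - int n)) / (2 * N) * \<eta>
    = of_int a / N + (of_int a * z + of_int a / (2 * N) + of_int (a * (a - int n)) / (2 * N) * \<eta>)"
    by (simp add: distrib_left)
  show ?thesis
    unfolding t_eq theta_int_alt e x prod_theta_plus_1n by (simp only: ee_add mult_ac)
qed

definition "shift_const = - 1 / (2 * N) + (N - 1) / (2 * N) * \<eta>"

text \<open>The multiplier is the same for every index \<open>a\<close>: translation by \<eta>/n
  permutes the theta functions up to one common factor.\<close>

lemma t_plus_etan: "t a (z + \<eta> / N) = ee (shift_const - z) * t (a + 1) z"
proof -
  have e: "z + \<eta> / N + of_int a / N * \<eta> = z + of_int (a + 1) / N * \<eta>" by (simp add: add_divide_distrib algebra_simps)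
  have x: "of_int a * (z + \<eta> / N) + of_int a / (2 * N) + of_int (a * (a - int n)) / (2 * N) * \<eta>
    = (shift_const - z) + (of_int (a + 1) * z + of_int (a + 1) / (2 * N) + of_int ((a + 1) * (a + 1 - int n)) / (2 * N) * \<eta>)"
    using N_nz unfolding shift_const_def by (simp add: field_simps)
  show ?thesis
    unfolding t_eq theta_int_alt e x by (simp only: ee_add mult_ac)
qed

text \<open>Reflection sends m/n to -m/n, which only permutes the factors modulo 1, and
  \<open>a\<close> to \<open>- a\<close>; the rest collects the multipliers from
  \<open>theta_uminus\<close>.\<close>

lemma t_uminus: "t a (- z) = - ee (of_int a / N - N * z) * t (- a) z"
proof -
  let ?w = "z - of_int a / N * \<eta>"
  have "(\<Prod>m<n. theta \<eta> ((- z + of_int a / N * \<eta>) + of_nat m / N)) = (\<Prod>m<n. theta \<eta> (- (?w - of_nat m / N)))"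
    by (simp add: algebra_simps)
  also have "\<dots> = (\<Prod>m<n. - ee (- (?w - of_nat m / N))) * (\<Prod>m<n. theta \<eta> (?w - of_nat m / N))"
    unfolding theta_uminus by (rule prod.distrib)
  also have "(\<Prod>m<n. - ee (- (?w - of_nat m / N))) = (-1) ^ n * ee ((N - 1) / 2 - N * ?w)"
    unfolding prod_uminus
    by (simp add: ee_sum[symmetric] sum_subtractf sum_of_nat_lessThan)
  also have "\<dots> = - ee (- (N * ?w))"
    unfolding ee_diff ee_half_N ee_minus by (simp add: divide_inverse)
  also have "N * ?w = N * z - of_int a * \<eta>" using N_nz by (simp add: field_simps)
  finally have P: "(\<Prod>m<n. theta \<eta> ((- z + of_int a / N * \<eta>) + of_nat m / N))
     = - ee (- (N * z - of_int a * \<eta>)) * (\<Prod>m<n. theta \<eta> (?w + of_nat m / N))"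
    unfolding prod_theta_uminus .
  have e: "?w = z + of_int (- a) / N * \<eta>" by simp
  have x: "(of_int a * - z + of_int a / (2 * N) + of_int (a * (a - int n)) / (2 * N) * \<eta>) + (- (N * z - of_int a * \<eta>))
     = (of_int a / N - N * z) + (of_int (- a) * z + of_int (- a) / (2 * N) + of_int (- a * (- a - int n)) / (2 * N) * \<eta>)"
    using N_nz by (simp add: field_simps)
  have "t a (- z) = - ee ((of_int a * - z + of_int a / (2 * N) + of_int (a * (a - int n)) / (2 * N) * \<eta>) + (- (N * z - of_int a * \<eta>)))
      * (\<Prod>m<n. theta \<eta> (?w + of_nat m / N))"
    unfolding t_eq theta_int_alt P by (simp only: ee_add) simp
  then show ?thesis
    unfolding x t_eq theta_int_alt e by (simp only: ee_add) simp
qed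

lemma t_zero:
  assumes "t a z = 0"
  obtains m where "m < n" "z + of_int a / N * \<eta> + of_nat m / N \<in> lattice \<eta>"
  using assms unfolding t_eq theta_int_alt by (auto simp: theta_eq_0_iff)

lemma t_zero_L: 
  assumes "t a z = 0" shows "z \<in> L"
proof -
  obtain m where m: "z + of_int a / N * \<eta> + of_nat m / N \<in> lattice \<eta>" using assms by (rule t_zero)
  then obtain b c where "z + of_int a / N * \<eta> + of_nat m / N = of_int b + of_int c * \<eta>"
    by (auto simp: lattice_def)
  then have "z = (of_int (int n * b - int m) + of_int (int n * c - a) * \<eta>) / N"
    using N_nz by (simp add: field_simps) (simp add: algebra_simps)?
  then show ?thesis unfolding L_iff' by blast
qed

lemma lattice_coords:
  assumes "of_real x + of_real y * \<eta> = of_real x' + of_real y' * \<eta>"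
  shows "x = x'" "y = y'"
proof -
  from assms have "y * Im \<eta> = y' * Im \<eta>" by (auto simp: complex_eq_iff)
  then show "y = y'" using Im_eta by simp
  then show "x = x'" using assms by (simp add: complex_eq_iff)
qed

text \<open>A zero at the origin puts (a \<eta> + m)/n into the lattice, and 1 and \<eta> are
  independent over the reals.\<close>

lemma t_0_zero:
  assumes "t a 0 = 0" shows "int n dvd a"
proof -
  obtain m where m: "0 + of_int a / N * \<eta> + of_nat m / N \<in> lattice \<eta>" using assms by (rule t_zero)
  then obtain b c where bc: "0 + of_int a / N * \<eta> + of_nat m / N = of_int b + of_int c * \<eta>"
    by (auto simp: lattice_def)
  then have "of_real (of_nat m / of_nat n) + of_real (of_int a / of_nat n) * \<eta> = of_real (of_int b) + of_real (of_int c) * \<eta>"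
    by (simp add: add_ac)
  from lattice_coords(2)[OF this] have "of_int a = (of_int (c * int n) :: real)"
    using n_pos by (simp add: field_simps)
  then have "a = c * int n" by (subst (asm) of_int_eq_iff)
  then show ?thesis by simp
qed

lemma t_0_0: "t 0 0 = 0"
  unfolding t_eq theta_int_alt using n_pos theta_0 by (auto simp: prod_zero_iff intro!: bexI[of _ 0])

lemma t_holo: "t a holomorphic_on UNIV"
proof -
  have "t a = (\<lambda>z. ee (of_int a * z + of_int a / (2 * N) + of_int (a * (a - int n)) / (2 * N) * \<eta>)
     * (\<Prod>m<n. theta \<eta> ((z + of_int a / N * \<eta>) + of_nat m / N)))"
    by (rule ext) (simp only: t_eq theta_int_alt)
  then show ?thesis
    by (auto intro!: holomorphic_on_mult holomorphic_on_ee holomorphic_on_prod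
        entire_compose[OF theta_holo] holomorphic_on_add holomorphic_on_const holomorphic_on_ident)
qed

text \<open>Only the factor with m = 0 vanishes at the origin, and its zero is simple by
  \<open>deriv_theta_0\<close>.\<close>

lemma deriv_t_0: "deriv (t 0) 0 \<noteq> 0"
proof -
  obtain n' where n': "n = Suc n'" using n_pos by (cases n) auto
  let ?g = "\<lambda>z. \<Prod>m<n'. theta \<eta> (z + of_nat (Suc m) / N)"
  have g: "?g holomorphic_on UNIV"
    by (intro holomorphic_on_prod entire_compose[OF theta_holo] entire_affine)
  have "t 0 = (\<lambda>z. theta \<eta> z * ?g z)"
    by (rule ext, unfold t_eq theta_int_alt)
       (simp add: n' prod.lessThan_Suc_shift del: prod.lessThan_Suc)
  then have "deriv (t 0) 0 = deriv (theta \<eta>) 0 * ?g 0"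
    using deriv_mult_at_zero[OF theta_holo g theta_0] by simp
  moreover have "?g 0 \<noteq> 0"
  proof
    assume "?g 0 = 0"
    then obtain m where m: "m < n'" "of_nat (Suc m) / N \<in> lattice \<eta>"
      by (auto simp: prod_zero_iff theta_eq_0_iff)
    then obtain b c where bc: "of_nat (Suc m) / N = of_int b + of_int c * \<eta>" by (auto simp: lattice_def)
    then have "of_real (of_nat (Suc m) / of_nat n) + of_real 0 * \<eta> = of_real (of_int b) + of_real (of_int c) * \<eta>"
      by simp
    from lattice_coords(1)[OF this] have "of_int (int (Suc m)) = (of_int (b * int n) :: real)"
      using n_pos by (simp add: field_simps)
    then have "int (Suc m) = b * int n" by (subst (asm) of_int_eq_iff)
    then have "int n dvd int (Suc m)" by simp
    then have "n dvd Suc m" by (simp only: int_dvd_int_iff)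
    then show False using m(1) n' by (auto dest: dvd_imp_le)
  qed
  ultimately show ?thesis using deriv_theta_0 by simp
qed

text \<open>All \<open>\<theta>\<^sub>\<alpha>\<close> multiplied together, the product with one factor left out, and the denominator
  \<open>\<theta>\<^sub>1(0) \<dots> \<theta>\<^sub>n\<^sub>-\<^sub>1(0)\<close> in the definition of \<open>R\<close>.\<close>

definition "vth z = (\<Prod>a\<in>{0..<int n}. t a z)"
definition "vth_cof x z = (\<Prod>a\<in>{0..<int n} - {x mod int n}. t a z)"
definition "c0 = vth_cof 0 0"

lemma vth_cof_mod [simp]: "vth_cof (x mod int n) = vth_cof x"
  by (simp add: vth_cof_def[abs_def])

lemma vth_split: "vth z = t x z * vth_cof x z"
proof -
  have "x mod int n \<in> {0..<int n}" using n_pos by auto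
  then show ?thesis unfolding vth_def vth_cof_def
    by (subst prod.remove[of _ "x mod int n"]) auto
qed

lemma vth_holo: "vth holomorphic_on UNIV" and vth_cof_holo: "vth_cof x holomorphic_on UNIV"
  unfolding vth_def[abs_def] vth_cof_def[abs_def] by (intro holomorphic_on_prod t_holo)+

lemma vth_zero: "vth z = 0 \<Longrightarrow> z \<in> L"
  unfolding vth_def by (auto dest: t_zero_L)

lemma c0_nz: "c0 \<noteq> 0"
proof
  assume "c0 = 0"
  then have "\<exists>a\<in>{0..<int n} - {0}. t a 0 = 0" by (simp add: c0_def vth_cof_def prod_zero_iff)
  then obtain a where "a \<in> {0..<int n} - {0}" "t a 0 = 0" by blast
  then show False using t_0_zero[of a] zdvd_imp_le[of "int n" a] by auto
qed

lemma vth_cof_0: "vth_cof x 0 = (if x mod int n = 0 then c0 else 0)"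
proof (cases "x mod int n = 0")
  case True
  then show ?thesis by (simp add: c0_def vth_cof_def)
next
  case False
  then have "0 \<in> {0..<int n} - {x mod int n}" using n_pos by auto
  then show ?thesis using False t_0_0 unfolding vth_cof_def by (auto intro!: prod_zero)
qed

lemma vth_0: "vth 0 = 0"
  using vth_split[of 0 0] t_0_0 by simp

lemma deriv_vth_0: "deriv vth 0 \<noteq> 0"
proof -
  have "vth = (\<lambda>z. t 0 z * vth_cof 0 z)" using vth_split by auto
  then have "deriv vth 0 = deriv (t 0) 0 * c0"
    using deriv_mult_at_zero[OF t_holo vth_cof_holo t_0_0] by (simp add: c0_def)
  then show ?thesis using deriv_t_0 c0_nz by simp
qed

definition "root_prod = (\<Prod>a\<in>{0..<int n}. ee (of_int a / N))"

lemma root_prod_nz [simp]: "root_prod \<noteq> 0" by (simp add: root_prod_def)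

lemma vth_plus_1n: "vth (z + 1 / N) = root_prod * vth z"
  by (simp add: vth_def t_plus_1n prod.distrib root_prod_def)

lemma vth_minus_1n: "vth (z - 1 / N) = vth z / root_prod"
  using vth_plus_1n[of "z - 1 / N"] by (simp add: field_simps)

lemma prod_residues_shift:
  "(\<Prod>a\<in>{0..<int n}. t (a + c) z) = vth z"
proof -
  have inj: "inj_on (\<lambda>a. (a + c) mod int n) {0..<int n}"
  proof (rule inj_onI)
    fix a b assume ab: "a \<in> {0..<int n}" "b \<in> {0..<int n}" "(a + c) mod int n = (b + c) mod int n"
    then have "((a + c) - c) mod int n = ((b + c) - c) mod int n" by (metis mod_diff_left_eq)
    then show "a = b" using ab by simp
  qed
  moreover have "(\<lambda>a. (a + c) mod int n) ` {0..<int n} \<subseteq> {0..<int n}" using n_pos by auto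
  ultimately have "bij_betw (\<lambda>a. (a + c) mod int n) {0..<int n} {0..<int n}"
    by (simp add: bij_betw_def endo_inj_surj)
  from prod.reindex_bij_betw[OF this, of "\<lambda>a. t a z"] show ?thesis by (simp add: vth_def)
qed

lemma vth_plus_etan: "vth (z + \<eta> / N) = ee (N * (shift_const - z)) * vth z"
  by (simp add: vth_def t_plus_etan prod.distrib prod_residues_shift ee_mult_of_nat)

lemma vth_minus_etan: "vth (z - \<eta> / N) = vth z / ee (N * (shift_const + \<eta> / N - z))"
  using vth_plus_etan[of "z - \<eta> / N"] by (simp add: algebra_simps)

end

section \<open>Unitarity of the R-matrix\<close>

lemma DERIV_uminus_arg:
  assumes "f holomorphic_on UNIV"
  shows "((\<lambda>z. f (- z)) has_field_derivative (- deriv f (- u))) (at u)"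
proof -
  have "(f has_field_derivative deriv f (- u)) (at (- u))"
    by (rule holomorphic_derivI[OF assms]) auto
  from DERIV_chain2[OF this DERIV_minus[OF DERIV_ident]] show ?thesis by simp
qed

context theta_level
begin

lemma L_vth_zero: "z \<in> L \<Longrightarrow> vth z = 0"
  by (rule L_induct) (auto simp: vth_0 vth_plus_1n vth_minus_1n vth_plus_etan vth_minus_etan)

lemma vth_eq_0_iff: "vth z = 0 \<longleftrightarrow> z \<in> L"
  using L_vth_zero vth_zero by blast

lemma eventually_vth_nz: "eventually (\<lambda>w. vth w \<noteq> 0) (at z)"
proof -
  have "\<exists>b. vth b \<noteq> 0"
  proof (rule ccontr)
    assume "\<not> ?thesis"
    then have "vth = (\<lambda>_. 0)" by auto
    then show False using deriv_vth_0 by simp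
  qed
  then obtain b where "vth b \<noteq> 0" by blast
  from non_zero_neighbour_alt[OF vth_holo, of z b] this
  show ?thesis by (auto elim: eventually_mono)
qed

lemma eventually_notin_L: "eventually (\<lambda>w. w \<notin> L) (at z)"
  using eventually_vth_nz[of z] by (simp add: vth_eq_0_iff)

text \<open>The induction has to treat all \<open>D\<close> at once, because a step by \<eta>/n
  replaces \<open>D\<close> by a neighbouring index.\<close>

lemma quasi_limit_shift:
  fixes f :: "int \<Rightarrow> complex \<Rightarrow> complex"
  assumes c: "c \<noteq> 0"
    and p1: "\<And>D z. f D (z + 1 / N) = c * f D z"
    and p2: "\<And>D z. f D (z + \<eta> / N) = f (D + 1) z"
    and base: "\<And>D. \<exists>l. (f D \<longlongrightarrow> l) (at z0)"
    and zeta: "\<zeta> \<in> L"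
  shows "\<exists>l. (f D \<longlongrightarrow> l) (at (z0 + \<zeta>))"
proof -
  have "\<forall>D. \<exists>l. (f D \<longlongrightarrow> l) (at (z0 + \<zeta>))"
  proof (rule L_induct[OF zeta])
    fix z assume IH: "\<forall>D. \<exists>l. (f D \<longlongrightarrow> l) (at (z0 + z))"
    show "\<forall>D. \<exists>l. (f D \<longlongrightarrow> l) (at (z0 + (z + 1 / N)))"
    proof
      fix D
      obtain l where l: "(f D \<longlongrightarrow> l) (at (z0 + z))" using IH by blast
      have "(\<lambda>w. c * f D (w + - (1 / N))) \<midarrow>(z0 + z) - - (1 / N)\<rightarrow> c * l"
        by (intro tendsto_mult tendsto_const LIM_offset l)
      moreover have "c * f D (w + - (1 / N)) = f D w" for w
        using p1[of D "w + - (1 / N)"] by simp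
      ultimately show "\<exists>l. (f D \<longlongrightarrow> l) (at (z0 + (z + 1 / N)))" by (auto simp: add_ac)
    qed
    show "\<forall>D. \<exists>l. (f D \<longlongrightarrow> l) (at (z0 + (z - 1 / N)))"
    proof
      fix D
      obtain l where l: "(f D \<longlongrightarrow> l) (at (z0 + z))" using IH by blast
      have "(\<lambda>w. f D (w + 1 / N) / c) \<midarrow>(z0 + z) - 1 / N\<rightarrow> l / c"
        by (intro tendsto_divide tendsto_const LIM_offset l c)
      then show "\<exists>l. (f D \<longlongrightarrow> l) (at (z0 + (z - 1 / N)))" using c by (auto simp: p1 add_diff_eq)
    qed
    show "\<forall>D. \<exists>l. (f D \<longlongrightarrow> l) (at (z0 + (z + \<eta> / N)))"
    proof
      fix D
      obtain l where l: "(f (D + 1) \<longlongrightarrow> l) (at (z0 + z))" using IH by blast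
      have "(\<lambda>w. f (D + 1) (w + - (\<eta> / N))) \<midarrow>(z0 + z) - - (\<eta> / N)\<rightarrow> l"
        by (intro LIM_offset l)
      moreover have "f (D + 1) (w + - (\<eta> / N)) = f D w" for w
        using p2[of D "w + - (\<eta> / N)"] by simp
      ultimately show "\<exists>l. (f D \<longlongrightarrow> l) (at (z0 + (z + \<eta> / N)))" by (auto simp: add_ac)
    qed
    show "\<forall>D. \<exists>l. (f D \<longlongrightarrow> l) (at (z0 + (z - \<eta> / N)))"
    proof
      fix D
      obtain l where l: "(f (D - 1) \<longlongrightarrow> l) (at (z0 + z))" using IH by blast
      have "(\<lambda>w. f (D - 1) (w + \<eta> / N)) \<midarrow>(z0 + z) - \<eta> / N\<rightarrow> l"
        by (intro LIM_offset l)
      then show "\<exists>l. (f D \<longlongrightarrow> l) (at (z0 + (z - \<eta> / N)))" by (auto simp: p2 add_diff_eq)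
    qed
  qed (use base in simp)
  then show ?thesis by blast
qed

text \<open>After n steps in either direction each \<open>f D\<close> is elliptic for the full
  lattice, hence constant. A single step by \<eta>/n shows that the constant is the same for all
  \<open>D\<close>, and a single step by 1/n that it is fixed by \<open>c\<close>, so that it is 0
  unless \<open>c = 1\<close>.\<close>

lemma quasi_elliptic_const:
  fixes f :: "int \<Rightarrow> complex \<Rightarrow> complex"
  assumes mero: "\<And>D. f D meromorphic_on UNIV"
    and lim: "\<And>D z. \<exists>l. (f D \<longlongrightarrow> l) (at z)"
    and p1: "\<And>D z. f D (z + 1 / N) = c * f D z" and c: "c ^ n = 1"
    and p2: "\<And>D z. f D (z + \<eta> / N) = f (D + 1) z" and Dn: "\<And>D. f (D + int n) = f D"
  obtains \<kappa> where "\<And>D z. (f D \<longlongrightarrow> \<kappa>) (at z)" "c * \<kappa> = \<kappa>"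
proof -
  have a: "f D (z + of_nat m / N) = c ^ m * f D z" for D z m
  proof (induction m)
    case (Suc m)
    then show ?case using p1[of D "z + of_nat m / N"] by (simp add: add_divide_distrib add_ac)
  qed simp
  have 1: "f D (z + 1) = f D z" for D z
    using a[of D z n] c N_nz by simp
  have b: "f D (z + of_nat m * \<eta> / N) = f (D + int m) z" for D z m
  proof (induction m arbitrary: D)
    case (Suc m)
    then show ?case using p2[of D "z + of_nat m * \<eta> / N"] by (simp add: distrib_right add_divide_distrib add_ac)
  qed simp
  have 2: "f D (z + \<eta>) = f D z" for D z
    using b[of D z n] Dn N_nz by simp
  have "\<exists>\<kappa>. \<forall>z. (f D \<longlongrightarrow> \<kappa>) (at z)" for D
    by (rule elliptic_limit_const[OF mero lim 1 2]) blast
  then obtain \<kappa> where k: "\<And>D z. (f D \<longlongrightarrow> \<kappa> D) (at z)" by metis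
  have "\<kappa> (D + 1) = \<kappa> D" for D
  proof -
    have "(\<lambda>w. f D (w + \<eta> / N)) \<midarrow>\<eta> / N - \<eta> / N\<rightarrow> \<kappa> D" by (intro LIM_offset k)
    then show ?thesis using k[of "D + 1" 0] by (auto simp: p2 intro: tendsto_unique[OF at_neq_bot])
  qed
  then have kc: "\<kappa> D = \<kappa> 0" for D
    using periodic_of_int[of \<kappa> 1 0 D] by simp
  have "(\<lambda>w. f 0 (w + 1 / N)) \<midarrow>1 / N - 1 / N\<rightarrow> \<kappa> 0" by (intro LIM_offset k)
  then have A: "((\<lambda>w. c * f 0 w) \<longlongrightarrow> \<kappa> 0) (at 0)" by (simp add: p1)
  have B: "((\<lambda>w. c * f 0 w) \<longlongrightarrow> c * \<kappa> 0) (at 0)" by (intro tendsto_mult tendsto_const k)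
  have "c * \<kappa> 0 = \<kappa> 0" by (rule tendsto_unique[OF at_neq_bot B A])
  then show ?thesis using that k kc by metis
qed

end

locale theta_coprime = theta_level +
  fixes k :: nat
  assumes cop: "coprime n k"
begin

text \<open>Coprimality of \<open>n\<close> and \<open>k\<close> enters the argument only through
  this lemma.\<close>

lemma mod_cancel_k:
  assumes "(int k * a) mod int n = (int k * b) mod int n"
  shows "a mod int n = b mod int n"
proof -
  have "int n dvd int k * (a - b)" using assms by (simp add: mod_eq_dvd_iff right_diff_distrib)
  moreover have "coprime (int n) (int k)" using cop by simp
  ultimately have "int n dvd a - b" using coprime_dvd_mult_right_iff by blast
  then show ?thesis by (simp add: mod_eq_dvd_iff)
qed

end

locale theta_tau = theta_coprime +
  fixes \<tau> :: complex
  assumes tau: "\<tau> \<notin> frac_lattice n \<eta>"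
begin

text \<open>With \<open>D = j - i\<close> and \<open>s = a - i\<close>, the coefficient of \<open>R(z) R(-z)\<close> at row \<open>(a, b)\<close> and column \<open>(i, j)\<close>
  is \<open>Phi D s z\<close> up to a scalar function of \<open>z\<close>; \<open>Psi\<close> is \<open>Phi\<close> with its poles at \<open>(1/n)\<Lambda>\<close> cleared.
  The quasi-periodicity of \<open>G\<close> and \<open>Phi\<close> also holds at the poles, where division by zero gives \<open>0\<close>.\<close>

definition "G x y u = t (x + y) (u + \<tau>) / (t x u * t y \<tau>)"
definition "Phi D s z = (\<Sum>e\<in>{0..<int n}. G (s - e) (int k * (D - e - s)) (- z) * G e (int k * (D - e)) z)"
definition "H x y u = vth_cof x u * t (x + y) (u + \<tau>) / t y \<tau>"
definition "Psi D s z = (\<Sum>e\<in>{0..<int n}. H (s - e) (int k * (D - e - s)) (- z) * H e (int k * (D - e)) z)"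

lemma t_tau_nz [simp]: "t a \<tau> \<noteq> 0"
  using t_zero_L tau by blast

lemma t_nz: "z \<notin> L \<Longrightarrow> t a z \<noteq> 0"
  using t_zero_L by blast

lemma G_cong: "x mod int n = x' mod int n \<Longrightarrow> y mod int n = y' mod int n \<Longrightarrow> G x y = G x' y'"
  unfolding G_def[abs_def] using t_cong[of x x'] t_cong[of y y'] t_cong[of "x + y" "x' + y'"] mod_add_cong by metis

lemma H_cong: "x mod int n = x' mod int n \<Longrightarrow> y mod int n = y' mod int n \<Longrightarrow> H x y = H x' y'"
  unfolding H_def[abs_def] using t_cong[of y y'] t_cong[of "x + y" "x' + y'"] mod_add_cong vth_cof_mod by metis

lemma mod_k_cong: "a mod int n = b mod int n \<Longrightarrow> (int k * a) mod int n = (int k * b) mod int n"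
  by (rule mod_mult_cong) auto

lemma G_cong_k: "x mod int n = x' mod int n \<Longrightarrow> y mod int n = y' mod int n \<Longrightarrow> G x (int k * y) = G x' (int k * y')"
  by (rule G_cong) (auto intro: mod_k_cong)

lemma H_cong_k: "x mod int n = x' mod int n \<Longrightarrow> y mod int n = y' mod int n \<Longrightarrow> H x (int k * y) = H x' (int k * y')"
  by (rule H_cong) (auto intro: mod_k_cong)

lemma G_plus_1n: "G x y (u + 1 / N) = ee (of_int y / N) * G x y u"
proof -
  have "u + 1 / N + \<tau> = (u + \<tau>) + 1 / N" by simp
  then show ?thesis
    unfolding G_def by (simp only: t_plus_1n) (simp add: add_divide_distrib ee_add)
qed

lemma G_minus_1n: "G x y (u - 1 / N) = ee (- of_int y / N) * G x y u"
  using G_plus_1n[of x y "u - 1 / N"] ee_minus[of "of_int y / N"] by (simp add: field_simps)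

lemma G_plus_etan: "G x y (u + \<eta> / N) = ee (- \<tau>) * G (x + 1) y u"
proof -
  have e: "u + \<eta> / N + \<tau> = (u + \<tau>) + \<eta> / N" by simp
  have e': "ee (shift_const - (u + \<tau>)) = ee (- \<tau>) * ee (shift_const - u)"
    unfolding ee_add[symmetric] by (simp add: algebra_simps)
  have "x + y + 1 = x + 1 + y" by simp
  then show ?thesis
    unfolding G_def e t_plus_etan e' by (simp add: add_ac)
qed

lemma G_minus_etan: "G x y (u - \<eta> / N) = ee \<tau> * G (x - 1) y u"
  using G_plus_etan[of "x - 1" y "u - \<eta> / N"] by (simp add: ee_minus field_simps)

text \<open>The two roots of unity attached to \<open>e\<close> multiply to one that depends on
  \<open>s\<close> alone, hence it can be taken out of the sum.\<close>

lemma Phi_plus_1n: "Phi D s (z + 1 / N) = ee (of_int (int k * s) / N) * Phi D s z"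
proof -
  have "ee (- of_int (int k * (D - e - s)) / N) * ee (of_int (int k * (D - e)) / N) = ee (of_int (int k * s) / N)" for e
    unfolding ee_add[symmetric] using N_nz by (simp add: field_simps)
  then have *: "ee (- of_int (int k * (D - e - s)) / N) * a * (ee (of_int (int k * (D - e)) / N) * b) = ee (of_int (int k * s) / N) * (a * b)" for e a b
    by (metis (no_types, lifting) mult.assoc mult.left_commute)
  have m: "- (z + 1 / N) = - z - 1 / N" by simp
  show ?thesis
    unfolding Phi_def m G_plus_1n G_minus_1n * sum_distrib_left ..
qed

lemma mod_residue: "(a - e mod int n) mod int n = (a - e) mod int n"
    "(a - e mod int n - b) mod int n = (a - e - b) mod int n"
  by (simp_all add: mod_diff_right_eq mod_diff_eq) (metis mod_diff_left_eq mod_diff_right_eq)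

text \<open>The translation turns the first indices \<open>s - e\<close> and \<open>e\<close> into
  \<open>s - (e + 1)\<close> and \<open>e + 1\<close> while the second ones stay. Renaming
  \<open>e + 1\<close> to \<open>e\<close> therefore raises \<open>D\<close> by one; the factors
  \<open>ee \<tau>\<close> and \<open>ee (- \<tau>)\<close> cancel.\<close>

lemma Phi_plus_etan: "Phi D s (z + \<eta> / N) = Phi (D + 1) s z"
proof -
  let ?f = "\<lambda>e. G (s - e) (int k * (D + 1 - e - s)) (- z) * G e (int k * (D + 1 - e)) z"
  have m: "- (z + \<eta> / N) = - z - \<eta> / N" by simp
  have "ee \<tau> * ee (- \<tau>) = 1" by (simp add: ee_minus)
  then have *: "ee \<tau> * a * (ee (- \<tau>) * b) = a * b" for a b
    by (metis (no_types, lifting) mult.assoc mult.left_commute mult_1)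
  have "Phi D s (z + \<eta> / N) = (\<Sum>e\<in>{0..<int n}. ?f (e + 1))"
    unfolding Phi_def m G_plus_etan G_minus_etan * by (simp add: algebra_simps)
  also have "\<dots> = (\<Sum>e\<in>{0..<int n}. ?f e)"
  proof (rule sum_residues_shift)
    fix a
    show "?f (a mod int n) = ?f a"
      by (intro arg_cong2[of _ _ _ _ times] fun_cong[OF G_cong_k]) (simp_all add: mod_residue)
  qed
  finally show ?thesis by (simp add: Phi_def)
qed

lemma Phi_plus_n: "Phi (D + int n) s = Phi D s"
proof -
  have "G x (int k * (D + int n - e)) = G x (int k * (D - e))"
    "G x (int k * (D + int n - e - s)) = G x (int k * (D - e - s))" for x e
    by (intro G_cong_k; simp add: mod_eq_dvd_iff)+
  then show ?thesis by (simp add: Phi_def[abs_def])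
qed

lemma H_vth: "t x u \<noteq> 0 \<Longrightarrow> H x y u = vth u * G x y u"
  unfolding H_def G_def vth_split[of u x] by simp

lemma Psi_Phi: "z \<notin> L \<Longrightarrow> Psi D s z = vth (- z) * vth z * Phi D s z"
  unfolding Psi_def Phi_def sum_distrib_left
  by (intro sum.cong refl) (simp add: H_vth t_nz)

lemma H_holo: "H x y holomorphic_on UNIV"
  unfolding H_def[abs_def]
  by (intro holomorphic_on_mult holomorphic_on_divide vth_cof_holo entire_compose[OF t_holo] entire_affine holomorphic_on_const) simp

lemma Psi_holo: "Psi D s holomorphic_on UNIV"
  unfolding Psi_def[abs_def]
  by (intro holomorphic_on_sum holomorphic_on_mult H_holo entire_compose[OF H_holo] entire_affine)

lemma entire_meromorphic: "f holomorphic_on UNIV \<Longrightarrow> f meromorphic_on UNIV"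
  by (intro analytic_on_imp_meromorphic_on) (simp add: analytic_on_open)

lemma Phi_mero: "Phi D s meromorphic_on UNIV"
  unfolding Phi_def[abs_def] G_def
  by (intro meromorphic_on_sum meromorphic_on_mult meromorphic_on_divide entire_meromorphic holomorphic_on_mult
      entire_compose[OF t_holo] t_holo entire_affine holomorphic_on_const)

lemma Phi_isCont:
  assumes "z \<notin> L" shows "isCont (Phi D s) z"
proof -
  have "- z \<notin> L" using assms by simp
  then have nz: "t x z \<noteq> 0" "t x (- z) \<noteq> 0" for x using assms t_nz by blast+
  have c: "isCont (\<lambda>z. t x (f z)) z" if "f holomorphic_on UNIV" for f x
    by (rule entire_isCont[OF entire_compose[OF t_holo that]])
  show ?thesis
    unfolding Phi_def[abs_def] G_def
    by (intro continuous_intros c entire_affine holomorphic_on_ident) (auto simp: nz)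
qed

text \<open>The cofactor vanishes at the origin unless \<open>x\<close> is 0 in Z_n; in that case
  the two remaining values at \<tau> cancel.\<close>

lemma H_0: "H x y 0 = (if x mod int n = 0 then c0 else 0)"
proof (cases "x mod int n = 0")
  case True
  then have "t (x + y) = t y" by (intro t_cong) (metis add.left_neutral mod_add_left_eq)
  then show ?thesis using True by (simp add: H_def vth_cof_0)
qed (simp add: H_def vth_cof_0)

lemma mod_n_diff_eq_0_iff: "e \<in> {0..<int n} \<Longrightarrow> (s - e) mod int n = 0 \<longleftrightarrow> e = s mod int n"
proof -
  assume e: "e \<in> {0..<int n}"
  have "(s - e) mod int n = 0 \<longleftrightarrow> s mod int n = e mod int n" by (metis mod_eq_dvd_iff dvd_eq_mod_eq_0)
  then show ?thesis using e by auto
qed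

lemma Psi_0: "Psi D s 0 = (if s mod int n = 0 then c0 ^ 2 else 0)"
proof -
  have "Psi D s 0 = (\<Sum>e\<in>{0..<int n}. if e = 0 then if s mod int n = 0 then c0 ^ 2 else 0 else 0)"
    unfolding Psi_def
    by (intro sum.cong refl) (auto simp: H_0 power2_eq_square)
  then show ?thesis using n_pos by simp
qed

lemma H_deriv: "(H x y has_field_derivative deriv (H x y) u) (at u)"
  by (rule holomorphic_derivI[OF H_holo]) auto

text \<open>Only \<open>e = 0\<close> and \<open>e = s\<close> in Z_n contribute. Both bring in the
  derivative of the same function \<open>H s (int k * (D - s))\<close>, taken at -z in one summand
  and at z in the other, so the signs are opposite.\<close>

lemma deriv_Psi_0: "deriv (Psi D s) 0 = 0"
proof -
  let ?a = "\<lambda>e. H (s - e) (int k * (D - e - s))" and ?b = "\<lambda>e. H e (int k * (D - e))"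
  let ?h = "H s (int k * (D - s))"
  have s: "s mod int n \<in> {0..<int n}" using n_pos by auto
  have "(Psi D s has_field_derivative (\<Sum>e\<in>{0..<int n}. (- deriv (?a e) 0) * ?b e 0 + deriv (?b e) 0 * ?a e 0)) (at 0)"
    unfolding Psi_def[abs_def]
  proof (intro DERIV_sum)
    fix e
    have "((\<lambda>z. ?a e (- z)) has_field_derivative (- deriv (?a e) 0)) (at 0)"
      using DERIV_uminus_arg[OF H_holo, of _ _ 0] by simp
    from DERIV_mult[OF this H_deriv]
    show "((\<lambda>z. ?a e (- z) * ?b e z) has_field_derivative (- deriv (?a e) 0) * ?b e 0 + deriv (?b e) 0 * ?a e 0) (at 0)"
      by simp
  qed
  moreover have "(\<Sum>e\<in>{0..<int n}. (- deriv (?a e) 0) * ?b e 0) = - deriv ?h 0 * c0"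
  proof -
    have "(\<Sum>e\<in>{0..<int n}. (- deriv (?a e) 0) * ?b e 0)
        = (\<Sum>e\<in>{0..<int n}. if e = 0 then - deriv ?h 0 * c0 else 0)"
      by (intro sum.cong refl) (auto simp: H_0)
    then show ?thesis using n_pos by simp
  qed
  moreover have "(\<Sum>e\<in>{0..<int n}. deriv (?b e) 0 * ?a e 0) = deriv ?h 0 * c0"
  proof -
    have h: "H (s mod int n) (int k * (D - s mod int n)) = ?h"
      by (rule H_cong_k) (simp_all add: mod_residue)
    have "(\<Sum>e\<in>{0..<int n}. deriv (?b e) 0 * ?a e 0)
        = (\<Sum>e\<in>{0..<int n}. if e = s mod int n then deriv ?h 0 * c0 else 0)"
      by (intro sum.cong refl) (auto simp: H_0 mod_n_diff_eq_0_iff h)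
    then show ?thesis using s by simp
  qed
  ultimately have "(Psi D s has_field_derivative - deriv ?h 0 * c0 + deriv ?h 0 * c0) (at 0)"
    by (simp only: sum.distrib)
  then have "(Psi D s has_field_derivative 0) (at 0)" by simp
  then show ?thesis by (rule DERIV_imp_deriv)
qed

lemma vth_minus_deriv: "deriv (\<lambda>z. vth (- z)) 0 = - deriv vth 0"
proof -
  have "((\<lambda>z. vth (- z)) has_field_derivative (- deriv vth 0)) (at 0)"
    using DERIV_uminus_arg[OF vth_holo, of 0] by simp
  then show ?thesis by (rule DERIV_imp_deriv)
qed

text \<open>By \<open>Psi_0\<close> and \<open>deriv_Psi_0\<close> the singular part of
  \<open>Phi\<close> at the origin does not depend on \<open>D\<close>, and it is absent for
  \<open>s\<close> nonzero in Z_n. The coefficient \<beta> treats both cases together: \<beta> = 1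
  removes the singular part by a difference, \<beta> = 0 keeps \<open>Phi\<close> itself.\<close>

lemma Phi_difference_const:
  fixes s :: int
  defines "\<beta> \<equiv> (if s mod int n = 0 then 1 else 0 :: complex)"
  obtains \<kappa> where "\<And>D z. z \<notin> L \<Longrightarrow> Phi (D + 1) s z - \<beta> * Phi D s z = \<kappa>"
    "ee (of_int (int k * s) / N) * \<kappa> = \<kappa>"
proof -
  define f where "f D z = Phi (D + 1) s z - \<beta> * Phi D s z" for D z
  let ?c = "ee (of_int (int k * s) / N)"
  have mero: "f D meromorphic_on UNIV" for D
    unfolding f_def[abs_def] by (intro meromorphic_on_diff meromorphic_on_mult Phi_mero meromorphic_on_const)
  have p1: "f D (z + 1 / N) = ?c * f D z" for D z
    by (simp only: f_def Phi_plus_1n) (simp add: algebra_simps)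
  have p2: "f D (z + \<eta> / N) = f (D + 1) z" for D z
    by (simp add: f_def Phi_plus_etan)
  have c: "?c ^ n = 1"
  proof -
    have "?c ^ n = ee (of_int (int k * s))" unfolding ee_mult_of_nat[symmetric] using N_nz by simp
    then show ?thesis by (simp only: ee_of_int)
  qed
  have Dn: "f (D + int n) = f D" for D
  proof -
    have "D + int n + 1 = (D + 1) + int n" by simp
    then show ?thesis unfolding f_def[abs_def] by (simp only: Phi_plus_n)
  qed
  have cont: "isCont (f D) z" if "z \<notin> L" for D z
    unfolding f_def[abs_def] by (intro continuous_intros Phi_isCont that)
  have lim0: "\<exists>l. (f D \<longlongrightarrow> l) (at 0)" for D
  proof -
    let ?g = "\<lambda>z. Psi (D + 1) s z - \<beta> * Psi D s z"
    have h: "?g holomorphic_on UNIV" by (intro holomorphic_intros Psi_holo)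
    have g0: "?g 0 = 0" by (simp add: Psi_0 \<beta>_def)
    have "(?g has_field_derivative deriv (Psi (D + 1) s) 0 - \<beta> * deriv (Psi D s) 0) (at 0)"
      by (intro DERIV_diff DERIV_cmult holomorphic_derivI[OF Psi_holo]) auto
    then have d0: "deriv ?g 0 = 0" using deriv_Psi_0 by (auto dest: DERIV_imp_deriv)
    obtain l where "(\<lambda>z. ?g z / (vth (- z) * vth z)) \<midarrow>0\<rightarrow> l"
      using double_zero_quotient_limit[OF h g0 d0 entire_compose[OF vth_holo entire_affine(4)] _ _ vth_holo vth_0 deriv_vth_0]
        vth_minus_deriv deriv_vth_0 vth_0 by auto
    moreover have "eventually (\<lambda>z. ?g z / (vth (- z) * vth z) = f D z) (at 0)"
      using eventually_notin_L[of 0]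
    proof eventually_elim
      case (elim z)
      then have "vth z \<noteq> 0" "vth (- z) \<noteq> 0" by (simp_all add: vth_eq_0_iff)
      then show ?case using elim by (simp add: Psi_Phi f_def field_simps)
    qed
    ultimately show ?thesis using Lim_transform_eventually by blast
  qed
  have lim: "\<exists>l. (f D \<longlongrightarrow> l) (at z)" for D z
  proof (cases "z \<in> L")
    case True
    show ?thesis using quasi_limit_shift[of ?c f 0 z D, OF _ p1 p2 lim0 True] by simp
  next
    case False
    then show ?thesis using cont by (auto simp: isCont_def)
  qed
  obtain \<kappa> where k: "\<And>D z. (f D \<longlongrightarrow> \<kappa>) (at z)" "?c * \<kappa> = \<kappa>"
    using quasi_elliptic_const[of f ?c, OF mero lim p1 c p2 Dn] by metis
  have "Phi (D + 1) s z - \<beta> * Phi D s z = \<kappa>" if "z \<notin> L" for D z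
    using cont[OF that, of D] k(1)[of D z] unfolding isCont_def f_def[symmetric] by (rule tendsto_unique[OF at_neq_bot])
  then show ?thesis using that k(2) by blast
qed

lemma Phi_off_diagonal:
  assumes "s mod int n \<noteq> 0" "z \<notin> L"
  shows "Phi D s z = 0"
proof -
  obtain \<kappa> where k: "\<And>D z. z \<notin> L \<Longrightarrow> Phi (D + 1) s z - 0 * Phi D s z = \<kappa>"
    "ee (of_int (int k * s) / N) * \<kappa> = \<kappa>"
    using Phi_difference_const[of s] assms(1) by auto
  txt \<open>\<open>Phi\<close> is constant, but the shift by \<open>1/n\<close> multiplies it by a nontrivial root of unity.\<close>
  have "\<kappa> = 0"
  proof (rule ccontr)
    assume "\<kappa> \<noteq> 0"
    then have "ee (of_int (int k * s) / N) = 1" using k(2) by simp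
    then obtain m where "of_int (int k * s) / N = of_int m" by (auto simp: ee_eq_1_iff elim: Ints_cases)
    then have "(of_int (int k * s) :: complex) = of_int (m * int n)" using N_nz by (simp add: field_simps)
    then have "int k * s = m * int n" by (subst (asm) of_int_eq_iff)
    then have "(int k * s) mod int n = (int k * 0) mod int n" by simp
    from mod_cancel_k[OF this] show False using assms(1) by simp
  qed
  then show ?thesis using k(1)[OF assms(2), of "D - 1"] by simp
qed

text \<open>Raising \<open>D\<close> by one adds a constant \<kappa>, and n such steps lead back to
  the start, so n \<kappa> = 0.\<close>

lemma Phi_diagonal:
  assumes "z \<notin> L"
  shows "Phi D 0 z = Phi 0 0 z"
proof -
  obtain \<kappa> where k: "\<And>D z. z \<notin> L \<Longrightarrow> Phi (D + 1) 0 z - 1 * Phi D 0 z = \<kappa>"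
    using Phi_difference_const[of 0] by auto
  have "Phi (D + int m) 0 z = Phi D 0 z + of_nat m * \<kappa>" for D m
  proof (induction m)
    case (Suc m)
    then show ?case using k[OF assms, of "D + int m"] by (simp add: algebra_simps)
  qed simp
  from this[of 0 n] have "\<kappa> = 0" using N_nz Phi_plus_n[of 0 0] by simp
  then have "Phi (D + 1) 0 z = Phi D 0 z" for D using k[OF assms, of D] by simp
  then show ?thesis using periodic_of_int[of "\<lambda>D. Phi D 0 z" 1 0 D] by simp
qed

end

section \<open>The scalar in the unitarity relation\<close>

context theta_tau
begin

text \<open>By \<open>Phi_diagonal\<close> all summands of \<open>S\<close> agree off
  \<open>L\<close>, but only the whole sum displays the symmetries used below. \<open>Lam\<close> is
  the averaged version with the poles cleared, hence entire.\<close>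

definition "S z = (\<Sum>D\<in>{0..<int n}. Phi D 0 z)"
definition "Lam z = (\<Sum>D\<in>{0..<int n}. Psi D 0 z) / N"

lemma G_residue: "G (a mod int n) y = G a y" "G (- (a mod int n)) y = G (- a) y" "G x (a mod int n) = G x a"
  by (rule G_cong; simp add: mod_minus_eq)+

text \<open>For fixed \<open>x\<close> the index \<open>int k * (D - x)\<close> runs once through
  Z_n. In the resulting sum \<open>k\<close> no longer occurs and \<open>x\<close>, \<open>y\<close>
  range independently.\<close>

lemma S_alt: "S z = (\<Sum>x\<in>{0..<int n}. \<Sum>y\<in>{0..<int n}. G (- x) y (- z) * G x y z)"
proof -
  have "S z = (\<Sum>x\<in>{0..<int n}. \<Sum>D\<in>{0..<int n}. G (- x) (int k * (D - x)) (- z) * G x (int k * (D - x)) z)"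
    unfolding S_def Phi_def by (subst sum.swap) simp
  also have "\<dots> = (\<Sum>x\<in>{0..<int n}. \<Sum>y\<in>{0..<int n}. G (- x) y (- z) * G x y z)"
  proof (rule sum.cong[OF refl])
    fix x
    let ?f = "\<lambda>y. G (- x) y (- z) * G x y z"
    show "(\<Sum>D\<in>{0..<int n}. ?f (int k * (D - x))) = (\<Sum>y\<in>{0..<int n}. ?f y)"
    proof (rule sum_residues_reindex[where f = ?f and g = "\<lambda>D. int k * (D - x)"])
      show "?f (a mod int n) = ?f a" for a by (simp add: G_residue)
      fix a b assume ab: "a \<in> {0..<int n}" "b \<in> {0..<int n}" "(int k * (a - x)) mod int n = (int k * (b - x)) mod int n"
      from mod_cancel_k[OF ab(3)] have "((a - x) + x) mod int n = ((b - x) + x) mod int n" by (metis mod_add_left_eq)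
      then show "a = b" using ab by simp
    qed
  qed
  finally show ?thesis .
qed

lemma S_uminus: "S (- z) = S z"
proof -
  let ?f = "\<lambda>x. \<Sum>y\<in>{0..<int n}. G (- x) y (- z) * G x y z"
  have "S (- z) = (\<Sum>x\<in>{0..<int n}. ?f (- x))"
    unfolding S_alt by (simp add: mult.commute)
  also have "\<dots> = (\<Sum>x\<in>{0..<int n}. ?f x)"
  proof (rule sum_residues_reindex)
    show "?f (a mod int n) = ?f a" for a by (simp add: G_residue)
    fix a b assume ab: "a \<in> {0..<int n}" "b \<in> {0..<int n}" "(- a) mod int n = (- b) mod int n"
    then have "(- (- a)) mod int n = (- (- b)) mod int n" by (metis mod_minus_eq)
    then show "a = b" using ab by simp
  qed
  finally show ?thesis by (simp add: S_alt)
qed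

lemma S_tau: "S \<tau> = 0"
proof -
  let ?f = "\<lambda>x y. G (- x) y (- \<tau>) * G x y \<tau>"
  txt \<open>The summands of \<open>S_alt\<close> at \<open>\<tau>\<close> are antisymmetric in \<open>x\<close> and \<open>y\<close>.\<close>
  have f: "?f y x = - ?f x y" for x y
  proof -
    \<comment> \<open>At z = \<tau> the numerator of the first \<open>G\<close> is
      \<open>t (y - x)\<close> at the origin, which is odd in \<open>y - x\<close> up to a root of
      unity. The other factors are symmetric in \<open>x\<close> and \<open>y\<close>, apart from
      the multiplier produced by \<open>t (- x) (- \<tau>)\<close>, which offsets this root of
      unity.\<close>
    have *: "?f x y = - (t (y - x) 0 * t (x + y) (\<tau> + \<tau>) / ((t x \<tau>)\<^sup>2 * (t y \<tau>)\<^sup>2)) / ee (- of_int x / N - N * \<tau>)" for x y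
      unfolding G_def t_uminus by (simp add: power2_eq_square add_ac)
    let ?A = "ee (of_int (x - y) / N)" and ?B = "ee (- of_int y / N - N * \<tau>)" and ?C = "ee (- of_int x / N - N * \<tau>)"
    let ?T = "t (y - x) 0 * t (x + y) (\<tau> + \<tau>) / ((t x \<tau>)\<^sup>2 * (t y \<tau>)\<^sup>2)"
    have u: "t (x - y) 0 = - ?A * t (y - x) 0"
      using t_uminus[of "x - y" 0] by simp
    have "?f y x = (?A / ?B) * ?T"
      unfolding *[of y x] u by (simp add: add.commute mult_ac)
    moreover have "ee (of_int (x - y) / N) / ee (- of_int y / N - N * \<tau>) = 1 / ee (- of_int x / N - N * \<tau>)"
    proof -
      have "of_int (x - y) / N - (- of_int y / N - N * \<tau>) = 0 - (- of_int x / N - N * \<tau>)"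
        by (simp add: diff_divide_distrib)
      then have "ee (of_int (x - y) / N - (- of_int y / N - N * \<tau>)) = ee (0 - (- of_int x / N - N * \<tau>))" by (rule arg_cong)
      then show ?thesis by (simp only: ee_diff[of "of_int (x - y) / N" "- of_int y / N - N * \<tau>"]
            ee_diff[of 0 "- of_int x / N - N * \<tau>"] ee_0)
    qed
    ultimately have "?f y x = (1 / ?C) * ?T" by (simp only:)
    moreover have "?f x y = - ((1 / ?C) * ?T)" unfolding *[of x y] by simp
    ultimately show ?thesis by (simp only: minus_minus)
  qed
  have "(\<Sum>x\<in>{0..<int n}. \<Sum>y\<in>{0..<int n}. ?f y x) = - (\<Sum>x\<in>{0..<int n}. \<Sum>y\<in>{0..<int n}. ?f x y)"
    unfolding sum_negf[symmetric] by (rule sum.cong[OF refl], rule sum.cong[OF refl], rule f)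
  moreover have "(\<Sum>x\<in>{0..<int n}. \<Sum>y\<in>{0..<int n}. ?f y x) = (\<Sum>x\<in>{0..<int n}. \<Sum>y\<in>{0..<int n}. ?f x y)"
    by (rule sum.swap)
  ultimately show ?thesis unfolding S_alt by simp
qed

lemma Lam_holo: "Lam holomorphic_on UNIV"
  unfolding Lam_def[abs_def] using N_nz
  by (intro holomorphic_on_divide holomorphic_on_sum Psi_holo holomorphic_on_const) auto

lemma Lam_S: "z \<notin> L \<Longrightarrow> Lam z = vth (- z) * vth z * S z / N"
  by (simp add: Lam_def S_def Psi_Phi sum_distrib_left)

lemma Lam_Phi: "z \<notin> L \<Longrightarrow> vth (- z) * vth z * Phi D 0 z = Lam z"
proof -
  assume z: "z \<notin> L"
  have "S z = (\<Sum>D\<in>{0..<int n}. Phi 0 0 z)"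
    unfolding S_def using Phi_diagonal[OF z] by (intro sum.cong) auto
  then have "S z = N * Phi 0 0 z" by simp
  then show ?thesis using Lam_S[OF z] Phi_diagonal[OF z, of D] N_nz by simp
qed

lemma Lam_0: "Lam 0 = c0 ^ 2"
  using N_nz by (simp add: Lam_def Psi_0)

lemma Lam_tau: "Lam \<tau> = 0" "Lam (- \<tau>) = 0"
  using tau S_tau S_uminus[of \<tau>] by (simp_all add: Lam_S)

text \<open>Has the same multipliers under 1/n and \<eta>/n as \<open>vth (- z) * vth z\<close>, but
  its zeros are moved from (1/n)\<Lambda> to the cosets of \<tau> and -\<tau>.\<close>

definition "W z = vth (z - \<tau>) * vth (- z - \<tau>)"

lemma W_holo: "W holomorphic_on UNIV"
  unfolding W_def[abs_def] by (intro holomorphic_on_mult entire_compose[OF vth_holo] entire_affine)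

lemma W_uminus: "W (- z) = W z"
  by (simp add: W_def mult.commute)

lemma W_tau: "W \<tau> = 0" "W (- \<tau>) = 0"
  by (simp_all add: W_def vth_0)

text \<open>The second factor is what makes the zero of \<open>W\<close> at \<tau> simple exactly
  for 2\<tau> outside (1/n)\<Lambda>.\<close>

lemma deriv_W_tau: "deriv W \<tau> = deriv vth 0 * vth (- \<tau> - \<tau>)"
proof -
  have "(vth has_field_derivative deriv vth 0) (at (\<tau> - \<tau>))"
    using holomorphic_derivI[OF vth_holo, of 0 UNIV] by simp
  from DERIV_chain2[OF this DERIV_diff[OF DERIV_ident DERIV_const]]
  have "deriv (\<lambda>z. vth (z - \<tau>)) \<tau> = deriv vth 0" by (auto dest: DERIV_imp_deriv)
  then show ?thesis
    unfolding W_def[abs_def]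
    by (subst deriv_mult_at_zero) (auto intro!: entire_compose[OF vth_holo] entire_affine simp: vth_0)
qed

lemma deriv_W_minus_tau: "deriv W (- \<tau>) = - deriv W \<tau>"
proof -
  have "W = (\<lambda>z. W (- z))" by (simp add: W_uminus)
  then have "deriv W (- \<tau>) = deriv (\<lambda>z. W (- z)) (- \<tau>)" by simp
  also have "\<dots> = - deriv W \<tau>" using DERIV_uminus_arg[OF W_holo, of "- \<tau>"] by (auto dest: DERIV_imp_deriv)
  finally show ?thesis .
qed

text \<open>Comparing the elliptic function \<open>Lam / W\<close> with its value at the origin shows that the
  zero of \<open>Lam\<close> at \<open>\<tau>\<close> is simple.\<close>

lemma deriv_Lam_tau:
  assumes "\<tau> + \<tau> \<notin> L"
  shows "deriv Lam \<tau> \<noteq> 0"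
proof -
  \<comment> \<open>Written with \<open>S\<close>, whose periodicity holds at every point, poles
    included. Off \<open>L\<close> it is n times \<open>Lam / W\<close>, and this suffices for
    limits.\<close>
  define F where "F z = S z * (vth (- z) * vth z) / W z" for z
  have nz: "vth (- \<tau> - \<tau>) \<noteq> 0"
    using assms L_uminus_iff[of "\<tau> + \<tau>"] by (simp add: vth_eq_0_iff)
  have dW: "deriv W \<tau> \<noteq> 0" using nz deriv_vth_0 deriv_W_tau by simp
  have FL: "F z = N * (Lam z / W z)" if "z \<notin> L" for z
    using that N_nz by (simp add: F_def Lam_S mult_ac)
  have lim_of: "(F \<longlongrightarrow> N * l) (at z)" if "((\<lambda>z. Lam z / W z) \<longlongrightarrow> l) (at z)" for l z
  proof (rule Lim_transform_eventually)
    show "((\<lambda>z. N * (Lam z / W z)) \<longlongrightarrow> N * l) (at z)" by (intro tendsto_mult tendsto_const that)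
    show "eventually (\<lambda>z. N * (Lam z / W z) = F z) (at z)"
      using eventually_notin_L[of z] by eventually_elim (simp add: FL)
  qed
  have cont: "((\<lambda>z. Lam z / W z) \<longlongrightarrow> Lam z / W z) (at z)" if "W z \<noteq> 0" for z
    using entire_isCont[OF Lam_holo, of z] entire_isCont[OF W_holo, of z] that
    by (auto simp: isCont_def intro!: tendsto_divide)
  have ltau: "(F \<longlongrightarrow> N * (deriv Lam \<tau> / deriv W \<tau>)) (at \<tau>)"
    by (intro lim_of simple_zero_quotient_limit Lam_holo W_holo Lam_tau W_tau dW)
  have lmtau: "(F \<longlongrightarrow> N * (deriv Lam (- \<tau>) / deriv W (- \<tau>))) (at (- \<tau>))"
    using dW by (intro lim_of simple_zero_quotient_limit Lam_holo W_holo Lam_tau W_tau) (simp add: deriv_W_minus_tau)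
  have S1: "S (z + 1 / N) = S z" for z
    by (simp add: S_def Phi_plus_1n)
  have S2: "S (z + \<eta> / N) = S z" for z
    unfolding S_def Phi_plus_etan
  proof (rule sum_residues_shift)
    fix a
    have "Phi (a mod int n + of_int (a div int n) * int n) 0 = Phi (a mod int n) 0"
      by (rule periodic_of_int[of "\<lambda>D. Phi D 0"]) (rule Phi_plus_n)
    then show "Phi (a mod int n) 0 z = Phi a 0 z" by simp
  qed
  have m: "- (z + 1 / N) = - z - 1 / N" "z + 1 / N - \<tau> = (z - \<tau>) + 1 / N" "- z - 1 / N - \<tau> = (- z - \<tau>) - 1 / N"
    "- (z + \<eta> / N) = - z - \<eta> / N" "z + \<eta> / N - \<tau> = (z - \<tau>) + \<eta> / N" "- z - \<eta> / N - \<tau> = (- z - \<tau>) - \<eta> / N" for z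
    by simp_all
  have F1: "F (z + 1 / N) = 1 * F z" for z
    unfolding F_def W_def m S1 vth_plus_1n vth_minus_1n by simp
  have F2: "F (z + \<eta> / N) = F z" for z
  proof -
    have aux: "x * ((b / q) * (p * a)) / ((r * a') * (b' / s)) = x * (b * a) / (a' * b')"
      if "p * s = r * q" "q \<noteq> 0" "s \<noteq> 0" "r \<noteq> 0" for x a b a' b' p q r s :: complex
    proof -
      have "x * ((b / q) * (p * a)) / ((r * a') * (b' / s)) = x * (b * a) * (p * s) / (a' * b' * (r * q))"
        using that(3) by (simp add: mult_ac)
      then show ?thesis unfolding that(1) using that by simp
    qed
    have "ee (N * (shift_const - z)) * ee (N * (shift_const + \<eta> / N - (- z - \<tau>))) = ee (N * (shift_const - (z - \<tau>))) * ee (N * (shift_const + \<eta> / N - - z))"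
      unfolding ee_add[symmetric] by (simp add: algebra_simps)
    then show ?thesis
      unfolding F_def W_def m S2 vth_plus_etan vth_minus_etan by (rule aux) auto
  qed
  have mero: "F meromorphic_on UNIV"
    unfolding F_def[abs_def] S_def
    by (intro meromorphic_on_divide meromorphic_on_mult meromorphic_on_sum Phi_mero entire_meromorphic W_holo
        vth_holo entire_compose[OF vth_holo] entire_affine)
  have lim: "\<exists>l. (F \<longlongrightarrow> l) (at z)" for z
  proof (cases "W z = 0")
    case False
    then show ?thesis using lim_of[OF cont] by blast
  next
    case True
    then have "z - \<tau> \<in> L \<or> - z - \<tau> \<in> L" by (simp add: W_def vth_eq_0_iff)
    moreover have "- z - \<tau> \<in> L \<Longrightarrow> z + \<tau> \<in> L" using L_uminus_iff[of "z + \<tau>"] by simp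
    ultimately consider "z - \<tau> \<in> L" | "z + \<tau> \<in> L" by blast
    then show ?thesis
    proof cases
      case 1
      show ?thesis using quasi_limit_shift[of 1 "\<lambda>_. F" \<tau> "z - \<tau>" 0, OF _ F1 F2 _ 1] ltau by auto
    next
      case 2
      show ?thesis using quasi_limit_shift[of 1 "\<lambda>_. F" "- \<tau>" "z + \<tau>" 0, OF _ F1 F2 _ 2] lmtau by auto
    qed
  qed
  obtain K where K: "\<And>z. (F \<longlongrightarrow> K) (at z)"
    using quasi_elliptic_const[of "\<lambda>_. F" 1, OF mero lim F1 _ F2] by auto
  have "W 0 \<noteq> 0" using tau by (simp add: W_def vth_eq_0_iff)
  then have "K = N * (Lam 0 / W 0)" "W 0 \<noteq> 0"
    using tendsto_unique[OF at_neq_bot K lim_of[OF cont]] by auto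
  then have "K \<noteq> 0" using N_nz c0_nz by (simp add: Lam_0)
  moreover have "K = N * (deriv Lam \<tau> / deriv W \<tau>)" by (rule tendsto_unique[OF at_neq_bot K ltau])
  ultimately show ?thesis by auto
qed

end

section \<open>Entries of the R-matrix and unitarity\<close>

context theta_level
begin

text \<open>Only the index \<open>r = j - a\<close> contributes to the sum in \<open>R_coeff\<close>.\<close>

definition "R_entry k \<tau> z a b i j =
  (if (a + b) mod int n = (i + j) mod int n
   then vth (- z) / c0 * (t (a - i + int k * (j - a)) (- z + \<tau>) / (t (a - i) (- z) * t (int k * (j - a)) \<tau>)) else 0)"

lemma prod_nat_int: "(\<Prod>\<alpha><n. t (int \<alpha>) z) = vth z"
  unfolding vth_def
  by (rule prod.reindex_bij_witness[of _ nat int]) auto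

lemma prod_nat_int': "(\<Prod>\<alpha>\<in>{1..<n}. t (int \<alpha>) 0) = c0"
  unfolding c0_def vth_cof_def
  by (rule prod.reindex_bij_witness[of _ nat int]) auto

text \<open>The two congruences fix r in Z_n and are compatible only if the index sums agree. For r
  = j - a the numerator index j - i + r (k - 1) is a - i + k (j - a), the sum of the two denominator
  indices.\<close>

lemma R_coeff_eq:
  assumes "a < n" "b < n" "i < n" "j < n"
  shows "R_coeff n k \<eta> \<tau> z a b i j = R_entry k \<tau> z (int a) (int b) (int i) (int j)"
proof -
  let ?Q = "{r. r < n \<and> (int j - int r) mod int n = int a \<and> (int i + int r) mod int n = int b}"
  let ?C = "(int a + int b) mod int n = (int i + int j) mod int n"
  let ?r = "nat ((int j - int a) mod int n)"
  let ?f = "\<lambda>r. t (int j - int i + int r * (int k - 1)) (- z + \<tau>)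
          / (t (int j - int i - int r) (- z) * t (int k * int r) \<tau>)"
  have ia: "(int j - r) mod int n = int a \<longleftrightarrow> r mod int n = (int j - int a) mod int n" for r
  proof -
    have "(int j - r) mod int n = int a \<longleftrightarrow> (int j - r) mod int n = int a mod int n" using assms by simp
    also have "\<dots> \<longleftrightarrow> int n dvd (int j - r) - int a" by (simp add: mod_eq_dvd_iff)
    also have "\<dots> \<longleftrightarrow> int n dvd r - (int j - int a)"
      using dvd_minus_iff[of "int n" "r - (int j - int a)"] by (simp add: algebra_simps)
    finally show ?thesis by (simp add: mod_eq_dvd_iff)
  qed
  have ib: "(int i + r) mod int n = int b \<longleftrightarrow> ?C" if "r mod int n = (int j - int a) mod int n" for r
  proof -
    have d: "int n dvd r - (int j - int a)" using that by (simp add: mod_eq_dvd_iff)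
    have "(int i + r) mod int n = int b \<longleftrightarrow> (int i + r) mod int n = int b mod int n" using assms by simp
    also have "\<dots> \<longleftrightarrow> int n dvd (int i + r) - int b" by (simp add: mod_eq_dvd_iff)
    also have "(int i + r) - int b = (r - (int j - int a)) - ((int a + int b) - (int i + int j))" by simp
    also have "int n dvd \<dots> \<longleftrightarrow> int n dvd (int a + int b) - (int i + int j)"
      using d dvd_diff_right_iff by (metis dvd_diff_commute dvd_diff_right_iff)
    finally show ?thesis by (simp add: mod_eq_dvd_iff)
  qed
  have rm: "int ?r mod int n = (int j - int a) mod int n" and rn: "?r < n" using n_pos by (auto simp: nat_less_iff)
  have Q: "?Q = (if ?C then {?r} else {})"
  proof -
    have "r \<in> ?Q \<longleftrightarrow> r = ?r \<and> ?C" for r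
    proof
      assume "r \<in> ?Q"
      then have r: "r < n" "int r mod int n = (int j - int a) mod int n" "(int i + int r) mod int n = int b"
        by (auto simp: ia)
      then show "r = ?r \<and> ?C" using ib[OF r(2)] by auto
    next
      assume "r = ?r \<and> ?C"
      then show "r \<in> ?Q" using rm rn ia[of "int ?r"] ib[OF rm] by simp
    qed
    then show ?thesis by auto
  qed
  have d: "int n dvd int ?r - (int j - int a)" using rm by (simp only: mod_eq_dvd_iff)
  have "t (int j - int i + int ?r * (int k - 1)) = t (int a - int i + int k * (int j - int a))"
  proof (rule t_cong)
    have "(int j - int i + int ?r * (int k - 1)) - (int a - int i + int k * (int j - int a))
       = (int ?r - (int j - int a)) * (int k - 1)" by (simp add: algebra_simps)
    then show "(int j - int i + int ?r * (int k - 1)) mod int n = (int a - int i + int k * (int j - int a)) mod int n"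
      unfolding mod_eq_dvd_iff using d by (metis dvd_mult2)
  qed
  moreover have "t (int j - int i - int ?r) = t (int a - int i)"
  proof (rule t_cong)
    have "(int j - int i - int ?r) - (int a - int i) = - (int ?r - (int j - int a))" by simp
    then show "(int j - int i - int ?r) mod int n = (int a - int i) mod int n"
      unfolding mod_eq_dvd_iff using d by (metis dvd_minus_iff)
  qed
  moreover have "t (int k * int ?r) = t (int k * (int j - int a))"
  proof (rule t_cong)
    have "int k * int ?r - int k * (int j - int a) = int k * (int ?r - (int j - int a))" by (simp add: algebra_simps)
    then show "(int k * int ?r) mod int n = (int k * (int j - int a)) mod int n"
      unfolding mod_eq_dvd_iff using d by (metis dvd_mult)
  qed
  ultimately have f: "?f ?r = t (int a - int i + int k * (int j - int a)) (- z + \<tau>) / (t (int a - int i) (- z) * t (int k * (int j - int a)) \<tau>)"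
    by (simp only:)
  have "(\<Sum>r\<in>?Q. ?f r) = (if ?C then ?f ?r else 0)"
    unfolding Q by (simp only: sum.insert sum.empty finite.emptyI empty_iff not_False_eq_True add_0_right if_distrib cong: if_cong split: if_splits) simp
  then show ?thesis
    unfolding R_coeff_def R_entry_def prod_nat_int prod_nat_int' f by simp
qed

lemma sum_div_mod:
  "(\<Sum>p<n * n. f (p div n) (p mod n)) = (\<Sum>c<n. \<Sum>d<n. f c d :: 'a :: comm_monoid_add)"
proof -
  have "(\<Sum>c<n. \<Sum>d<n. f c d) = (\<Sum>(c, d)\<in>{..<n} \<times> {..<n}. f c d)"
    by (rule sum.cartesian_product)
  also have "\<dots> = (\<Sum>p<n * n. f (p div n) (p mod n))"
  proof (rule sum.reindex_bij_witness[of _ "\<lambda>p. (p div n, p mod n)" "\<lambda>(c, d). c * n + d"])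
    fix cd assume "cd \<in> {..<n} \<times> {..<n}"
    then obtain c d where cd: "cd = (c, d)" "c < n" "d < n" by auto
    have "Suc c * n \<le> n * n" using cd(2) by (intro mult_le_mono1) auto
    then have "c * n + d < n * n" using cd(3) by simp
    then show "(case cd of (c, d) \<Rightarrow> c * n + d) \<in> {..<n * n}" by (simp add: cd)
  qed (use n_pos in \<open>auto simp: less_mult_imp_div_less\<close>)
  finally show ?thesis ..
qed

end

context theta_tau
begin

text \<open>Conservation of the index sum forces d = i + j - c in Z_n, which leaves one sum over c;
  the substitution e = c - i turns it into \<open>Phi\<close>.\<close>

lemma R_entry_unitarity:
  assumes z: "z \<notin> L" and "a < n" "b < n" "i < n" "j < n"
  shows "(\<Sum>c<n. \<Sum>d<n. R_entry k \<tau> z (int a) (int b) (int c) (int d) * R_entry k \<tau> (- z) (int c) (int d) (int i) (int j))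
    = (if a = i \<and> b = j then Lam z / c0 ^ 2 else 0)"
proof -
  let ?C = "(int a + int b) mod int n = (int i + int j) mod int n"
  let ?m = "vth (- z) * vth z / c0 ^ 2"
  let ?f = "\<lambda>c. G (int a - c) (int k * (int i + int j - c - int a)) (- z) * G (c - int i) (int k * (int j - c)) z"
  have inner: "(\<Sum>d<n. R_entry k \<tau> z (int a) (int b) (int c) (int d) * R_entry k \<tau> (- z) (int c) (int d) (int i) (int j))
     = (if ?C then ?m * ?f (int c) else 0)" if "c < n" for c
  proof -
    define d0 where "d0 = nat ((int i + int j - int c) mod int n)"
    have dn: "d0 < n" using n_pos by (auto simp: d0_def nat_less_iff)
    have iff: "(int c + int d) mod int n = (int i + int j) mod int n \<longleftrightarrow> d = d0" if "d < n" for d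
    proof -
      have "(int c + int d) mod int n = (int i + int j) mod int n \<longleftrightarrow> int d mod int n = (int i + int j - int c) mod int n"
        by (simp add: mod_eq_dvd_iff algebra_simps)
      then show ?thesis using that by (auto simp: d0_def)
    qed
    have dm: "(int c + int d0) mod int n = (int i + int j) mod int n" using iff[OF dn] by simp
    have Gd: "G (int a - int c) (int k * (int d0 - int a)) = G (int a - int c) (int k * (int i + int j - int c - int a))"
    proof (rule G_cong_k)
      show "(int d0 - int a) mod int n = (int i + int j - int c - int a) mod int n"
        using dm by (simp only: mod_eq_dvd_iff) (simp add: algebra_simps)
    qed simp
    have "(\<Sum>d<n. R_entry k \<tau> z (int a) (int b) (int c) (int d) * R_entry k \<tau> (- z) (int c) (int d) (int i) (int j))
       = (\<Sum>d<n. if d = d0 then R_entry k \<tau> z (int a) (int b) (int c) (int d0) * R_entry k \<tau> (- z) (int c) (int d0) (int i) (int j) else 0)"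
    proof (rule sum.cong)
      fix d assume "d \<in> {..<n}"
      then have "R_entry k \<tau> (- z) (int c) (int d) (int i) (int j) = 0" if "d \<noteq> d0"
        using iff[of d] that unfolding R_entry_def by simp
      then show "R_entry k \<tau> z (int a) (int b) (int c) (int d) * R_entry k \<tau> (- z) (int c) (int d) (int i) (int j) =
        (if d = d0 then R_entry k \<tau> z (int a) (int b) (int c) (int d0) * R_entry k \<tau> (- z) (int c) (int d0) (int i) (int j) else 0)"
        by (metis mult_zero_right)
    qed simp
    also have "\<dots> = R_entry k \<tau> z (int a) (int b) (int c) (int d0) * R_entry k \<tau> (- z) (int c) (int d0) (int i) (int j)"
      using dn by simp
    also have "\<dots> = (if ?C then ?m * ?f (int c) else 0)"
    proof -
      have "R_entry k \<tau> z (int a) (int b) (int c) (int d0) = (if ?C then vth (- z) / c0 * G (int a - int c) (int k * (int d0 - int a)) (- z) else 0)"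
        by (simp add: R_entry_def G_def dm)
      moreover have "R_entry k \<tau> (- z) (int c) (int d0) (int i) (int j) = vth z / c0 * G (int c - int i) (int k * (int j - int c)) z"
        using dm by (simp add: R_entry_def G_def)
      ultimately show ?thesis unfolding Gd by (simp add: power2_eq_square)
    qed
    finally show ?thesis .
  qed
  have "(\<Sum>c<n. \<Sum>d<n. R_entry k \<tau> z (int a) (int b) (int c) (int d) * R_entry k \<tau> (- z) (int c) (int d) (int i) (int j))
     = (if ?C then ?m * (\<Sum>c<n. ?f (int c)) else 0)"
    using inner by (simp add: sum_distrib_left)
  also have "(\<Sum>c<n. ?f (int c)) = (\<Sum>c\<in>{0..<int n}. ?f c)"
    by (rule sum.reindex_bij_witness[of _ nat int]) auto
  also have "\<dots> = (\<Sum>e\<in>{0..<int n}. ?f (e + int i))"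
  proof (rule sum_residues_shift[symmetric])
    fix e
    show "?f (e mod int n) = ?f e"
      by (intro arg_cong2[of _ _ _ _ times] fun_cong[OF G_cong_k]) (simp_all add: mod_residue mod_diff_left_eq)
  qed
  also have "\<dots> = Phi (int j - int i) (int a - int i) z"
    unfolding Phi_def by (simp add: algebra_simps)
  finally have *: "(\<Sum>c<n. \<Sum>d<n. R_entry k \<tau> z (int a) (int b) (int c) (int d) * R_entry k \<tau> (- z) (int c) (int d) (int i) (int j))
     = (if ?C then ?m * Phi (int j - int i) (int a - int i) z else 0)" .
  show ?thesis
  proof (cases "a = i")
    case True
    have "?C \<longleftrightarrow> b = j"
      using assms True by (auto simp: mod_eq_dvd_iff) (metis mod_eq_dvd_iff mod_less of_nat_eq_iff zmod_int)
    then show ?thesis using * True Lam_Phi[OF z, of "int j - int i"] by simp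
  next
    case False
    have "(int a - int i) mod int n \<noteq> 0"
    proof
      assume "(int a - int i) mod int n = 0"
      then have "int a mod int n = int i mod int n" by (metis mod_eq_dvd_iff dvd_eq_mod_eq_0)
      then show False using assms False by simp
    qed
    then show ?thesis using * False Phi_off_diagonal z by simp
  qed
qed

lemma R_mat_unitarity:
  assumes "z \<notin> L"
  shows "R_mat n k \<eta> \<tau> z * R_mat n k \<eta> \<tau> (- z) = (Lam z / c0 ^ 2) \<cdot>\<^sub>m 1\<^sub>m (n * n)"
proof (rule eq_matI)
  fix p q assume "p < dim_row ((Lam z / c0 ^ 2) \<cdot>\<^sub>m 1\<^sub>m (n * n))" "q < dim_col ((Lam z / c0 ^ 2) \<cdot>\<^sub>m 1\<^sub>m (n * n))"
  then have pq: "p < n * n" "q < n * n" by simp_all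
  then have b: "p div n < n" "p mod n < n" "q div n < n" "q mod n < n"
    using n_pos by (auto simp: less_mult_imp_div_less)
  have "(R_mat n k \<eta> \<tau> z * R_mat n k \<eta> \<tau> (- z)) $$ (p, q) =
     (\<Sum>r<n * n. R_coeff n k \<eta> \<tau> z (p div n) (p mod n) (r div n) (r mod n) * R_coeff n k \<eta> \<tau> (- z) (r div n) (r mod n) (q div n) (q mod n))"
    using pq by (simp add: R_mat_def scalar_prod_def atLeast0LessThan)
  also have "\<dots> = (\<Sum>c<n. \<Sum>d<n. R_coeff n k \<eta> \<tau> z (p div n) (p mod n) c d * R_coeff n k \<eta> \<tau> (- z) c d (q div n) (q mod n))"
    by (rule sum_div_mod)
  also have "\<dots> = (if p div n = q div n \<and> p mod n = q mod n then Lam z / c0 ^ 2 else 0)"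
    using b by (simp add: R_coeff_eq R_entry_unitarity[OF assms])
  also have "p div n = q div n \<and> p mod n = q mod n \<longleftrightarrow> p = q" by (metis div_mod_decomp)
  finally show "(R_mat n k \<eta> \<tau> z * R_mat n k \<eta> \<tau> (- z)) $$ (p, q) = ((Lam z / c0 ^ 2) \<cdot>\<^sub>m 1\<^sub>m (n * n)) $$ (p, q)"
    using pq by simp
qed (simp_all add: R_mat_def)

end

section \<open>Ranks of matrices\<close>

context vec_space
begin

lemma dim_subspace_mono:
  assumes "subspace class_ring W1 V" "subspace class_ring W2 V" "W1 \<subseteq> W2"
    "vectorspace.fin_dim class_ring (vs W1)" "vectorspace.fin_dim class_ring (vs W2)"
  shows "vectorspace.dim class_ring (vs W1) \<le> vectorspace.dim class_ring (vs W2)"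
  using vectorspace.subspace_dim[OF subspace_is_vs[OF assms(2)] nested_subspaces[OF assms(2,1,3)] assms(5)]
    assms(4) by auto

lemma col_space_subspace:
  assumes "A \<in> carrier_mat n nc"
  shows "subspace class_ring (col_space A) V" "vectorspace.fin_dim class_ring (vs (col_space A))"
  using assms cols_dim[of A] fin_dim_span_cols[OF assms] span_is_subspace[of "set (cols A)"]
  by (auto simp: col_space_def)

lemma rank_le_of_col_space_subset:
  assumes "A \<in> carrier_mat n nc" "B \<in> carrier_mat n nc'" "col_space A \<subseteq> col_space B"
  shows "rank A \<le> rank B"
  using dim_subspace_mono[OF col_space_subspace(1)[OF assms(1)] col_space_subspace(1)[OF assms(2)] assms(3)
      col_space_subspace(2)[OF assms(1)] col_space_subspace(2)[OF assms(2)]]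
  by (simp add: rank_def col_space_def)

lemma rank_mult_le_left:
  assumes A: "A \<in> carrier_mat n n" and B: "B \<in> carrier_mat n n"
  shows "rank (A * B) \<le> rank A"
proof (rule rank_le_of_col_space_subset)
  show "A * B \<in> carrier_mat n n" "A \<in> carrier_mat n n" using A B by auto
  show "col_space (A * B) \<subseteq> col_space A"
  proof
    fix y assume "y \<in> col_space (A * B)"
    then obtain x where x: "x \<in> carrier_vec n" "y = (A * B) *\<^sub>v x"
      using col_space_eq[of "A * B" n] A B by auto
    then have "y = A *\<^sub>v (B *\<^sub>v x)" "B *\<^sub>v x \<in> carrier_vec n" using A B by auto
    then show "y \<in> col_space A" using col_space_eq[OF A] A by auto
  qed
qed

lemma rank_le_card_span:
  assumes "A \<in> carrier_mat n nc" "finite S" "S \<subseteq> carrier_vec n" "set (cols A) \<subseteq> span S"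
  shows "rank A \<le> card S"
proof -
  have sub: "subspace class_ring (span S) V" using assms(3) by (intro span_is_subspace) auto
  have fd: "vectorspace.fin_dim class_ring (vs (span S))" using assms(2,3) by (intro fin_dim_span) auto
  have vs: "vectorspace class_ring (vs (span S))" using sub by (rule subspace_is_vs)
  have "col_space A \<subseteq> span S"
    unfolding col_space_def using assms(3,4) sub
    by (intro span_is_subset) (auto simp: subspace_def)
  then have "rank A \<le> vectorspace.dim class_ring (vs (span S))"
    using dim_subspace_mono[OF col_space_subspace(1)[OF assms(1)] sub _ col_space_subspace(2)[OF assms(1)] fd]
    by (simp add: rank_def col_space_def)
  also have "\<dots> \<le> card S"
  proof (rule vectorspace.gen_ge_dim[OF vs assms(2)])
    show "S \<subseteq> carrier (vs (span S))" using assms(3) in_own_span by auto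
    show "LinearCombinations.module.gen_set class_ring (vs (span S)) S"
      using span_li_not_depend(1)[of S "span S"] assms(3) in_own_span[of S] sub by (auto simp: subspace_def)
  qed
  finally show ?thesis .
qed

lemma mult_mat_linear_map:
  assumes A: "A \<in> carrier_mat n n"
  shows "linear_map class_ring V V (\<lambda>v. A *\<^sub>v v)"
proof -
  have "(\<lambda>v. A *\<^sub>v v) \<in> LinearCombinations.module_hom class_ring V V"
    unfolding LinearCombinations.module_hom_def
    using A by (auto simp: mult_add_distrib_mat_vec[OF A] mult_mat_vec[OF A])
  then have "mod_hom class_ring V V (\<lambda>v. A *\<^sub>v v)"
    by (intro mod_hom.intro mod_hom_axioms.intro vec_module)
  then show ?thesis by (intro linear_map.intro vec_vs)
qed

lemma rank_kernel:
  assumes A: "A \<in> carrier_mat n n"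
  shows "rank A + vectorspace.dim class_ring (vs (mat_kernel A)) = n"
    and "subspace class_ring (mat_kernel A) V" "vectorspace.fin_dim class_ring (vs (mat_kernel A))"
proof -
  interpret T: linear_map class_ring V V "\<lambda>v. A *\<^sub>v v" by (rule mult_mat_linear_map[OF A])
  have k: "T.kerT = mat_kernel A"
    unfolding T.ker_def mat_kernel_def using A by auto
  have i: "T.imT = col_space A"
    unfolding T.im_def col_space_eq[OF A] using A by auto
  show "rank A + vectorspace.dim class_ring (vs (mat_kernel A)) = n"
    using T.rank_nullity[OF fin_dim] dim_is_n unfolding k i by (simp add: rank_def col_space_def)
  show "subspace class_ring (mat_kernel A) V" using T.kerT_is_subspace unfolding k .
  then have vs: "vectorspace class_ring (vs (mat_kernel A))" by (rule subspace_is_vs)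
  obtain B where "finite B" "kernel.basis n A B" using kernel_basis_exists[OF A] by blast
  then show "vectorspace.fin_dim class_ring (vs (mat_kernel A))"
    unfolding vectorspace.fin_dim_def[OF vs] vectorspace.basis_def[OF vs] by auto
qed

lemma rank_mult_le_right:
  assumes A: "A \<in> carrier_mat n n" and B: "B \<in> carrier_mat n n"
  shows "rank (A * B) \<le> rank B"
proof -
  have AB: "A * B \<in> carrier_mat n n" using A B by auto
  have "mat_kernel B \<subseteq> mat_kernel (A * B)" by (rule mat_kernel_mult_subset[OF B A])
  from dim_subspace_mono[OF rank_kernel(2)[OF B] rank_kernel(2)[OF AB] this rank_kernel(3)[OF B] rank_kernel(3)[OF AB]]
  show ?thesis using rank_kernel(1)[OF B] rank_kernel(1)[OF AB] by simp
qed

text \<open>The image of \<open>B\<close> lies in the kernel of \<open>A\<close>.\<close>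

lemma rank_add_le_if_mult_eq_0:
  assumes A: "A \<in> carrier_mat n n" and B: "B \<in> carrier_mat n n" and "A * B = 0\<^sub>m n n"
  shows "rank A + rank B \<le> n"
proof -
  have "col_space B \<subseteq> mat_kernel A"
  proof
    fix y assume "y \<in> col_space B"
    then obtain x where x: "x \<in> carrier_vec n" "y = B *\<^sub>v x"
      using col_space_eq[OF B] B by auto
    then have "A *\<^sub>v y = (A * B) *\<^sub>v x" using A B by simp
    moreover have "0\<^sub>m n n *\<^sub>v x = 0\<^sub>v n" using x by (intro eq_vecI) auto
    ultimately have "A *\<^sub>v y = 0\<^sub>v n" using assms(3) by simp
    then show "y \<in> mat_kernel A" using x A B by (intro mat_kernelI[OF A]) auto
  qed
  from dim_subspace_mono[OF col_space_subspace(1)[OF B] rank_kernel(2)[OF A] this col_space_subspace(2)[OF B] rank_kernel(3)[OF A]]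
  have "rank B \<le> vectorspace.dim class_ring (vs (mat_kernel A))" by (simp add: rank_def col_space_def)
  then show ?thesis using rank_kernel(1)[OF A] by simp
qed

text \<open>Subadditivity of the rank. The condition is a nonvanishing determinant and therefore
  open in \<open>A\<close> and \<open>B\<close>, which makes it suitable for limits.\<close>

lemma rank_add_ge_if_det_nonzero:
  assumes A: "A \<in> carrier_mat n n" and B: "B \<in> carrier_mat n n"
    and U: "U \<in> carrier_mat n n" and W: "W \<in> carrier_mat n n"
    and "det (A * U + W * B) \<noteq> 0"
  shows "n \<le> rank A + rank B"
proof -
  have M: "A * U + W * B \<in> carrier_mat n n" using A B U W by auto
  have "n = rank (A * U + W * B)" using det_rank_iff[OF M] assms(5) by simp
  also have "\<dots> \<le> rank (A * U) + rank (W * B)" using A B U W by (intro rank_subadditive) auto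
  also have "\<dots> \<le> rank A + rank B"
    using rank_mult_le_left[OF A U] rank_mult_le_right[OF W B] by simp
  finally show ?thesis .
qed

text \<open>The matrix factors as \<open>?L * A * ?R\<close>, where \<open>?L\<close> has at most
  one nonzero entry in each row and \<open>?R\<close> at most one in each column.\<close>

lemma rank_reindex_le:
  assumes A: "A \<in> carrier_mat n n" and f: "\<And>x. x < n \<Longrightarrow> f x < n" and g: "\<And>x. x < n \<Longrightarrow> g x < n"
  shows "rank (mat n n (\<lambda>(x, y). u x * A $$ (f x, g y) * v y)) \<le> rank A"
proof -
  let ?L = "mat n n (\<lambda>(x, p). if p = f x then u x else 0)"
  let ?R = "mat n n (\<lambda>(p, y). if p = g y then v y else 0)"
  have AR: "A * ?R = mat n n (\<lambda>(p, y). A $$ (p, g y) * v y)"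
  proof (rule eq_matI)
    fix p y assume "p < dim_row (mat n n (\<lambda>(p, y). A $$ (p, g y) * v y))" "y < dim_col (mat n n (\<lambda>(p, y). A $$ (p, g y) * v y))"
    then have py: "p < n" "y < n" by auto
    have "(A * ?R) $$ (p, y) = (\<Sum>q\<in>{0..<n}. A $$ (p, q) * (if q = g y then v y else 0))"
      using py A by (simp add: scalar_prod_def)
    also have "\<dots> = (\<Sum>q\<in>{0..<n}. if q = g y then A $$ (p, g y) * v y else 0)"
      by (intro sum.cong) auto
    finally show "(A * ?R) $$ (p, y) = mat n n (\<lambda>(p, y). A $$ (p, g y) * v y) $$ (p, y)"
      using py g by simp
  qed (use A in auto)
  have "mat n n (\<lambda>(x, y). u x * A $$ (f x, g y) * v y) = ?L * (A * ?R)"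
  proof (rule eq_matI)
    fix x y assume "x < dim_row (?L * (A * ?R))" "y < dim_col (?L * (A * ?R))"
    then have xy: "x < n" "y < n" by auto
    have "(?L * (A * ?R)) $$ (x, y) = (\<Sum>q\<in>{0..<n}. (if q = f x then u x else 0) * (A $$ (q, g y) * v y))"
      unfolding AR using xy by (simp add: scalar_prod_def)
    also have "\<dots> = (\<Sum>q\<in>{0..<n}. if q = f x then u x * (A $$ (f x, g y) * v y) else 0)"
      by (intro sum.cong) auto
    finally show "mat n n (\<lambda>(x, y). u x * A $$ (f x, g y) * v y) $$ (x, y) = (?L * (A * ?R)) $$ (x, y)"
      using xy f by (simp add: mult.assoc)
  qed (use A in auto)
  then show ?thesis
    using rank_mult_le_right[of ?L "A * ?R"] rank_mult_le_left[OF A, of ?R] A by simp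
qed

end

lemma tendsto_det:
  fixes M :: "'b \<Rightarrow> complex mat"
  assumes "\<And>x. M x \<in> carrier_mat m m" "M0 \<in> carrier_mat m m"
    and "\<And>i j. i < m \<Longrightarrow> j < m \<Longrightarrow> ((\<lambda>x. M x $$ (i, j)) \<longlongrightarrow> M0 $$ (i, j)) F"
  shows "((\<lambda>x. det (M x)) \<longlongrightarrow> det M0) F"
  unfolding det_def'[OF assms(1)] det_def'[OF assms(2)]
  by (intro tendsto_sum tendsto_mult tendsto_const tendsto_prod assms(3)) (auto simp: permutes_in_image)

section \<open>The flip of two tensor factors\<close>

definition swap_index :: "nat \<Rightarrow> nat \<Rightarrow> nat" where
  "swap_index s q = (q mod s) * s + q div s"

text \<open>With P the flip this is 1 + c P; for \<open>c = - 1\<close> and \<open>c = 1\<close> its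
  image consists of the antisymmetric and the symmetric tensors.\<close>

definition flip_mat :: "nat \<Rightarrow> complex \<Rightarrow> complex mat" where
  "flip_mat s c = mat (s * s) (s * s) (\<lambda>(p, q). of_bool (p = q) + c * of_bool (p = swap_index s q))"

lemma flip_mat_carrier [simp]: "flip_mat s c \<in> carrier_mat (s * s) (s * s)"
  by (simp add: flip_mat_def)

lemma pair_index_less: "i < s \<Longrightarrow> j < s \<Longrightarrow> i * s + j < s * (s :: nat)"
proof -
  assume "i < s" "j < s"
  then have "Suc i * s \<le> s * s" by (intro mult_le_mono1) auto
  then show ?thesis using \<open>j < s\<close> by simp
qed

lemma swap_index_pair: "i < s \<Longrightarrow> j < s \<Longrightarrow> swap_index s (i * s + j) = j * s + i"
  by (simp add: swap_index_def)

lemma pair_index_eq_iff: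
  "i < s \<Longrightarrow> j < s \<Longrightarrow> i' < s \<Longrightarrow> j' < s \<Longrightarrow> i * s + j = i' * s + j' \<longleftrightarrow> i = i' \<and> j = (j' :: nat)"
proof
  assume a: "i < s" "j < s" "i' < s" "j' < s" "i * s + j = i' * s + j'"
  then have "(i * s + j) div s = (i' * s + j') div s" "(i * s + j) mod s = (i' * s + j') mod s" by simp_all
  then show "i = i' \<and> j = j'" using a(1-4) by simp
qed simp

lemma pair_index_cases:
  assumes "q < s * (s :: nat)"
  obtains i j where "i < s" "j < s" "q = i * s + j"
proof -
  have "s > 0" using assms by (cases s) auto
  then show ?thesis
    using that[of "q div s" "q mod s"] assms by (simp add: less_mult_imp_div_less)
qed

text \<open>Since P and \<open>c\<close> both square to 1, (1 + c P) P = c (1 + c P).\<close>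

lemma col_flip_mat_swap:
  assumes "i < s" "j < s" "c * c = 1"
  shows "col (flip_mat s c) (j * s + i) = c \<cdot>\<^sub>v col (flip_mat s c) (i * s + j)"
proof (rule eq_vecI)
  fix p assume "p < dim_vec (c \<cdot>\<^sub>v col (flip_mat s c) (i * s + j))"
  then have p: "p < s * s" by (simp add: flip_mat_def)
  have e: "flip_mat s c $$ (p, i * s + j) = of_bool (p = i * s + j) + c * of_bool (p = j * s + i)"
    if "i < s" "j < s" for i j
    using p pair_index_less[OF that] by (simp add: flip_mat_def swap_index_pair[OF that])
  have d: "dim_row (flip_mat s c) = s * s" "dim_col (flip_mat s c) = s * s" by (simp_all add: flip_mat_def)
  have l: "vec_index (col (flip_mat s c) q) p = flip_mat s c $$ (p, q)" if "q < s * s" for q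
    by (rule index_col) (use p that d in auto)
  have "vec_index (c \<cdot>\<^sub>v col (flip_mat s c) (i * s + j)) p = c * flip_mat s c $$ (p, i * s + j)"
    using p d by (subst index_smult_vec(1)) (simp_all only: dim_col l[OF pair_index_less[OF assms(1,2)]])
  also have "\<dots> = c * of_bool (p = i * s + j) + (c * c) * of_bool (p = j * s + i)"
    by (simp only: e[OF assms(1,2)] distrib_left mult.assoc)
  also have "\<dots> = flip_mat s c $$ (p, j * s + i)"
    unfolding e[OF assms(2,1)] assms(3) by (simp only: mult_1 add.commute[of "c * _"])
  finally show "vec_index (col (flip_mat s c) (j * s + i)) p = vec_index (c \<cdot>\<^sub>v col (flip_mat s c) (i * s + j)) p"
    by (simp only: l[OF pair_index_less[OF assms(2,1)]])
qed (simp add: flip_mat_def)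

lemma (in vec_space) smult_in_span_single:
  assumes "v \<in> S" "S \<subseteq> carrier_vec n"
  shows "c \<cdot>\<^sub>v v \<in> span S"
  using assms smult_in_span[of S v c] in_own_span[of S] by auto

text \<open>One column from each pair (i, j), (j, i) spans the other one, and for
  \<open>c = - 1\<close> the diagonal columns vanish.\<close>

lemma rank_flip_mat_le:
  assumes c: "c * c = 1" and I: "finite I" "I \<subseteq> {..<s} \<times> {..<s}"
    and cover: "\<And>i j. i < s \<Longrightarrow> j < s \<Longrightarrow> (i, j) \<in> I \<or> (j, i) \<in> I \<or> (i = j \<and> c = - 1)"
  shows "vec_space.rank (s * s) (flip_mat s c) \<le> card I"
proof -
  interpret vec_space "TYPE(complex)" "s * s" .
  let ?S = "(\<lambda>(i, j). col (flip_mat s c) (i * s + j)) ` I"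
  have S: "?S \<subseteq> carrier_vec (s * s)" by (auto intro!: carrier_vecI simp: flip_mat_def)
  have "set (cols (flip_mat s c)) \<subseteq> span ?S"
  proof
    fix v assume "v \<in> set (cols (flip_mat s c))"
    then obtain q where q: "q < s * s" "v = col (flip_mat s c) q"
      by (auto simp: cols_def flip_mat_def)
    obtain i j where ij: "i < s" "j < s" "q = i * s + j" using q(1) by (rule pair_index_cases)
    from cover[OF ij(1,2)] consider "(i, j) \<in> I" | "(j, i) \<in> I" | "i = j" "c = - 1" by blast
    then show "v \<in> span ?S"
    proof cases
      case 1
      then have "v \<in> ?S" using q(2) ij(3) by force
      then show ?thesis using in_own_span[OF S[folded module_vec_simps(3)]] S in_own_span[of ?S] by auto
    next
      case 2
      then have "col (flip_mat s c) (j * s + i) \<in> ?S" by force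
      moreover have "v = c \<cdot>\<^sub>v col (flip_mat s c) (j * s + i)"
        using col_flip_mat_swap[OF ij(2,1) c] q(2) ij(3) by simp
      ultimately show ?thesis using smult_in_span_single[OF _ S] by metis
    next
      case 3
      have "v = 0\<^sub>v (s * s)"
        unfolding q(2) ij(3) using ij(1,2) 3 pair_index_less[of i s i]
        by (intro eq_vecI) (auto simp: flip_mat_def swap_index_pair)
      moreover have "0\<^sub>v (s * s) \<in> span ?S" using in_spanI[of "0\<^sub>v (s * s)" "\<lambda>_. 0" "{}" ?S] by (simp add: lincomb_def)
      ultimately show ?thesis by simp
    qed
  qed
  then have "rank (flip_mat s c) \<le> card ?S"
    using I(1) S by (intro rank_le_card_span[OF flip_mat_carrier]) auto
  also have "\<dots> \<le> card I" using I(1) by (rule card_image_le)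
  finally show ?thesis .
qed

lemma choose_two_sum: "(s choose 2) + (Suc s choose 2) = s * s"
  by (induction s) (auto simp: numeral_2_eq_2)

lemma rank_flip_mat_minus: "vec_space.rank (s * s) (flip_mat s (- 1)) \<le> s choose 2"
proof -
  let ?I = "(\<lambda>(j, i). (i, j)) ` (SIGMA j:{..<s}. {..<j})"
  have "(\<Sum>j<s. j) = s choose 2" by (induction s) (auto simp: numeral_2_eq_2)
  then have "card ?I = s choose 2" by (subst card_image) (auto simp: inj_on_def)
  moreover have "vec_space.rank (s * s) (flip_mat s (- 1)) \<le> card ?I"
  proof (rule rank_flip_mat_le)
    fix i j assume "i < s" "j < s"
    then show "(i, j) \<in> ?I \<or> (j, i) \<in> ?I \<or> (i = j \<and> - 1 = (- 1 :: complex))"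
      by (cases i j rule: linorder_cases) force+
  qed auto
  ultimately show ?thesis by simp
qed

lemma rank_flip_mat_plus: "vec_space.rank (s * s) (flip_mat s 1) \<le> Suc s choose 2"
proof -
  let ?I = "(\<lambda>(j, i). (i, j)) ` (SIGMA j:{..<s}. {..j})"
  have "(\<Sum>j<s. Suc j) = Suc s choose 2" by (induction s) (auto simp: numeral_2_eq_2)
  then have "card ?I = Suc s choose 2" by (subst card_image) (auto simp: inj_on_def)
  moreover have "vec_space.rank (s * s) (flip_mat s 1) \<le> card ?I"
  proof (rule rank_flip_mat_le)
    fix i j assume "i < s" "j < s"
    then show "(i, j) \<in> ?I \<or> (j, i) \<in> ?I \<or> (i = j \<and> 1 = (- 1 :: complex))"
      by (cases i j rule: linorder_cases) force+
  qed auto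
  ultimately show ?thesis by simp
qed

lemma flip_mat_add: "flip_mat s (- 1) + flip_mat s 1 = 2 \<cdot>\<^sub>m 1\<^sub>m (s * s)"
  by (rule eq_matI) (auto simp: flip_mat_def)

lemma (in vec_space) rank_reindex_eq:
  assumes A: "A \<in> carrier_mat n n" and f: "\<And>x. x < n \<Longrightarrow> f x < n" and g: "\<And>x. x < n \<Longrightarrow> g x < n"
    and f': "\<And>x. x < n \<Longrightarrow> f' x < n" "\<And>x. x < n \<Longrightarrow> f (f' x) = x"
    and g': "\<And>x. x < n \<Longrightarrow> g' x < n" "\<And>x. x < n \<Longrightarrow> g (g' x) = x"
    and u: "\<And>x. u x \<noteq> 0" and v: "\<And>x. v x \<noteq> 0"
  shows "rank (mat n n (\<lambda>(x, y). u x * A $$ (f x, g y) * v y)) = rank A"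
proof (rule antisym)
  let ?M = "mat n n (\<lambda>(x, y). u x * A $$ (f x, g y) * v y)"
  show "rank ?M \<le> rank A" by (rule rank_reindex_le[OF A f g])
  have "A = mat n n (\<lambda>(x, y). (1 / u (f' x)) * ?M $$ (f' x, g' y) * (1 / v (g' y)))"
    by (rule eq_matI) (use A f' g' u v in auto)
  moreover have "rank (mat n n (\<lambda>(x, y). (1 / u (f' x)) * ?M $$ (f' x, g' y) * (1 / v (g' y)))) \<le> rank ?M"
    by (rule rank_reindex_le) (use f' g' in auto)
  ultimately show "rank A \<le> rank ?M" by simp
qed

text \<open>Lower semicontinuity of both ranks, with a constant sum, makes them locally constant.\<close>

lemma eventually_rank_eq:
  fixes A B :: "'b \<Rightarrow> complex mat"
  assumes carr: "\<And>x. A x \<in> carrier_mat m m" "\<And>x. B x \<in> carrier_mat m m" "A0 \<in> carrier_mat m m" "B0 \<in> carrier_mat m m"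
      "U \<in> carrier_mat m m" "W \<in> carrier_mat m m"
    and le: "vec_space.rank m A0 + vec_space.rank m B0 \<le> m"
    and det0: "det (A0 * U + W * B0) \<noteq> 0"
    and A: "\<And>i j. i < m \<Longrightarrow> j < m \<Longrightarrow> ((\<lambda>x. A x $$ (i, j)) \<longlongrightarrow> A0 $$ (i, j)) F"
    and B: "\<And>i j. i < m \<Longrightarrow> j < m \<Longrightarrow> ((\<lambda>x. B x $$ (i, j)) \<longlongrightarrow> B0 $$ (i, j)) F"
    and ev: "eventually (\<lambda>x. vec_space.rank m (A x) + vec_space.rank m (B x) \<le> m) F"
  shows "eventually (\<lambda>x. vec_space.rank m (A x) = vec_space.rank m A0) F"
proof -
  interpret vec_space "TYPE(complex)" m .
  have m0: "m \<le> rank A0 + rank B0"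
    by (rule rank_add_ge_if_det_nonzero[OF carr(3,4,5,6) det0])
  \<comment> \<open>Only one of the two matrices varies at a time, with \<open>U\<close> and
    \<open>W\<close> kept from the limit. Near the limit neither rank can then fall below its
    limiting value, and the bound \<open>ev\<close> on the sum prevents either from rising.\<close>
  have "((\<lambda>x. det (A x * U + W * B0)) \<longlongrightarrow> det (A0 * U + W * B0)) F"
  proof (rule tendsto_det)
    fix i j assume ij: "i < m" "j < m"
    have "((\<lambda>x. (\<Sum>k\<in>{0..<m}. A x $$ (i, k) * U $$ (k, j)) + (W * B0) $$ (i, j)) \<longlongrightarrow>
      (\<Sum>k\<in>{0..<m}. A0 $$ (i, k) * U $$ (k, j)) + (W * B0) $$ (i, j)) F"
      using ij by (intro tendsto_intros A) auto
    moreover have "(C * U + W * B0) $$ (i, j) = (\<Sum>k\<in>{0..<m}. C $$ (i, k) * U $$ (k, j)) + (W * B0) $$ (i, j)"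
      if "C \<in> carrier_mat m m" for C
      using that carr ij by (simp add: scalar_prod_def)
    ultimately show "((\<lambda>x. (A x * U + W * B0) $$ (i, j)) \<longlongrightarrow> (A0 * U + W * B0) $$ (i, j)) F"
      using carr by simp
  qed (use carr in auto)
  from tendsto_imp_eventually_ne[OF this det0]
  have e1: "eventually (\<lambda>x. m \<le> rank (A x) + rank B0) F"
    by eventually_elim (rule rank_add_ge_if_det_nonzero[OF carr(1,4,5,6)])
  have "((\<lambda>x. det (A0 * U + W * B x)) \<longlongrightarrow> det (A0 * U + W * B0)) F"
  proof (rule tendsto_det)
    fix i j assume ij: "i < m" "j < m"
    have "((\<lambda>x. (A0 * U) $$ (i, j) + (\<Sum>k\<in>{0..<m}. W $$ (i, k) * B x $$ (k, j))) \<longlongrightarrow>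
      (A0 * U) $$ (i, j) + (\<Sum>k\<in>{0..<m}. W $$ (i, k) * B0 $$ (k, j))) F"
      using ij by (intro tendsto_intros B) auto
    moreover have "(A0 * U + W * C) $$ (i, j) = (A0 * U) $$ (i, j) + (\<Sum>k\<in>{0..<m}. W $$ (i, k) * C $$ (k, j))"
      if "C \<in> carrier_mat m m" for C
      using that carr ij by (simp add: scalar_prod_def)
    ultimately show "((\<lambda>x. (A0 * U + W * B x) $$ (i, j)) \<longlongrightarrow> (A0 * U + W * B0) $$ (i, j)) F"
      using carr by simp
  qed (use carr in auto)
  from tendsto_imp_eventually_ne[OF this det0]
  have e2: "eventually (\<lambda>x. m \<le> rank A0 + rank (B x)) F"
    by eventually_elim (rule rank_add_ge_if_det_nonzero[OF carr(3,2,5,6)])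
  from e1 e2 ev show ?thesis
    by eventually_elim (use le m0 in linarith)
qed

text \<open>The two upper bounds add up to s^2, and (1 - P) + (1 + P) = 2 is invertible, so both are
  attained. The last two claims are the hypotheses of \<open>eventually_rank_eq\<close>.\<close>

lemma rank_flip_mats:
  "vec_space.rank (s * s) (flip_mat s (- 1)) = s choose 2"
  "vec_space.rank (s * s) (flip_mat s (- 1)) + vec_space.rank (s * s) (flip_mat s 1) \<le> s * s"
  "det (flip_mat s (- 1) * 1\<^sub>m (s * s) + 1\<^sub>m (s * s) * flip_mat s 1) \<noteq> 0"
proof -
  interpret vec_space "TYPE(complex)" "s * s" .
  have e: "flip_mat s (- 1) * 1\<^sub>m (s * s) + 1\<^sub>m (s * s) * flip_mat s 1 = 2 \<cdot>\<^sub>m 1\<^sub>m (s * s)"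
    by (simp only: right_mult_one_mat[OF flip_mat_carrier] left_mult_one_mat[OF flip_mat_carrier] flip_mat_add)
  show d: "det (flip_mat s (- 1) * 1\<^sub>m (s * s) + 1\<^sub>m (s * s) * flip_mat s 1) \<noteq> 0"
    unfolding e by (simp add: det_smult)
  have "s * s \<le> rank (flip_mat s (- 1)) + rank (flip_mat s 1)"
    by (rule rank_add_ge_if_det_nonzero[OF _ _ _ _ d]) auto
  then show "rank (flip_mat s (- 1)) = s choose 2" "rank (flip_mat s (- 1)) + rank (flip_mat s 1) \<le> s * s"
    using rank_flip_mat_minus[of s] rank_flip_mat_plus[of s] choose_two_sum[of s] by linarith+
qed

section \<open>The rank of the R-matrix\<close>

context theta_level
begin

lemma R_mat_entry:
  assumes "p < n * n" "q < n * n"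
  shows "R_mat n k \<eta> \<tau> z $$ (p, q) = R_entry k \<tau> z (int (p div n)) (int (p mod n)) (int (q div n)) (int (q mod n))"
  using assms n_pos by (simp add: R_mat_def R_coeff_eq less_mult_imp_div_less)

lemma R_mat_carrier [simp]: "R_mat n k \<eta> \<tau> z \<in> carrier_mat (n * n) (n * n)"
  by (simp add: R_mat_def)

lemma t_isCont: "isCont f z \<Longrightarrow> isCont (\<lambda>z. t a (f z)) z"
  using isCont_o2[OF _ entire_isCont[OF t_holo]] .

lemma vth_isCont: "isCont f z \<Longrightarrow> isCont (\<lambda>z. vth (f z)) z"
  using isCont_o2[OF _ entire_isCont[OF vth_holo]] .

lemma vth_cof_isCont: "isCont f z \<Longrightarrow> isCont (\<lambda>z. vth_cof x (f z)) z"
  using isCont_o2[OF _ entire_isCont[OF vth_cof_holo]] .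

lemma t_notin_L: "z \<notin> L \<Longrightarrow> t a z \<noteq> 0"
  using t_zero_L by blast

lemma R_entry_isCont:
  assumes "\<tau> \<notin> L"
  shows "isCont (\<lambda>\<tau>. R_entry k \<tau> \<tau> a b i j) \<tau>" "isCont (\<lambda>\<tau>. R_entry k \<tau> (- \<tau>) a b i j) \<tau>"
proof -
  have nz: "t x \<tau> \<noteq> 0" "t x (- \<tau>) \<noteq> 0" for x
    using assms t_notin_L[of \<tau>] t_notin_L[of "- \<tau>"] by auto
  show "isCont (\<lambda>\<tau>. R_entry k \<tau> \<tau> a b i j) \<tau>"
  proof (cases "(a + b) mod int n = (i + j) mod int n")
    case True
    show ?thesis unfolding R_entry_def if_P[OF True]
      by (intro continuous_intros t_isCont vth_isCont) (use nz c0_nz in auto)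
  qed (simp add: R_entry_def)
  show "isCont (\<lambda>\<tau>. R_entry k \<tau> (- \<tau>) a b i j) \<tau>"
  proof (cases "(a + b) mod int n = (i + j) mod int n")
    case True
    show ?thesis unfolding R_entry_def if_P[OF True]
      by (intro continuous_intros t_isCont vth_isCont) (use nz c0_nz in auto)
  qed (simp add: R_entry_def)
qed

lemma R_entry_field_differentiable:
  assumes "z \<notin> L" "\<tau> \<notin> L"
  shows "(\<lambda>z. R_entry k \<tau> z a b i j) field_differentiable (at z)"
proof -
  have h: "(\<lambda>z. vth (- z)) field_differentiable (at z)" "(\<lambda>z. t x (- z + \<tau>)) field_differentiable (at z)"
     "(\<lambda>z. t x (- z)) field_differentiable (at z)" for x
    using entire_compose[OF vth_holo entire_affine(4)] entire_compose[OF t_holo entire_affine(5)]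
      entire_compose[OF t_holo entire_affine(4)]
    by (auto simp: holomorphic_on_def)
  have nz: "t x \<tau> \<noteq> 0" "t x (- z) \<noteq> 0" for x
    using assms t_notin_L[of \<tau>] t_notin_L[of "- z"] by auto
  show ?thesis
  proof (cases "(a + b) mod int n = (i + j) mod int n")
    case True
    show ?thesis unfolding R_entry_def if_P[OF True]
      by (intro field_differentiable_divide field_differentiable_mult field_differentiable_const h)
         (use nz c0_nz in auto)
  qed (simp add: R_entry_def)
qed

end

context theta_tau
begin

text \<open>Differentiating \<open>R(z) R(-z) = \<Lambda>(z)\<close> at the simple zero \<open>z = \<tau>\<close> of \<open>\<Lambda>\<close>.\<close>

lemma R_mat_rank_sum:
  assumes "\<tau> + \<tau> \<notin> L"
  shows "vec_space.rank (n * n) (R_mat n k \<eta> \<tau> \<tau>) + vec_space.rank (n * n) (R_mat n k \<eta> \<tau> (- \<tau>)) \<le> n * n"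
    and "\<exists>U\<in>carrier_mat (n * n) (n * n). \<exists>W\<in>carrier_mat (n * n) (n * n).
      det (R_mat n k \<eta> \<tau> \<tau> * U + W * R_mat n k \<eta> \<tau> (- \<tau>)) \<noteq> 0"
proof -
  interpret vec_space "TYPE(complex)" "n * n" .
  let ?R = "R_mat n k \<eta> \<tau>"
  have "?R \<tau> * ?R (- \<tau>) = 0\<^sub>m (n * n) (n * n)"
    unfolding R_mat_unitarity[OF tau] Lam_tau by (rule eq_matI) auto
  then show "rank (?R \<tau>) + rank (?R (- \<tau>)) \<le> n * n"
    by (rule rank_add_le_if_mult_eq_0[OF R_mat_carrier R_mat_carrier])
  define D where "D p q z = deriv (\<lambda>z. ?R z $$ (p, q)) z" for p q z
  have D: "((\<lambda>z. ?R z $$ (p, q)) has_field_derivative D p q z) (at z)" if "p < n * n" "q < n * n" "z \<notin> L" for p q z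
    unfolding D_def R_mat_entry[OF that(1,2)]
    using R_entry_field_differentiable[OF that(3) tau] by (simp add: DERIV_deriv_iff_field_differentiable)
  \<comment> \<open>The coefficients in the product rule: \<open>W\<close> is the derivative of R at
    \<tau>, and \<open>U\<close> is that of R(-z) at z = \<tau>, whence the sign.\<close>
  define W where "W = mat (n * n) (n * n) (\<lambda>(p, q). D p q \<tau>)"
  define U where "U = mat (n * n) (n * n) (\<lambda>(p, q). - D p q (- \<tau>))"
  let ?l = "deriv Lam \<tau> / c0 ^ 2"
  have "?R \<tau> * U + W * ?R (- \<tau>) = ?l \<cdot>\<^sub>m 1\<^sub>m (n * n)"
  proof (rule eq_matI)
    fix p q assume "p < dim_row (?l \<cdot>\<^sub>m 1\<^sub>m (n * n))" "q < dim_col (?l \<cdot>\<^sub>m 1\<^sub>m (n * n))"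
    then have pq: "p < n * n" "q < n * n" by auto
    let ?H = "\<lambda>z. \<Sum>r\<in>{0..<n * n}. ?R z $$ (p, r) * ?R (- z) $$ (r, q)"
    have H1: "(?H has_field_derivative (\<Sum>r\<in>{0..<n * n}. D p r \<tau> * ?R (- \<tau>) $$ (r, q) + - D r q (- \<tau>) * ?R \<tau> $$ (p, r))) (at \<tau>)"
    proof (intro DERIV_sum DERIV_mult)
      fix r assume r: "r \<in> {0..<n * n}"
      then show "((\<lambda>z. ?R z $$ (p, r)) has_field_derivative D p r \<tau>) (at \<tau>)"
        using pq tau by (intro D) auto
      have "((\<lambda>z. ?R z $$ (r, q)) has_field_derivative D r q (- \<tau>)) (at (- \<tau>))"
        using r pq tau by (intro D) auto
      from DERIV_chain2[OF this DERIV_minus[OF DERIV_ident]]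
      show "((\<lambda>z. ?R (- z) $$ (r, q)) has_field_derivative - D r q (- \<tau>)) (at \<tau>)" by simp
    qed
    have H2: "eventually (\<lambda>z. ?H z = Lam z / c0 ^ 2 * of_bool (p = q)) (nhds \<tau>)"
    proof -
      have "eventually (\<lambda>z. z \<notin> L) (nhds \<tau>)"
        using eventually_notin_L[of \<tau>] tau by (simp add: eventually_nhds_conv_at)
      then show ?thesis
      proof eventually_elim
        case (elim z)
        have "(?R z * ?R (- z)) $$ (p, q) = ?H z"
          using pq by (subst index_mult_mat(1)) (auto simp: scalar_prod_def R_mat_def)
        then have "?H z = ((Lam z / c0 ^ 2) \<cdot>\<^sub>m 1\<^sub>m (n * n)) $$ (p, q)"
          by (simp only: R_mat_unitarity[OF elim])
        then show ?case using pq by (cases "p = q") simp_all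
      qed
    qed
    have H3: "((\<lambda>z. Lam z / c0 ^ 2 * of_bool (p = q)) has_field_derivative ?l * of_bool (p = q)) (at \<tau>)"
      using holomorphic_derivI[OF Lam_holo, of \<tau> UNIV] by (intro DERIV_cmult_right DERIV_cdivide) auto
    have "(\<Sum>r\<in>{0..<n * n}. D p r \<tau> * ?R (- \<tau>) $$ (r, q) + - D r q (- \<tau>) * ?R \<tau> $$ (p, r)) = ?l * of_bool (p = q)"
      by (rule DERIV_unique[OF iffD1[OF DERIV_cong_ev[OF refl H2 refl] H1] H3])
    moreover have "(?R \<tau> * U + W * ?R (- \<tau>)) $$ (p, q)
       = (\<Sum>r\<in>{0..<n * n}. ?R \<tau> $$ (p, r) * U $$ (r, q)) + (\<Sum>r\<in>{0..<n * n}. W $$ (p, r) * ?R (- \<tau>) $$ (r, q))"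
      using pq by (simp add: scalar_prod_def U_def W_def R_mat_def)
    moreover have "\<dots> = (\<Sum>r\<in>{0..<n * n}. D p r \<tau> * ?R (- \<tau>) $$ (r, q) + - D r q (- \<tau>) * ?R \<tau> $$ (p, r))"
      unfolding sum.distrib[symmetric]
      by (rule sum.cong) (use pq in \<open>auto simp: U_def W_def\<close>)
    ultimately show "(?R \<tau> * U + W * ?R (- \<tau>)) $$ (p, q) = (?l \<cdot>\<^sub>m 1\<^sub>m (n * n)) $$ (p, q)"
      using pq by simp
  qed (simp_all add: U_def W_def R_mat_def)
  then have "det (?R \<tau> * U + W * ?R (- \<tau>)) \<noteq> 0"
    using deriv_Lam_tau[OF assms] c0_nz by (simp add: det_smult)
  moreover have "U \<in> carrier_mat (n * n) (n * n)" "W \<in> carrier_mat (n * n) (n * n)"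
    by (simp_all add: U_def W_def)
  ultimately show "\<exists>U\<in>carrier_mat (n * n) (n * n). \<exists>W\<in>carrier_mat (n * n) (n * n).
      det (?R \<tau> * U + W * ?R (- \<tau>)) \<noteq> 0" by blast
qed

end

section \<open>The limits at the origin\<close>

context theta_coprime
begin

lemma nat_diff_mod_0_iff: "a < n \<Longrightarrow> i < n \<Longrightarrow> (int a - int i) mod int n = 0 \<longleftrightarrow> a = i"
proof -
  assume ai: "a < n" "i < n"
  have "(int a - int i) mod int n = 0 \<longleftrightarrow> int a mod int n = int i mod int n" by (metis mod_eq_dvd_iff dvd_eq_mod_eq_0)
  then show ?thesis using ai by simp
qed

lemma t_0_nz: "x mod int n \<noteq> 0 \<Longrightarrow> t x 0 \<noteq> 0"
  using t_0_zero[of x] by auto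

lemma t_k_diff_0_nz: "a < n \<Longrightarrow> j < n \<Longrightarrow> a \<noteq> j \<Longrightarrow> t (int k * (int j - int a)) 0 \<noteq> 0"
proof (rule t_0_nz)
  assume aj: "a < n" "j < n" "a \<noteq> j"
  show "(int k * (int j - int a)) mod int n \<noteq> 0"
    using mod_cancel_k[of "int j - int a" 0] nat_diff_mod_0_iff[OF aj(2,1)] aj(3) by auto
qed

lemma swap_cond_iff:
  assumes "a < n" "b < n" "i < n" "j < n" "(int a + int b) mod int n = (int i + int j) mod int n"
  shows "a = i \<longleftrightarrow> b = j" "a = j \<longleftrightarrow> b = i"
proof -
  have c: "int n dvd int a + int b - (int i + int j)" using assms(5) by (simp add: mod_eq_dvd_iff)
  have eq: "int n dvd int x - int y \<longleftrightarrow> x = y" if "x < n" "y < n" for x y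
    using nat_diff_mod_0_iff[OF that] by (simp add: dvd_eq_mod_eq_0)
  show "a = i \<longleftrightarrow> b = j"
  proof
    assume "a = i" then show "b = j" using c eq[OF assms(2,4)] by simp
  next
    assume "b = j" then show "a = i" using c eq[OF assms(1,3)] by simp
  qed
  show "a = j \<longleftrightarrow> b = i"
  proof
    assume "a = j" then show "b = i" using c eq[OF assms(2,3)] by simp
  next
    assume "b = i" then show "a = j" using c eq[OF assms(1,4)] by (simp add: add.commute)
  qed
qed

text \<open>Cancels the denominator that can vanish as z tends to 0. What remains is
  \<open>t (int k * (j - a)) \<tau>\<close>, which tends to 0 only for \<open>a = j\<close> in
  Z_n.\<close>

lemma R_entry_vth_cof:
  assumes "z \<notin> L"
  shows "R_entry k \<tau> z a b i j = (if (a + b) mod int n = (i + j) mod int n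
     then vth_cof (a - i) (- z) / c0 * (t (a - i + int k * (j - a)) (- z + \<tau>) / t (int k * (j - a)) \<tau>) else 0)"
  using t_notin_L[of "- z" "a - i"] assms vth_split[of "- z" "a - i"] by (simp add: R_entry_def)

text \<open>For \<open>a\<close> different from \<open>j\<close> the entry extends continuously. For
  \<open>a = j\<close> the denominator \<open>t 0 \<tau>\<close> tends to 0: if \<open>i = j\<close>
  too, the numerator \<open>t 0 0\<close> is 0 throughout; otherwise the cofactor contains
  \<open>t 0 (- \<tau>)\<close>, and its ratio to \<open>t 0 \<tau>\<close> tends to -1. This is the
  sign in front of the flip.\<close>

lemma R_entry_limit_minus:
  assumes "a < n" "b < n" "i < n" "j < n"
  shows "((\<lambda>\<tau>. R_entry k \<tau> \<tau> (int a) (int b) (int i) (int j)) \<longlongrightarrow>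
    of_bool (a = i \<and> b = j) + (- 1) * of_bool (a = j \<and> b = i)) (at 0)"
proof -
  let ?C = "(int a + int b) mod int n = (int i + int j) mod int n"
  let ?x = "int a - int i" and ?y = "int k * (int j - int a)"
  show ?thesis
  proof (cases ?C)
    case False
    then have nb: "(a = i \<and> b = j) = False" "(a = j \<and> b = i) = False" by (auto simp: add.commute)
    have "R_entry k \<tau> \<tau> (int a) (int b) (int i) (int j) = 0" for \<tau>
      by (simp only: R_entry_def False if_False)
    then show ?thesis unfolding nb by simp
  next
    case True
    note sw = swap_cond_iff[OF assms True]
    define h where "h \<tau> = vth_cof ?x (- \<tau>) / c0 * (t (?x + ?y) 0 / t ?y \<tau>)" for \<tau>
    have "eventually (\<lambda>\<tau>. h \<tau> = R_entry k \<tau> \<tau> (int a) (int b) (int i) (int j)) (at 0)"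
      using eventually_notin_L[of 0]
      by eventually_elim (simp add: R_entry_vth_cof True h_def)
    moreover have "(h \<longlongrightarrow> of_bool (a = i \<and> b = j) + (- 1) * of_bool (a = j \<and> b = i)) (at 0)"
    proof (cases "a = j")
      case aj: False
      have nz: "t ?y 0 \<noteq> 0" using t_k_diff_0_nz[OF assms(1,4) aj] .
      have "isCont h 0" unfolding h_def[abs_def]
        by (intro continuous_intros t_isCont vth_cof_isCont) (use nz c0_nz in auto)
      moreover have "h 0 = of_bool (a = i \<and> b = j) + (- 1) * of_bool (a = j \<and> b = i)"
        using aj sw nz c0_nz nat_diff_mod_0_iff[OF assms(1,3)] by (auto simp: h_def vth_cof_0)
      ultimately show ?thesis by (simp add: isCont_def)
    next
      case aj: True
      show ?thesis
      proof (cases "a = i")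
        case ai: True
        then have "h = (\<lambda>_. 0)" using aj by (auto simp: h_def t_0_0)
        then show ?thesis using ai aj sw by simp
      next
        case ai: False
        have nz: "t ?x 0 \<noteq> 0" using t_0_nz nat_diff_mod_0_iff[OF assms(1,3)] ai by blast
        define g where "g \<tau> = - ee (- (N * \<tau>)) * (vth_cof 0 (- \<tau>) / t ?x (- \<tau>)) / c0 * t ?x 0" for \<tau>
        have "isCont g 0" unfolding g_def[abs_def] ee_def
          by (intro continuous_intros t_isCont vth_cof_isCont) (use nz c0_nz in auto)
        moreover have "g 0 = - 1" using nz c0_nz by (simp add: g_def c0_def[symmetric])
        ultimately have "(g \<longlongrightarrow> - 1) (at 0)" by (simp add: isCont_def)
        moreover have "eventually (\<lambda>\<tau>. g \<tau> = h \<tau>) (at 0)"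
          using eventually_notin_L[of 0]
        proof eventually_elim
          case (elim \<tau>)
          have nz2: "t ?x (- \<tau>) \<noteq> 0" "t 0 \<tau> \<noteq> 0" using elim t_notin_L[of "- \<tau>"] t_notin_L[of \<tau>] by auto
          have "vth_cof ?x (- \<tau>) * t ?x (- \<tau>) = - ee (- (N * \<tau>)) * t 0 \<tau> * vth_cof 0 (- \<tau>)"
            using vth_split[of "- \<tau>" ?x] vth_split[of "- \<tau>" 0] t_uminus[of 0 \<tau>] by (simp add: mult_ac)
          then have "vth_cof ?x (- \<tau>) = - ee (- (N * \<tau>)) * t 0 \<tau> * vth_cof 0 (- \<tau>) / t ?x (- \<tau>)"
            by (rule eq_divide_imp[OF nz2(1)])
          then show ?case using aj nz2 by (simp add: g_def h_def)
        qed
        ultimately have "(h \<longlongrightarrow> - 1) (at 0)" by (rule Lim_transform_eventually)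
        then show ?thesis using ai aj sw by simp
      qed
    qed
    ultimately show ?thesis by (rule Lim_transform_eventually[rotated])
  qed
qed

text \<open>At z = -\<tau> the numerator has the argument 2\<tau>. For \<open>a = i = j\<close> the
  ratio \<open>t 0 (\<tau> + \<tau>) / t 0 \<tau>\<close> tends to 2 = 1 + 1; for
  \<open>a = j\<close> different from \<open>i\<close> the factor \<open>t 0 \<tau>\<close> of the
  cofactor cancels without a sign.\<close>

lemma R_entry_limit_plus:
  assumes "a < n" "b < n" "i < n" "j < n"
  shows "((\<lambda>\<tau>. R_entry k \<tau> (- \<tau>) (int a) (int b) (int i) (int j)) \<longlongrightarrow>
    of_bool (a = i \<and> b = j) + 1 * of_bool (a = j \<and> b = i)) (at 0)"
proof -
  let ?C = "(int a + int b) mod int n = (int i + int j) mod int n"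
  let ?x = "int a - int i" and ?y = "int k * (int j - int a)"
  show ?thesis
  proof (cases ?C)
    case False
    then have nb: "(a = i \<and> b = j) = False" "(a = j \<and> b = i) = False" by (auto simp: add.commute)
    have "R_entry k \<tau> (- \<tau>) (int a) (int b) (int i) (int j) = 0" for \<tau>
      by (simp only: R_entry_def False if_False)
    then show ?thesis unfolding nb by simp
  next
    case True
    note sw = swap_cond_iff[OF assms True]
    define h where "h \<tau> = vth_cof ?x \<tau> / c0 * (t (?x + ?y) (\<tau> + \<tau>) / t ?y \<tau>)" for \<tau>
    have "eventually (\<lambda>\<tau>. h \<tau> = R_entry k \<tau> (- \<tau>) (int a) (int b) (int i) (int j)) (at 0)"
      using eventually_notin_L[of 0]
      by eventually_elim (simp add: R_entry_vth_cof True h_def)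
    moreover have "(h \<longlongrightarrow> of_bool (a = i \<and> b = j) + 1 * of_bool (a = j \<and> b = i)) (at 0)"
    proof (cases "a = j")
      case aj: False
      have nz: "t ?y 0 \<noteq> 0" using t_k_diff_0_nz[OF assms(1,4) aj] .
      have "isCont h 0" unfolding h_def[abs_def]
        by (intro continuous_intros t_isCont vth_cof_isCont) (use nz c0_nz in auto)
      moreover have "h 0 = of_bool (a = i \<and> b = j) + 1 * of_bool (a = j \<and> b = i)"
        using aj sw nz c0_nz nat_diff_mod_0_iff[OF assms(1,3)] by (auto simp: h_def vth_cof_0)
      ultimately show ?thesis by (simp add: isCont_def)
    next
      case aj: True
      show ?thesis
      proof (cases "a = i")
        case ai: True
        have "((\<lambda>\<tau>. t 0 \<tau>) has_field_derivative deriv (t 0) 0) (at (0 + 0))"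
          using holomorphic_derivI[OF t_holo[of 0], of 0 UNIV] by simp
        from DERIV_chain2[OF this DERIV_add[OF DERIV_ident DERIV_ident]]
        have d: "deriv (\<lambda>\<tau>. t 0 (\<tau> + \<tau>)) 0 = deriv (t 0) 0 * 2" by (auto dest: DERIV_imp_deriv)
        have "(\<lambda>\<tau>. t 0 (\<tau> + \<tau>)) holomorphic_on UNIV"
          by (intro entire_compose[OF t_holo] holomorphic_intros)
        from simple_zero_quotient_limit[OF this _ t_holo t_0_0 deriv_t_0]
        have "((\<lambda>\<tau>. t 0 (\<tau> + \<tau>) / t 0 \<tau>) \<longlongrightarrow> 2) (at 0)"
          unfolding d using deriv_t_0 t_0_0 by simp
        moreover have "((\<lambda>\<tau>. vth_cof 0 \<tau> / c0) \<longlongrightarrow> c0 / c0) (at 0)"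
          using entire_isCont[OF vth_cof_holo, of 0 0] c0_nz unfolding isCont_def
          by (intro tendsto_divide tendsto_const) (simp_all add: c0_def)
        ultimately have "((\<lambda>\<tau>. vth_cof 0 \<tau> / c0 * (t 0 (\<tau> + \<tau>) / t 0 \<tau>)) \<longlongrightarrow> c0 / c0 * 2) (at 0)"
          by (intro tendsto_mult)
        then show ?thesis using ai aj sw c0_nz by (simp add: h_def[abs_def])
      next
        case ai: False
        have nz: "t ?x 0 \<noteq> 0" using t_0_nz nat_diff_mod_0_iff[OF assms(1,3)] ai by blast
        define g where "g \<tau> = (vth_cof 0 \<tau> / t ?x \<tau>) / c0 * t ?x (\<tau> + \<tau>)" for \<tau>
        have "isCont g 0" unfolding g_def[abs_def]
          by (intro continuous_intros t_isCont vth_cof_isCont) (use nz c0_nz in auto)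
        moreover have "g 0 = 1" using nz c0_nz by (simp add: g_def c0_def[symmetric])
        ultimately have "(g \<longlongrightarrow> 1) (at 0)" by (simp add: isCont_def)
        moreover have "eventually (\<lambda>\<tau>. g \<tau> = h \<tau>) (at 0)"
          using eventually_notin_L[of 0]
        proof eventually_elim
          case (elim \<tau>)
          have nz2: "t ?x \<tau> \<noteq> 0" "t 0 \<tau> \<noteq> 0" using elim t_notin_L[of \<tau>] by auto
          have "vth_cof ?x \<tau> * t ?x \<tau> = t 0 \<tau> * vth_cof 0 \<tau>"
            using vth_split[of \<tau> ?x] vth_split[of \<tau> 0] by (simp add: mult_ac)
          then have "vth_cof ?x \<tau> = t 0 \<tau> * vth_cof 0 \<tau> / t ?x \<tau>"
            by (rule eq_divide_imp[OF nz2(1)])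
          then show ?case using aj nz2 by (simp add: g_def h_def)
        qed
        ultimately have "(h \<longlongrightarrow> 1) (at 0)" by (rule Lim_transform_eventually)
        then show ?thesis using ai aj sw by simp
      qed
    qed
    ultimately show ?thesis by (rule Lim_transform_eventually[rotated])
  qed
qed

lemma flip_mat_entry:
  assumes "p < n * n" "q < n * n"
  shows "flip_mat n c $$ (p, q) = of_bool (p div n = q div n \<and> p mod n = q mod n) + c * of_bool (p div n = q mod n \<and> p mod n = q div n)"
proof -
  have 1: "p = q \<longleftrightarrow> p div n = q div n \<and> p mod n = q mod n" by (metis div_mod_decomp)
  obtain i j where ij: "i < n" "j < n" "q = i * n + j" using assms(2) by (rule pair_index_cases)
  obtain a b where ab: "a < n" "b < n" "p = a * n + b" using assms(1) by (rule pair_index_cases)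
  have 2: "p = swap_index n q \<longleftrightarrow> p div n = q mod n \<and> p mod n = q div n"
    using ij ab by (simp add: swap_index_pair pair_index_eq_iff)
  show ?thesis using assms by (simp add: flip_mat_def 2 flip: 1)
qed

end

section \<open>Constancy of the rank off (1/2n)\<Lambda>\<close>

context theta_coprime
begin

lemma R_mat_limit_0:
  assumes "p < n * n" "q < n * n"
  shows "((\<lambda>\<tau>. R_mat n k \<eta> \<tau> \<tau> $$ (p, q)) \<longlongrightarrow> flip_mat n (- 1) $$ (p, q)) (at 0)"
    and "((\<lambda>\<tau>. R_mat n k \<eta> \<tau> (- \<tau>) $$ (p, q)) \<longlongrightarrow> flip_mat n 1 $$ (p, q)) (at 0)"
proof -
  have b: "p div n < n" "p mod n < n" "q div n < n" "q mod n < n"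
    using assms n_pos by (auto simp: less_mult_imp_div_less)
  show "((\<lambda>\<tau>. R_mat n k \<eta> \<tau> \<tau> $$ (p, q)) \<longlongrightarrow> flip_mat n (- 1) $$ (p, q)) (at 0)"
    unfolding R_mat_entry[OF assms] flip_mat_entry[OF assms] by (rule R_entry_limit_minus[OF b])
  show "((\<lambda>\<tau>. R_mat n k \<eta> \<tau> (- \<tau>) $$ (p, q)) \<longlongrightarrow> flip_mat n 1 $$ (p, q)) (at 0)"
    unfolding R_mat_entry[OF assms] flip_mat_entry[OF assms] by (rule R_entry_limit_plus[OF b])
qed

abbreviation "L2 \<equiv> frac_lattice (2 * n) \<eta>"

lemma double_in_L_iff: "\<tau> + \<tau> \<in> L \<longleftrightarrow> \<tau> \<in> L2"
proof -
  interpret two: theta_level \<eta> "2 * n" by unfold_locales (use n_pos in simp)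
  have "N * (\<tau> + \<tau>) = of_nat (2 * n) * \<tau>" by simp
  then show ?thesis unfolding L_iff two.L_iff by (simp only:)
qed

lemma L_subset_L2: "\<tau> \<in> L \<Longrightarrow> \<tau> \<in> L2"
  using double_in_L_iff L_add by blast

text \<open>\<open>L2\<close> is the lattice \<open>L\<close> of level \<open>2 * n\<close>, hence
  the zero set of a nonzero entire function.\<close>

lemma eventually_notin_L2: "eventually (\<lambda>w. w \<notin> L2) (at z)"
proof -
  interpret two: theta_level \<eta> "2 * n" by unfold_locales (use n_pos in simp)
  show ?thesis by (rule two.eventually_notin_L)
qed

lemma rank_sum_le: "\<tau> \<notin> L2 \<Longrightarrow>
  vec_space.rank (n * n) (R_mat n k \<eta> \<tau> \<tau>) + vec_space.rank (n * n) (R_mat n k \<eta> \<tau> (- \<tau>)) \<le> n * n"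
proof -
  assume \<tau>: "\<tau> \<notin> L2"
  interpret theta_tau \<eta> n k \<tau> by unfold_locales (use \<tau> L_subset_L2 in blast)
  show ?thesis by (rule R_mat_rank_sum(1)) (use \<tau> double_in_L_iff in simp)
qed

lemma rank_locally_constant:
  assumes "\<tau> \<notin> L2"
  shows "eventually (\<lambda>w. vec_space.rank (n * n) (R_mat n k \<eta> w w) = vec_space.rank (n * n) (R_mat n k \<eta> \<tau> \<tau>)) (at \<tau>)"
proof -
  have tL: "\<tau> \<notin> L" using assms L_subset_L2 by blast
  interpret theta_tau \<eta> n k \<tau> by unfold_locales (rule tL)
  obtain U W where UW: "U \<in> carrier_mat (n * n) (n * n)" "W \<in> carrier_mat (n * n) (n * n)"
      "det (R_mat n k \<eta> \<tau> \<tau> * U + W * R_mat n k \<eta> \<tau> (- \<tau>)) \<noteq> 0"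
    using R_mat_rank_sum(2) assms double_in_L_iff by blast
  have ev: "eventually (\<lambda>w. vec_space.rank (n * n) (R_mat n k \<eta> w w) + vec_space.rank (n * n) (R_mat n k \<eta> w (- w)) \<le> n * n) (at \<tau>)"
    using eventually_notin_L2[of \<tau>] by eventually_elim (rule rank_sum_le)
  show ?thesis
  proof (rule eventually_rank_eq[OF _ _ _ _ UW(1,2) rank_sum_le[OF assms] UW(3) _ _ ev])
    fix p q assume pq: "p < n * n" "q < n * n"
    show "((\<lambda>w. R_mat n k \<eta> w w $$ (p, q)) \<longlongrightarrow> R_mat n k \<eta> \<tau> \<tau> $$ (p, q)) (at \<tau>)"
      unfolding R_mat_entry[OF pq] using R_entry_isCont(1)[OF tL] by (simp add: isCont_def)
    show "((\<lambda>w. R_mat n k \<eta> w (- w) $$ (p, q)) \<longlongrightarrow> R_mat n k \<eta> \<tau> (- \<tau>) $$ (p, q)) (at \<tau>)"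
      unfolding R_mat_entry[OF pq] using R_entry_isCont(2)[OF tL] by (simp add: isCont_def)
  qed simp_all
qed

text \<open>The origin lies in \<open>L2\<close>, where denominators of R vanish, so the limits 1 -
  P and 1 + P take the place of values, with both auxiliary matrices equal to 1.\<close>

lemma rank_near_0:
  "eventually (\<lambda>w. vec_space.rank (n * n) (R_mat n k \<eta> w w) = n choose 2) (at 0)"
proof -
  have ev: "eventually (\<lambda>w. vec_space.rank (n * n) (R_mat n k \<eta> w w) + vec_space.rank (n * n) (R_mat n k \<eta> w (- w)) \<le> n * n) (at 0)"
    using eventually_notin_L2[of 0] by eventually_elim (rule rank_sum_le)
  show ?thesis
    using eventually_rank_eq[OF R_mat_carrier R_mat_carrier flip_mat_carrier flip_mat_carrier one_carrier_mat one_carrier_mat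
        rank_flip_mats(2,3) R_mat_limit_0 ev]
    unfolding rank_flip_mats(1) .
qed

lemma countable_L2: "countable L2"
proof -
  have "lattice \<eta> = (\<lambda>(a, b). of_int a + of_int b * \<eta>) ` UNIV" by (auto simp: lattice_def)
  then show ?thesis by (simp add: frac_lattice_def)
qed

lemma rank_R_mat:
  assumes "\<tau> \<notin> L2"
  shows "vec_space.rank (n * n) (R_mat n k \<eta> \<tau> \<tau>) = n choose 2"
proof -
  have conn: "connected (- L2)"
    by (intro path_connected_imp_connected path_connected_complement_countable countable_L2) simp
  have "eventually (\<lambda>w. w \<notin> L2 \<and> vec_space.rank (n * n) (R_mat n k \<eta> w w) = n choose 2) (at 0)"
    using eventually_notin_L2[of 0] rank_near_0 by eventually_elim simp
  then obtain w where w: "w \<notin> L2" "vec_space.rank (n * n) (R_mat n k \<eta> w w) = n choose 2"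
    using eventually_happens[of _ "at (0::complex)"] by auto
  have "vec_space.rank (n * n) (R_mat n k \<eta> \<tau> \<tau>) = vec_space.rank (n * n) (R_mat n k \<eta> w w)"
  proof (rule connected_local_const[OF conn])
    show "\<forall>a\<in>- L2. eventually (\<lambda>b. vec_space.rank (n * n) (R_mat n k \<eta> a a) = vec_space.rank (n * n) (R_mat n k \<eta> b b)) (at a within - L2)"
    proof
      fix a assume "a \<in> - L2"
      then have "eventually (\<lambda>b. vec_space.rank (n * n) (R_mat n k \<eta> b b) = vec_space.rank (n * n) (R_mat n k \<eta> a a)) (at a)"
        by (intro rank_locally_constant) simp
      then have "eventually (\<lambda>b. vec_space.rank (n * n) (R_mat n k \<eta> b b) = vec_space.rank (n * n) (R_mat n k \<eta> a a)) (at a within - L2)"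
        by (rule filter_leD[OF at_le[of "- L2" UNIV], rotated]) simp
      then show "eventually (\<lambda>b. vec_space.rank (n * n) (R_mat n k \<eta> a a) = vec_space.rank (n * n) (R_mat n k \<eta> b b)) (at a within - L2)"
        by eventually_elim simp
    qed
  qed (use assms w in auto)
  then show ?thesis using w by simp
qed

section \<open>Translation by points of (1/n)\<Lambda>\<close>

lemma t_translate:
  assumes "\<zeta> \<in> L"
  shows "\<exists>p q E. (\<forall>z. isCont E z \<and> E z \<noteq> 0) \<and> (\<forall>x z. t x (z + \<zeta>) = ee (of_int (x * p) / N) * E z * t (x + q) z)"
proof (rule L_induct[OF assms])
  show "\<exists>p q E. (\<forall>z. isCont E z \<and> E z \<noteq> 0) \<and> (\<forall>x z. t x (z + 0) = ee (of_int (x * p) / N) * E z * t (x + q) z)"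
    by (rule exI[of _ 0], rule exI[of _ 0], rule exI[of _ "\<lambda>_. 1"]) simp
next
  fix \<zeta> assume "\<exists>p q E. (\<forall>z. isCont E z \<and> E z \<noteq> 0) \<and> (\<forall>x z. t x (z + \<zeta>) = ee (of_int (x * p) / N) * E z * t (x + q) z)"
  then obtain p q E where E: "\<And>z. isCont E z" "\<And>z. E z \<noteq> 0"
    and IH: "\<And>x z. t x (z + \<zeta>) = ee (of_int (x * p) / N) * E z * t (x + q) z" by blast
  have ee_isCont: "isCont f z \<Longrightarrow> isCont (\<lambda>z. ee (f z)) z" for f z
    unfolding ee_def by (intro continuous_intros)
  show "\<exists>p q E. (\<forall>z. isCont E z \<and> E z \<noteq> 0) \<and> (\<forall>x z. t x (z + (\<zeta> + 1 / N)) = ee (of_int (x * p) / N) * E z * t (x + q) z)"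
  proof (intro exI conjI allI)
    fix x z
    have "t x (z + (\<zeta> + 1 / N)) = ee (of_int x / N) * t x (z + \<zeta>)"
      using t_plus_1n[of x "z + \<zeta>"] by (simp only: add.assoc)
    also have "\<dots> = (ee (of_int x / N) * ee (of_int (x * p) / N)) * E z * t (x + q) z" by (simp only: IH mult.assoc)
    also have "ee (of_int x / N) * ee (of_int (x * p) / N) = ee (of_int (x * (p + 1)) / N)"
      unfolding ee_add[symmetric] by (simp add: algebra_simps add_divide_distrib)
    finally show "t x (z + (\<zeta> + 1 / N)) = ee (of_int (x * (p + 1)) / N) * E z * t (x + q) z" .
  qed (rule E)+
  show "\<exists>p q E. (\<forall>z. isCont E z \<and> E z \<noteq> 0) \<and> (\<forall>x z. t x (z + (\<zeta> - 1 / N)) = ee (of_int (x * p) / N) * E z * t (x + q) z)"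
  proof (intro exI conjI allI)
    fix x z
    have "t x (z + \<zeta>) = ee (of_int x / N) * t x (z + (\<zeta> - 1 / N))"
      using t_plus_1n[of x "z + (\<zeta> - 1 / N)"] by (simp add: algebra_simps)
    then have "t x (z + (\<zeta> - 1 / N)) = (ee (of_int (x * p) / N) / ee (of_int x / N)) * E z * t (x + q) z"
      unfolding IH by (simp add: field_simps)
    also have "ee (of_int (x * p) / N) / ee (of_int x / N) = ee (of_int (x * (p - 1)) / N)"
      unfolding ee_diff[symmetric] by (simp add: algebra_simps diff_divide_distrib)
    finally show "t x (z + (\<zeta> - 1 / N)) = ee (of_int (x * (p - 1)) / N) * E z * t (x + q) z" .
  qed (rule E)+
  show "\<exists>p q E. (\<forall>z. isCont E z \<and> E z \<noteq> 0) \<and> (\<forall>x z. t x (z + (\<zeta> + \<eta> / N)) = ee (of_int (x * p) / N) * E z * t (x + q) z)"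
  proof (intro exI conjI allI)
    fix x z
    have "t x (z + (\<zeta> + \<eta> / N)) = ee (shift_const - (z + \<zeta>)) * t (x + 1) (z + \<zeta>)"
      using t_plus_etan[of x "z + \<zeta>"] by (simp only: add.assoc)
    also have "\<dots> = ee (shift_const - (z + \<zeta>)) * ee (of_int ((x + 1) * p) / N) * E z * t (x + 1 + q) z" by (simp only: IH mult.assoc)
    \<comment> \<open>Raising the index by one costs the factor \<open>ee (of_int p / N)\<close>,
      which does not depend on \<open>x\<close> and can be moved into the common factor
      \<open>E\<close>.\<close>
    also have "ee (of_int ((x + 1) * p) / N) = ee (of_int (x * p) / N) * ee (of_int p / N)"
      unfolding ee_add[symmetric] by (simp add: algebra_simps add_divide_distrib)
    finally show "t x (z + (\<zeta> + \<eta> / N)) = ee (of_int (x * p) / N) * (ee (shift_const - (z + \<zeta>)) * ee (of_int p / N) * E z) * t (x + (1 + q)) z"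
      by (simp only: mult_ac add.assoc)
  qed (auto intro!: continuous_intros E ee_isCont)
  show "\<exists>p q E. (\<forall>z. isCont E z \<and> E z \<noteq> 0) \<and> (\<forall>x z. t x (z + (\<zeta> - \<eta> / N)) = ee (of_int (x * p) / N) * E z * t (x + q) z)"
  proof (intro exI conjI allI)
    fix x z
    have "t (x - 1) (z + \<zeta>) = ee (shift_const - (z + \<zeta> - \<eta> / N)) * t x (z + (\<zeta> - \<eta> / N))"
      using t_plus_etan[of "x - 1" "z + (\<zeta> - \<eta> / N)"] by (simp add: algebra_simps)
    then have "t x (z + (\<zeta> - \<eta> / N)) = t (x - 1) (z + \<zeta>) / ee (shift_const - (z + \<zeta> - \<eta> / N))" by simp
    also have "\<dots> = ee (of_int ((x - 1) * p) / N) * E z * t (x - 1 + q) z / ee (shift_const - (z + \<zeta> - \<eta> / N))" by (simp only: IH)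
    also have "ee (of_int ((x - 1) * p) / N) = ee (of_int (x * p) / N) * ee (- of_int p / N)"
      unfolding ee_add[symmetric] by (simp add: algebra_simps diff_divide_distrib)
    finally show "t x (z + (\<zeta> - \<eta> / N)) = ee (of_int (x * p) / N) * (ee (- of_int p / N) * E z / ee (shift_const - (z + \<zeta> - \<eta> / N))) * t (x + (q - 1)) z"
      by (simp add: mult_ac algebra_simps)
  qed (auto intro!: continuous_intros E ee_isCont)
qed

lemma R_entry_mod:
  "R_entry k \<tau> z a (b mod int n) (i mod int n) j = R_entry k \<tau> z a b i j"
proof -
  have 1: "(a + b mod int n) mod int n = (i mod int n + j) mod int n \<longleftrightarrow> (a + b) mod int n = (i + j) mod int n"
    by (simp add: mod_add_left_eq mod_add_right_eq)
  have 2: "t (a - i mod int n) = t (a - i)" by (rule t_cong) (simp add: mod_diff_right_eq)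
  have 3: "t (a - i mod int n + y) = t (a - i + y)" for y
    by (rule t_cong) (metis mod_add_left_eq mod_diff_right_eq)
  show ?thesis unfolding R_entry_def 1 2 3 ..
qed

text \<open>Numerator over denominator leaves the root of unity belonging to k (j - a), a product of
  a row factor and a column factor. The index shift \<open>q\<close> is absorbed by
  \<open>i - q\<close>, and \<open>b - q\<close> then keeps the index sums equal. All the rest is
  the common factor \<open>h \<tau>\<close>.\<close>

lemma R_entry_translate:
  assumes "\<zeta> \<in> L"
  obtains p q :: int and h :: "complex \<Rightarrow> complex" where "isCont h 0" "h 0 \<noteq> 0"
    "\<And>\<tau> a b i j. R_entry k \<tau> (\<tau> + \<zeta>) a b i j =
       h \<tau> * (ee (- of_int (int k * a * p) / N) * R_entry k \<tau> \<tau> a (b - q) (i - q) j * ee (of_int (int k * j * p) / N))"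
proof -
  obtain p q E where E: "\<And>z. isCont E z" "\<And>z. E z \<noteq> 0"
    and T: "\<And>x z. t x (z + - \<zeta>) = ee (of_int (x * p) / N) * E z * t (x + q) z"
    using t_translate[OF L_uminus[OF assms]] by blast
  define C where "C = (\<Prod>x\<in>{0..<int n}. ee (of_int (x * p) / N))"
  have C: "C \<noteq> 0" by (simp add: C_def)
  have V: "vth (z + - \<zeta>) = C * E z ^ n * vth z" for z
    unfolding vth_def[of "z + - \<zeta>"] T by (simp add: prod.distrib C_def prod_residues_shift)
  \<comment> \<open>\<open>E\<close> enters n times through \<open>vth\<close>, once through the
    numerator, whose argument is -\<zeta> = 0 - \<zeta> for every \<tau>, and once inversely through
    the denominator.\<close>
  define h where "h \<tau> = C * E (- \<tau>) ^ n * E 0 / E (- \<tau>)" for \<tau>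
  have cE: "isCont (\<lambda>\<tau>. E (- \<tau>)) 0"
    by (rule isCont_o2[OF _ E(1)]) (intro continuous_intros)
  have "isCont h 0" unfolding h_def[abs_def]
    by (intro continuous_intros cE E(2))
  moreover have "h 0 \<noteq> 0" using C E(2) by (simp add: h_def)
  moreover have "R_entry k \<tau> (\<tau> + \<zeta>) a b i j =
       h \<tau> * (ee (- of_int (int k * a * p) / N) * R_entry k \<tau> \<tau> a (b - q) (i - q) j * ee (of_int (int k * j * p) / N))" for \<tau> a b i j
  proof -
    let ?x = "a - i" and ?y = "int k * (j - a)"
    have m: "- (\<tau> + \<zeta>) = - \<tau> + - \<zeta>" "- \<tau> + - \<zeta> + \<tau> = 0 + - \<zeta>" by simp_all
    have c: "(a + (b - q)) mod int n = (i - q + j) mod int n \<longleftrightarrow> (a + b) mod int n = (i + j) mod int n"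
      by (simp add: mod_eq_dvd_iff algebra_simps)
    have e1: "ee (of_int ((?x + ?y) * p) / N) = ee (of_int (?x * p) / N) * (ee (- of_int (int k * a * p) / N) * ee (of_int (int k * j * p) / N))"
      unfolding ee_add[symmetric] by (rule arg_cong[of _ _ ee]) (simp add: add_divide_distrib diff_divide_distrib algebra_simps)
    have e2: "?x + ?y + q = a - (i - q) + ?y" "?x + q = a - (i - q)" by simp_all
    show ?thesis
      unfolding R_entry_def c m T V e1 e2 h_def using E(2)[of "- \<tau>"] ee_nz by (simp add: mult_ac)
  qed
  ultimately show ?thesis using that by blast
qed

lemma rank_R_plus_mat:
  assumes "\<zeta> \<in> L"
  shows "vec_space.rank (n * n) (R_plus_mat n k \<eta> \<zeta>) = n choose 2"
proof -
  obtain p q h where h: "isCont h 0" "h 0 \<noteq> 0"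
    and R: "\<And>\<tau> a b i j. R_entry k \<tau> (\<tau> + \<zeta>) a b i j =
       h \<tau> * (ee (- of_int (int k * a * p) / N) * R_entry k \<tau> \<tau> a (b - q) (i - q) j * ee (of_int (int k * j * p) / N))"
    by (rule R_entry_translate[OF assms]) blast
  \<comment> \<open>Translation of residues by \<open>c\<close>. It acts on the second index of a
    row through \<open>f\<close> and on the first index of a column through \<open>g\<close>,
    matching \<open>b - q\<close> and \<open>i - q\<close>.\<close>
  define sh where "sh c b = nat ((int b + c) mod int n)" for c :: int and b :: nat
  have sh: "sh c b < n" "int (sh c b) = (int b + c) mod int n" for c b
    using n_pos by (auto simp: sh_def nat_less_iff)
  have sh_inv: "sh c (sh (- c) b) = b" "sh (- c) (sh c b) = b" if "b < n" for c b
    using that by (simp_all add: sh_def[of _ "sh _ _"] sh(2) mod_add_left_eq mod_diff_left_eq)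
  define f where "f c x = (x div n) * n + sh c (x mod n)" for c x
  define g where "g c y = sh c (y div n) * n + y mod n" for c y
  define u where "u x = h 0 * ee (- of_int (int k * int (x div n) * p) / N)" for x
  define v where "v y = ee (of_int (int k * int (y mod n) * p) / N)" for y
  have fg: "f c x < n * n" "g c x < n * n" if "x < n * n" for c x
    using that n_pos sh(1) unfolding f_def g_def by (auto intro!: pair_index_less simp: less_mult_imp_div_less)
  have fdm: "f c x div n = x div n" "f c x mod n = sh c (x mod n)" "g c x div n = sh c (x div n)" "g c x mod n = x mod n" for c x
    using sh(1) n_pos by (simp_all add: f_def g_def)
  have inv: "f (- q) (f q x) = x" "g (- q) (g q x) = x" if "x < n * n" for x
  proof -
    have "x div n < n" "x mod n < n" using that n_pos by (auto simp: less_mult_imp_div_less)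
    then show "f (- q) (f q x) = x" "g (- q) (g q x) = x"
      using sh_inv(2) by (simp_all add: f_def[of "- q"] g_def[of "- q"] fdm)
  qed
  have "R_plus_mat n k \<eta> \<zeta> = mat (n * n) (n * n) (\<lambda>(x, y). u x * flip_mat n (- 1) $$ (f (- q) x, g (- q) y) * v y)"
  proof (rule eq_matI)
    fix x y assume "x < dim_row (mat (n * n) (n * n) (\<lambda>(x, y). u x * flip_mat n (- 1) $$ (f (- q) x, g (- q) y) * v y))"
      "y < dim_col (mat (n * n) (n * n) (\<lambda>(x, y). u x * flip_mat n (- 1) $$ (f (- q) x, g (- q) y) * v y))"
    then have xy: "x < n * n" "y < n * n" by auto
    then have b: "x div n < n" "x mod n < n" "y div n < n" "y mod n < n"
      using n_pos by (auto simp: less_mult_imp_div_less)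
    have e: "R_coeff n k \<eta> \<tau> (\<tau> + \<zeta>) (x div n) (x mod n) (y div n) (y mod n)
       = h \<tau> * (ee (- of_int (int k * int (x div n) * p) / N) * R_mat n k \<eta> \<tau> \<tau> $$ (f (- q) x, g (- q) y) * ee (of_int (int k * int (y mod n) * p) / N))" for \<tau>
    proof -
      have "R_mat n k \<eta> \<tau> \<tau> $$ (f (- q) x, g (- q) y) = R_entry k \<tau> \<tau> (int (x div n)) (int (x mod n) - q) (int (y div n) - q) (int (y mod n))"
        unfolding R_mat_entry[OF fg(1)[OF xy(1)] fg(2)[OF xy(2)]] fdm sh(2) R_entry_mod by simp
      then show ?thesis unfolding R_coeff_eq[OF b] R by simp
    qed
    have "((\<lambda>\<tau>. h \<tau> * (ee (- of_int (int k * int (x div n) * p) / N) * R_mat n k \<eta> \<tau> \<tau> $$ (f (- q) x, g (- q) y) * ee (of_int (int k * int (y mod n) * p) / N)))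
      \<longlongrightarrow> h 0 * (ee (- of_int (int k * int (x div n) * p) / N) * flip_mat n (- 1) $$ (f (- q) x, g (- q) y) * ee (of_int (int k * int (y mod n) * p) / N))) (at 0)"
      using h(1) unfolding isCont_def
      by (intro tendsto_mult tendsto_const R_mat_limit_0(1) fg xy)
    then have "Lim (at 0) (\<lambda>\<tau>. R_coeff n k \<eta> \<tau> (\<tau> + \<zeta>) (x div n) (x mod n) (y div n) (y mod n))
       = u x * flip_mat n (- 1) $$ (f (- q) x, g (- q) y) * v y"
      unfolding e u_def v_def by (subst tendsto_Lim[OF at_neq_bot]) (auto simp: mult_ac)
    then show "R_plus_mat n k \<eta> \<zeta> $$ (x, y) = mat (n * n) (n * n) (\<lambda>(x, y). u x * flip_mat n (- 1) $$ (f (- q) x, g (- q) y) * v y) $$ (x, y)"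
      using xy by (simp add: R_plus_mat_def)
  qed (simp_all add: R_plus_mat_def)
  moreover have "vec_space.rank (n * n) (mat (n * n) (n * n) (\<lambda>(x, y). u x * flip_mat n (- 1) $$ (f (- q) x, g (- q) y) * v y))
      = vec_space.rank (n * n) (flip_mat n (- 1))"
    by (rule vec_space.rank_reindex_eq[OF flip_mat_carrier, where f' = "f q" and g' = "g q"])
       (use fg inv h(2) in \<open>auto simp: u_def v_def\<close>)
  ultimately show ?thesis by (simp only: rank_flip_mats(1))
qed

end

theorem theorem5p10:
  fixes n k :: nat and \<eta> \<tau> :: complex
  assumes "n > k" and "k \<ge> 1" and "coprime n k"
    and "Im \<eta> > 0"
    and "\<tau> \<notin> frac_lattice (2 * n) \<eta> - frac_lattice n \<eta>"
  shows "dim_rel n k \<eta> \<tau> = n choose 2"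
proof -
  interpret theta_coprime \<eta> n k
    by unfold_locales (use assms in auto)
  show ?thesis
  proof (cases "\<tau> \<in> frac_lattice n \<eta>")
    case True
    then show ?thesis by (simp add: dim_rel_def rel_mat_def rank_R_plus_mat)
  next
    case False
    then show ?thesis using assms(5) by (simp add: dim_rel_def rel_mat_def rank_R_mat)
  qed
qed

end
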